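(* Fix $p\in(1,+\infty)$. Cheeger's inequality $F_p[E]\ge \frac1p$, among convex sets $E\in\mathbb{K}^N$, is saturated only asymptotically as $N\to+\infty$; that is, setting $m_N:=\inf_{E\in\mathbb{K}^N}F_p[E]$, one has $$m_N>\frac1p\quad\text{for every integer }N\ge 1,\qquad\text{and}\qquad \lim_{N\to+\infty}m_N=\frac1p .$$
   Context: For $N\ge1$, $\mathbb{K}^N$ denotes the class of nonempty, open, bounded, convex subsets of $\mathbb{R}^N$. For a nonempty open bounded set $E\subseteq\mathbb{R}^N$: - the Cheeger constant is $h(E):=\inf\{P(A)/|A| : A\subseteq E \text{ measurable},\ |A|>0\}$, where $|A|$ is the Lebesgue measure and $P(A)$ the (De Giorgi) perimeter of $A$ in $\mathbb{R}^N$; - for $1<p<+\infty$, the first eigenvalue of the Dirichlet $p$-Laplacian is $\lambda_p(E):=\inf\{\int_E|\nabla u|^p\,dx : u\in W^{1,p}_0(E),\ \|u\|_{L^p(E)}=1\}$, where $W^{1,p}_0(E)$ is the closure of $C^\infty_c(E)$ with respect to the norm $\|u\|_p+\|\nabla u\|_p$; - $F_p[E]:=\lambda_p(E)^{1/p}/h(E)$. Cheeger's inequality is the known bound $F_p[E]\ge 1/p$, valid for every nonempty open bounded set $E\subseteq\mathbb{R}^N$. *)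

theory Defs
  imports "HOL-Analysis.Analysis"
begin

text \<open>
  The dimension \<open>N\<close> is quantified inside the theorem, so it cannot be a type.
  A point of \<open>\<real>\<^sup>N\<close> is a function \<open>nat \<Rightarrow> real\<close> that is extensional on \<open>{..<N}\<close>; this is the
  common carrier of the library's product topology and of its product measure.
  Functions on \<open>\<real>\<^sup>N\<close> are total HOL functions whose values off this carrier are irrelevant.
\<close>

type_synonym point = "nat \<Rightarrow> real"

definition euclid :: "nat \<Rightarrow> point topology" where
  "euclid N = product_topology (\<lambda>_. euclideanreal) {..<N}"

definition leb :: "nat \<Rightarrow> point measure" where
  "leb N = completion (\<Pi>\<^sub>M i\<in>{..<N}. lborel)"

definition leb_on :: "nat \<Rightarrow> point set \<Rightarrow> point measure" where
  "leb_on N E = restrict_space (leb N) E"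

definition enorm :: "nat \<Rightarrow> point \<Rightarrow> real" where
  "enorm N x = L2_set x {..<N}"

definition bounded_in :: "nat \<Rightarrow> point set \<Rightarrow> bool" where
  "bounded_in N E \<longleftrightarrow> (\<exists>r. \<forall>x\<in>E. enorm N x \<le> r)"

definition convex_in :: "nat \<Rightarrow> point set \<Rightarrow> bool" where
  "convex_in N E \<longleftrightarrow>
     (\<forall>x\<in>E. \<forall>y\<in>E. \<forall>t\<in>{0..1}. (\<lambda>i\<in>{..<N}. (1 - t) * x i + t * y i) \<in> E)"

definition open_convex_bodies :: "nat \<Rightarrow> point set set" where
  "open_convex_bodies N = {E. E \<noteq> {} \<and> openin (euclid N) E \<and> bounded_in N E \<and> convex_in N E}"


definition partial_deriv :: "nat \<Rightarrow> (point \<Rightarrow> real) \<Rightarrow> point \<Rightarrow> real" where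
  "partial_deriv i f x = deriv (\<lambda>t. f (x(i := t))) (x i)"

definition grad :: "(point \<Rightarrow> real) \<Rightarrow> point \<Rightarrow> point" where
  "grad f x = (\<lambda>i. partial_deriv i f x)"

definition divergence :: "nat \<Rightarrow> (point \<Rightarrow> point) \<Rightarrow> point \<Rightarrow> real" where
  "divergence N \<phi> x = (\<Sum>i<N. partial_deriv i (\<lambda>y. \<phi> y i) x)"

primrec Ck :: "nat \<Rightarrow> nat \<Rightarrow> (point \<Rightarrow> real) \<Rightarrow> bool" where
  "Ck N 0 f \<longleftrightarrow> continuous_map (euclid N) euclideanreal f"
| "Ck N (Suc k) f \<longleftrightarrow>
     continuous_map (euclid N) euclideanreal f \<and>
     (\<forall>i<N. (\<forall>x\<in>topspace (euclid N). (\<lambda>t. f (x(i := t))) differentiable at (x i)) \<and>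
            Ck N k (partial_deriv i f))"

definition supp :: "nat \<Rightarrow> (point \<Rightarrow> real) \<Rightarrow> point set" where
  "supp N f = euclid N closure_of {x \<in> topspace (euclid N). f x \<noteq> 0}"

definition Cinf_c :: "nat \<Rightarrow> point set \<Rightarrow> (point \<Rightarrow> real) set" where
  "Cinf_c N E = {f. (\<forall>k. Ck N k f) \<and> compactin (euclid N) (supp N f) \<and> supp N f \<subseteq> E}"

definition C1_c_fields :: "nat \<Rightarrow> (point \<Rightarrow> point) set" where
  "C1_c_fields N =
     {\<phi>. \<forall>i<N. Ck N 1 (\<lambda>x. \<phi> x i) \<and> compactin (euclid N) (supp N (\<lambda>x. \<phi> x i))}"


text \<open>
  The supremum may be infinite. Since the zero field is admissible, truncating negative
  integrals to 0 by \<open>ennreal\<close> does not change it.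
\<close>

definition perimeter :: "nat \<Rightarrow> point set \<Rightarrow> ennreal" where
  "perimeter N A =
     (SUP \<phi> \<in> {\<phi> \<in> C1_c_fields N. \<forall>x\<in>topspace (euclid N). enorm N (\<phi> x) \<le> 1}.
        ennreal (\<integral>x. divergence N \<phi> x \<partial>leb_on N A))"

text \<open>
  For nonempty open bounded \<open>E\<close> the infimum is finite, because \<open>E\<close> contains balls,
  so \<open>enn2real\<close> loses nothing.
\<close>

definition cheeger :: "nat \<Rightarrow> point set \<Rightarrow> real" where
  "cheeger N E =
     enn2real (INF A \<in> {A \<in> sets (leb N). A \<subseteq> E \<and> emeasure (leb N) A > 0}.
                 perimeter N A / emeasure (leb N) A)"


definition Lp :: "nat \<Rightarrow> real \<Rightarrow> point set \<Rightarrow> (point \<Rightarrow> real) set" where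
  "Lp N p E = {f \<in> borel_measurable (leb_on N E). integrable (leb_on N E) (\<lambda>x. \<bar>f x\<bar> powr p)}"

definition Lp_norm :: "nat \<Rightarrow> real \<Rightarrow> point set \<Rightarrow> (point \<Rightarrow> real) \<Rightarrow> real" where
  "Lp_norm N p E f = (\<integral>x. \<bar>f x\<bar> powr p \<partial>leb_on N E) powr (1 / p)"

definition weak_gradient :: "nat \<Rightarrow> point set \<Rightarrow> (point \<Rightarrow> real) \<Rightarrow> (point \<Rightarrow> point) \<Rightarrow> bool" where
  "weak_gradient N E u g \<longleftrightarrow>
     (\<forall>\<phi>\<in>Cinf_c N E. \<forall>i<N.
        (\<integral>x. u x * partial_deriv i \<phi> x \<partial>leb_on N E) = - (\<integral>x. g x i * \<phi> x \<partial>leb_on N E))"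

text \<open>
  Elements of \<open>W\<^sup>1\<^sup>,\<^sup>p(E)\<close> are represented as pairs \<open>(u, \<nabla>u)\<close>; the second component is determined
  by \<open>u\<close> up to null sets, and all integrals below are insensitive to null sets.
\<close>

definition W1p :: "nat \<Rightarrow> real \<Rightarrow> point set \<Rightarrow> ((point \<Rightarrow> real) \<times> (point \<Rightarrow> point)) set" where
  "W1p N p E =
     {(u, g). u \<in> Lp N p E \<and> (\<forall>i<N. (\<lambda>x. g x i) \<in> Lp N p E) \<and> weak_gradient N E u g}"

definition W1p_0 :: "nat \<Rightarrow> real \<Rightarrow> point set \<Rightarrow> ((point \<Rightarrow> real) \<times> (point \<Rightarrow> point)) set" where
  "W1p_0 N p E =
     {(u, g) \<in> W1p N p E. \<forall>\<epsilon>>0. \<exists>\<phi>\<in>Cinf_c N E.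
        Lp_norm N p E (\<lambda>x. u x - \<phi> x) +
        Lp_norm N p E (\<lambda>x. enorm N (\<lambda>i. g x i - grad \<phi> x i)) < \<epsilon>}"

definition eigenvalue_p :: "nat \<Rightarrow> real \<Rightarrow> point set \<Rightarrow> real" where
  "eigenvalue_p N p E =
     (INF (u, g) \<in> {(u, g) \<in> W1p_0 N p E. Lp_norm N p E u = 1}.
        \<integral>x. enorm N (g x) powr p \<partial>leb_on N E)"

definition F_p :: "nat \<Rightarrow> real \<Rightarrow> point set \<Rightarrow> real" where
  "F_p N p E = eigenvalue_p N p E powr (1 / p) / cheeger N E"

definition m_p :: "real \<Rightarrow> nat \<Rightarrow> real" where
  "m_p p N = (INF E \<in> open_convex_bodies N. F_p N p E)"

end

theory Submission
  imports Defs
begin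

text \<open>
  Throughout, \<open>E\<close> is a nonempty bounded open subset of \<open>\<real>\<^sup>N\<close> with Cheeger constant \<open>h\<close>. The constant
  \<open>h\<close> is also the best constant in \<open>h \<integral>w \<le> \<integral>|\<nabla>w|\<close> for nonnegative \<open>C\<^sup>1\<close> functions \<open>w\<close> with compact support
  in \<open>E\<close> (\<open>cheeger_bound_L1\<close> is the half that matters). With \<open>w = |u|\<^sup>p\<close> and Hoelder's inequality this
  gives Cheeger's inequality \<open>h \<parallel>u\<parallel>\<^sub>p \<le> p \<parallel>\<nabla>u\<parallel>\<^sub>p\<close>, and near equality forces \<open>|\<nabla>w|\<close> to be close to \<open>h w\<close>
  in \<open>L\<^sup>1\<close>.

  The strict inequality holds because, in a fixed dimension, \<open>|\<nabla>w|\<close> cannot be close to \<open>h w\<close>: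
  \<open>\<integral>||\<nabla>w| - h w| \<ge> e h \<integral>w\<close> with \<open>e > 0\<close> depending only on \<open>N\<close> (\<open>improved_cheeger_L1\<close>). Suppose the left
  side is small. Applying the functional inequality to \<open>G(w)\<close> shows that \<open>\<integral>(G(w) - w G'(w))\<close> is small
  for every admissible \<open>G\<close>, and \<open>G(t) = t ln (1 + 2\<beta> / (\<alpha> + t))\<close> turns this into the statement that
  \<open>w\<close> has little mass on the levels between \<open>\<alpha>\<close> and \<open>2\<beta>\<close>, up to a factor logarithmic in \<open>\<beta> / \<alpha>\<close>.
  Levels below \<open>\<alpha>\<close> carry mass at most \<open>\<alpha>\<close> times the measure of the support. Levels above \<open>\<beta>\<close> live on a set
  of small measure, where functions satisfy \<open>\<integral>|\<nabla>f| \<ge> 8 h \<integral>|f|\<close> (\<open>small_support_L1_le\<close>), so they carry little mass as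
  well. Thus \<open>e\<close> is of the order of one over the logarithm of \<open>h\<^sup>N |supp w|\<close>. To remove the support, \<open>w\<close> is
  multiplied by cut-off functions of radius \<open>\<rho> / h\<close>, which costs an error of order \<open>1 / \<rho>\<close>, whereas
  \<open>e\<close> only decreases like \<open>1 / ln \<rho>\<close>; a large \<open>\<rho>\<close> depending on \<open>N\<close> and nothing else does the job.
  A quantitative form of Young's inequality then transports the gain to the exponent \<open>p\<close>
  (\<open>improved_cheeger_Lp\<close>), and density gives it for the eigenvalue (\<open>F_p_lower_bound\<close>), uniformly
  in \<open>E\<close>. Hence \<open>m_N > 1 / p\<close>.

  For the limit it remains to bound \<open>m_N\<close> from above by \<open>F\<^sub>p\<close> of the unit ball. The field \<open>x\<close> has divergence
  \<open>N\<close> and length at most one on the ball, so \<open>h \<ge> N\<close>. For the eigenvalue, the function \<open>|x|\<close> to the power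
  \<open>-N/p\<close>, cut off smoothly in the variable \<open>-N ln |x|\<close> on a scale \<open>L\<close>, has \<open>p\<close>-Rayleigh quotient at most
  \<open>(N/p)\<^sup>p\<close> times a factor that is as close to one as desired if first \<open>L\<close> and then \<open>N\<close> is taken large
  (\<open>eigenvalue_ball_le\<close>); the error is controlled uniformly because the measure \<open>|x|\<close> to the power \<open>-N\<close>
  is invariant under dilations.
\<close>

section \<open>Lebesgue measure and affine maps\<close>

abbreviation pts :: "nat \<Rightarrow> point set" where
  "pts N \<equiv> PiE {..<N} (\<lambda>_. UNIV)"

text \<open>
  The Borel version of \<open>leb\<close>. Borel functions have the same integral for both measures, while Fubini's
  theorem and the transformation rules concern the product itself and not its completion.
\<close>

abbreviation lebB :: "nat \<Rightarrow> point measure" where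
  "lebB N \<equiv> (\<Pi>\<^sub>M i\<in>{..<N}. lborel)"

interpretation lb: product_sigma_finite "\<lambda>_::nat. lborel :: real measure"
  by standard

lemma sigma_finite_lebB: "sigma_finite_measure (lebB N)"
  by (rule lb.sigma_finite) simp

lemma topspace_euclid [simp]: "topspace (euclid N) = pts N"
  by (simp add: euclid_def)

lemma space_lebB [simp]: "space (lebB N) = pts N"
  by (simp add: space_PiM)

lemma upd_pts: "x \<in> pts N \<Longrightarrow> i < N \<Longrightarrow> x(i := t) \<in> pts N"
  by (auto simp: PiE_iff extensional_def)

lemma continuous_map_extend:
  "continuous_map euclidean (euclid N) (\<lambda>x::point. restrict x {..<N})"
  unfolding euclid_def
  by (subst continuous_map_componentwise)
     (auto intro!: continuous_intros continuous_on_product_coordinates)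

lemma measurable_extend:
  "(\<lambda>x i. if i < N then x i else 0) \<in> lebB N \<rightarrow>\<^sub>M (borel :: point measure)"
proof -
  have "(\<lambda>x i. if i < N then x i else 0) \<in> lebB N \<rightarrow>\<^sub>M (\<Pi>\<^sub>M i\<in>UNIV. (borel :: real measure))"
  proof (rule measurable_PiM_single')
    show "(\<lambda>x. if i < N then x i else 0) \<in> borel_measurable (lebB N)" for i :: nat
    proof (cases "i < N")
      case True
      then have "(\<lambda>x. x i) \<in> lebB N \<rightarrow>\<^sub>M lborel"
        by (intro measurable_component_singleton) auto
      with True show ?thesis by simp
    qed simp
  qed simp
  then show ?thesis
    by (simp add: sets_PiM_equal_borel cong: measurable_cong_sets)
qed

lemma restrict_extend: "x \<in> pts N \<Longrightarrow> restrict (\<lambda>i. if i < N then x i else 0) {..<N} = x"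
  by (auto simp: PiE_iff extensional_def restrict_def fun_eq_iff)

text \<open>
  The carrier is a set of extensional functions and not a type. Extending points by zero embeds it
  measurably into the type of all functions, and \<open>f\<close> composed with restriction is continuous there.
\<close>

lemma borel_measurable_continuous_map:
  assumes "continuous_map (euclid N) euclideanreal f"
  shows "f \<in> borel_measurable (lebB N)"
proof -
  have "continuous_map euclidean euclideanreal (f \<circ> (\<lambda>x::point. restrict x {..<N}))"
    by (rule continuous_map_compose[OF continuous_map_extend assms])
  then have "(f \<circ> (\<lambda>x::point. restrict x {..<N})) \<in> borel_measurable borel"
    by (intro borel_measurable_continuous_onI) simp
  from measurable_compose[OF measurable_extend this]
  show ?thesis
    by (rule measurable_cong[THEN iffD1, rotated]) (simp add: restrict_extend)
qed

lemma openin_imp_sets: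
  assumes "openin (euclid N) U"
  shows "U \<in> sets (lebB N)"
proof -
  have "openin euclidean ((\<lambda>x::point. restrict x {..<N}) -` U)"
    using openin_continuous_map_preimage[OF continuous_map_extend assms]
    by (simp add: vimage_def)
  then have "(\<lambda>x::point. restrict x {..<N}) -` U \<in> sets borel"
    by simp
  from measurable_sets[OF measurable_extend this]
  have "(\<lambda>x i. if i < N then x i else 0) -` (\<lambda>x::point. restrict x {..<N}) -` U \<inter> pts N \<in> sets (lebB N)"
    by simp
  moreover have "(\<lambda>x i. if i < N then x i else 0) -` (\<lambda>x::point. restrict x {..<N}) -` U \<inter> pts N = U"
    using openin_subset[OF assms] by (auto simp: restrict_extend)
  ultimately show ?thesis by simp
qed

definition aff :: "nat \<Rightarrow> point \<Rightarrow> real \<Rightarrow> point \<Rightarrow> point" where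
  "aff N z c x = (\<lambda>i\<in>{..<N}. z i + c * x i)"

lemma aff_pts [simp]: "aff N z c x \<in> pts N"
  by (simp add: aff_def)

lemma measurable_aff [measurable]: "aff N z c \<in> lebB N \<rightarrow>\<^sub>M lebB N"
  unfolding aff_def by (intro measurable_restrict) measurable

lemma emeasure_lborel_affine_vimage:
  assumes "c \<noteq> 0" and [measurable]: "A \<in> sets borel"
  shows "emeasure lborel {x::real. t + c * x \<in> A} = emeasure lborel A / ennreal \<bar>c\<bar>"
proof -
  have "emeasure lborel A = (\<integral>\<^sup>+x. indicator A x \<partial>lborel)"
    by simp
  also have "\<dots> = ennreal \<bar>c\<bar> * (\<integral>\<^sup>+x. indicator A (t + c * x) \<partial>lborel)"
    by (rule nn_integral_real_affine) (use assms in auto)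
  also have "(\<integral>\<^sup>+x. indicator A (t + c * x) \<partial>lborel) = (\<integral>\<^sup>+x. indicator {x. t + c * x \<in> A} x \<partial>lborel)"
    by (intro nn_integral_cong) (auto simp: indicator_def)
  also have "\<dots> = emeasure lborel {x::real. t + c * x \<in> A}"
    by (rule nn_integral_indicator) measurable
  finally show ?thesis
    using assms by (metis abs_ge_zero abs_eq_0 ennreal_eq_0_iff ennreal_neq_top le_numeral_extra(3)
        mult.commute mult_divide_eq_ennreal order_antisym)
qed

text \<open>
  Dilations and translations at once: with \<open>c = 1\<close> this is translation invariance, with \<open>c = -1\<close>
  reflection, and general \<open>c\<close> serves for the scale invariance used on balls.
\<close>

lemma distr_aff:
  assumes "c \<noteq> 0"
  shows "scale_measure (ennreal (\<bar>c\<bar> ^ N)) (distr (lebB N) (lebB N) (aff N z c)) = lebB N"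
proof (rule lb.PiM_eqI)
  fix A :: "nat \<Rightarrow> real set"
  assume A: "\<And>i. i \<in> {..<N} \<Longrightarrow> A i \<in> sets lborel"
  have PA: "PiE {..<N} A \<in> sets (lebB N)"
    using A by (intro sets_PiM_I_finite) auto
  have sets: "{x. z i + c * x \<in> A i} \<in> sets lborel" if "i < N" for i
  proof -
    have [measurable]: "A i \<in> sets borel" using A that by auto
    show ?thesis by simp
  qed
  have "emeasure (distr (lebB N) (lebB N) (aff N z c)) (PiE {..<N} A)
      = emeasure (lebB N) (aff N z c -` PiE {..<N} A \<inter> space (lebB N))"
    by (rule emeasure_distr[OF measurable_aff PA])
  also have "aff N z c -` PiE {..<N} A \<inter> space (lebB N) = PiE {..<N} (\<lambda>i. {x. z i + c * x \<in> A i})"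
  proof (rule set_eqI)
    fix x
    have "aff N z c x \<in> PiE {..<N} A \<longleftrightarrow> (\<forall>i<N. z i + c * x i \<in> A i)"
      unfolding aff_def PiE_iff by (simp add: Ball_def)
    then show "x \<in> aff N z c -` PiE {..<N} A \<inter> space (lebB N) \<longleftrightarrow>
        x \<in> PiE {..<N} (\<lambda>i. {x. z i + c * x \<in> A i})"
      unfolding space_lebB
      by (simp only: PiE_iff Ball_def lessThan_iff mem_Collect_eq UNIV_I vimage_eq Int_iff
          simp_thms conj_commute)
  qed
  also have "emeasure (lebB N) \<dots> = (\<Prod>i<N. emeasure lborel {x. z i + c * x \<in> A i})"
    by (rule lb.emeasure_PiM) (use sets in auto)
  also have "\<dots> = (\<Prod>i<N. emeasure lborel (A i) * inverse (ennreal \<bar>c\<bar>))"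
    using A by (intro prod.cong) (auto simp: emeasure_lborel_affine_vimage[OF assms] divide_ennreal_def)
  also have "\<dots> = (\<Prod>i<N. emeasure lborel (A i)) * inverse (ennreal \<bar>c\<bar>) ^ N"
    by (simp add: prod.distrib)
  also have "inverse (ennreal \<bar>c\<bar>) ^ N = ennreal (inverse \<bar>c\<bar> ^ N)"
    using assms by (subst inverse_ennreal) (auto intro: ennreal_power)
  finally show "emeasure (scale_measure (ennreal (\<bar>c\<bar> ^ N)) (distr (lebB N) (lebB N) (aff N z c))) (PiE {..<N} A) =
         (\<Prod>i<N. emeasure lborel (A i))"
    using assms
    by (simp add: mult.left_commute[of "ennreal (\<bar>c\<bar> ^ N)"] ennreal_mult'[symmetric] power_mult_distrib[symmetric])
qed auto

lemma nn_integral_aff: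
  assumes "c \<noteq> 0" and [measurable]: "f \<in> borel_measurable (lebB N)"
  shows "(\<integral>\<^sup>+x. f x \<partial>lebB N) = ennreal (\<bar>c\<bar> ^ N) * (\<integral>\<^sup>+x. f (aff N z c x) \<partial>lebB N)"
  by (subst distr_aff[OF assms(1), of N z, symmetric])
     (simp add: nn_integral_scale_measure nn_integral_distr)

lemma integral_shift:
  fixes f :: "point \<Rightarrow> real"
  assumes [measurable]: "f \<in> borel_measurable (lebB N)"
  shows "(\<integral>x. f (aff N z 1 x) \<partial>lebB N) = (\<integral>x. f x \<partial>lebB N)"
proof -
  have "distr (lebB N) (lebB N) (aff N z 1) = lebB N"
    using distr_aff[of 1 N z] by simp
  then show ?thesis
    using integral_distr[OF measurable_aff assms, of z 1] by simp
qed

lemma integrable_shift: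
  fixes f :: "point \<Rightarrow> real"
  assumes [measurable]: "integrable (lebB N) f"
  shows "integrable (lebB N) (\<lambda>x. f (aff N z 1 x))"
proof -
  have "distr (lebB N) (lebB N) (aff N z 1) = lebB N"
    using distr_aff[of 1 N z] by simp
  then show ?thesis
    using integrable_distr[OF measurable_aff, of N z 1 f] assms by simp
qed

definition cube :: "nat \<Rightarrow> real \<Rightarrow> point set" where
  "cube N r = PiE {..<N} (\<lambda>_. {-r..r})"

lemma cube_sets [measurable]: "cube N r \<in> sets (lebB N)"
  unfolding cube_def by (intro sets_PiM_I_finite) auto

lemma emeasure_cube: "0 \<le> r \<Longrightarrow> emeasure (lebB N) (cube N r) = ennreal ((2 * r) ^ N)"
  unfolding cube_def by (subst lb.emeasure_PiM) (auto simp: ennreal_power)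

lemma in_cube_iff: "x \<in> pts N \<Longrightarrow> x \<in> cube N r \<longleftrightarrow> (\<forall>i<N. \<bar>x i\<bar> \<le> r)"
  by (fastforce simp: cube_def PiE_iff abs_le_iff minus_le_iff)

lemma compactin_cube: "compactin (euclid N) (cube N r)"
  unfolding euclid_def cube_def by (subst compactin_PiE) auto

section \<open>Continuously differentiable functions with bounded support\<close>

text \<open>
  The partial derivatives are carried along as an explicit family \<open>D\<close>. This keeps products and
  compositions computable and avoids the differential: every argument below works along coordinate
  lines.
\<close>

definition has_C1 :: "nat \<Rightarrow> (point \<Rightarrow> real) \<Rightarrow> (nat \<Rightarrow> point \<Rightarrow> real) \<Rightarrow> bool" where
  "has_C1 N f D \<longleftrightarrow>
     continuous_map (euclid N) euclideanreal f \<and>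
     (\<forall>i<N. continuous_map (euclid N) euclideanreal (D i)) \<and>
     (\<forall>x\<in>pts N. \<forall>i<N. ((\<lambda>t. f (x(i := t))) has_real_derivative D i x) (at (x i)))"

text \<open>
  Bounded support, in the form in which it enters integrability. The support condition inside the
  open set is always stated separately.
\<close>

definition vanishes_off_cube :: "nat \<Rightarrow> real \<Rightarrow> (point \<Rightarrow> real) \<Rightarrow> bool" where
  "vanishes_off_cube N r f \<longleftrightarrow> (\<forall>x\<in>pts N. x \<notin> cube N r \<longrightarrow> f x = 0)"

lemma has_C1D:
  assumes "has_C1 N f D"
  shows "continuous_map (euclid N) euclideanreal f"
    and "i < N \<Longrightarrow> continuous_map (euclid N) euclideanreal (D i)"
    and "x \<in> pts N \<Longrightarrow> i < N \<Longrightarrow> ((\<lambda>t. f (x(i := t))) has_real_derivative D i x) (at (x i))"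
    and "f \<in> borel_measurable (lebB N)"
    and "i < N \<Longrightarrow> D i \<in> borel_measurable (lebB N)"
  using assms unfolding has_C1_def by (auto intro: borel_measurable_continuous_map)

lemma has_C1_line:
  assumes "has_C1 N f D" "x \<in> pts N" "i < N"
  shows "((\<lambda>t. f (x(i := t))) has_real_derivative D i (x(i := s))) (at s)"
  using has_C1D(3)[OF assms(1) upd_pts[OF assms(2,3), of s] assms(3)] by simp

lemma partial_deriv_eq:
  assumes "has_C1 N f D" "x \<in> pts N" "i < N"
  shows "partial_deriv i f x = D i x"
  unfolding partial_deriv_def by (rule DERIV_imp_deriv) (rule has_C1D(3)[OF assms])

lemma Ck_1_imp_has_C1:
  assumes "Ck N 1 f"
  shows "has_C1 N f (\<lambda>i. partial_deriv i f)"
  using assms unfolding has_C1_def One_nat_def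
  by (auto simp: partial_deriv_def DERIV_deriv_iff_real_differentiable)

lemma continuous_map_eq_on_pts:
  "continuous_map (euclid N) X f \<Longrightarrow> (\<And>x. x \<in> pts N \<Longrightarrow> f x = g x) \<Longrightarrow> continuous_map (euclid N) X g"
  by (erule continuous_map_eq) simp

lemma has_C1_imp_Ck_1:
  assumes "has_C1 N f D"
  shows "Ck N 1 f"
proof -
  have "continuous_map (euclid N) euclideanreal (partial_deriv i f)" if "i < N" for i
    by (rule continuous_map_eq_on_pts[OF has_C1D(2)[OF assms that]])
       (simp add: partial_deriv_eq[OF assms _ that])
  moreover have "(\<lambda>t. f (x(i := t))) differentiable at (x i)" if "i < N" "x \<in> pts N" for i x
    using has_C1D(3)[OF assms that(2,1)] by (auto simp: real_differentiable_def)
  ultimately show ?thesis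
    using has_C1D(1)[OF assms] by simp
qed

lemma has_C1_mult:
  assumes "has_C1 N f D" "has_C1 N g E"
  shows "has_C1 N (\<lambda>x. f x * g x) (\<lambda>i x. D i x * g x + f x * E i x)"
  unfolding has_C1_def
proof (intro conjI allI impI ballI)
  fix x i assume "x \<in> pts N" "i < N"
  from DERIV_mult[OF has_C1D(3)[OF assms(1) this] has_C1D(3)[OF assms(2) this]]
  show "((\<lambda>t. f (x(i := t)) * g (x(i := t))) has_real_derivative D i x * g x + f x * E i x) (at (x i))"
    by (simp add: algebra_simps)
qed (auto intro!: continuous_intros has_C1D[OF assms(1)] has_C1D[OF assms(2)])

lemma has_C1_chain:
  assumes f: "has_C1 N f D"
    and S: "\<And>x. x \<in> pts N \<Longrightarrow> f x \<in> S"
    and g: "\<And>t. t \<in> S \<Longrightarrow> (g has_real_derivative g' t) (at t)"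
    and g': "continuous_on S g'"
  shows "has_C1 N (\<lambda>x. g (f x)) (\<lambda>i x. g' (f x) * D i x)"
proof -
  have fS: "continuous_map (euclid N) (top_of_set S) f"
    using has_C1D(1)[OF f] S by (simp add: continuous_map_in_subtopology image_subset_iff)
  have gS: "continuous_on S g"
    by (intro continuous_at_imp_continuous_on ballI DERIV_isCont[OF g])
  have "continuous_map (euclid N) euclideanreal (g \<circ> f)"
    by (rule continuous_map_compose[OF fS]) (use gS in simp)
  moreover have c': "continuous_map (euclid N) euclideanreal (g' \<circ> f)"
    by (rule continuous_map_compose[OF fS]) (use g' in simp)
  moreover have "((\<lambda>t. g (f (x(i := t)))) has_real_derivative g' (f x) * D i x) (at (x i))"
    if "x \<in> pts N" "i < N" for x i
    using DERIV_chain'[OF has_C1D(3)[OF f that], of g "g' (f x)"] g[OF S[OF that(1)]]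
    by (simp add: mult.commute)
  ultimately show ?thesis
    unfolding has_C1_def o_def
    by (auto intro!: continuous_map_real_mult has_C1D[OF f])
qed

definition sqd :: "nat \<Rightarrow> point \<Rightarrow> point \<Rightarrow> real" where
  "sqd N z x = (\<Sum>j<N. (x j - z j)\<^sup>2)"

lemma has_C1_sqd: "has_C1 N (sqd N z) (\<lambda>i x. 2 * (x i - z i))"
  unfolding has_C1_def sqd_def[abs_def]
proof (intro conjI allI impI ballI)
  show "continuous_map (euclid N) euclideanreal (\<lambda>x. \<Sum>j<N. (x j - z j)\<^sup>2)"
    unfolding euclid_def by (intro continuous_intros) auto
  show "continuous_map (euclid N) euclideanreal (\<lambda>x. 2 * (x i - z i))" if "i < N" for i
    unfolding euclid_def using that by (intro continuous_intros) auto
  fix x i assume "x \<in> pts N" "i < N"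
  have "((\<lambda>t. (t - z i)\<^sup>2 + (\<Sum>j\<in>{..<N}-{i}. (x j - z j)\<^sup>2)) has_real_derivative 2 * (x i - z i)) (at (x i))"
    by (auto intro!: derivative_eq_intros)
  moreover have "(\<Sum>j<N. ((x(i := t)) j - z j)\<^sup>2) = (t - z i)\<^sup>2 + (\<Sum>j\<in>{..<N}-{i}. (x j - z j)\<^sup>2)" for t
    using \<open>i < N\<close> by (subst sum.remove[of _ i]) auto
  ultimately show "((\<lambda>t. \<Sum>j<N. ((x(i := t)) j - z j)\<^sup>2) has_real_derivative 2 * (x i - z i)) (at (x i))"
    by simp
qed

lemma measurable_sqd [measurable]: "sqd N z \<in> borel_measurable (lebB N)"
  by (rule has_C1D(4)[OF has_C1_sqd])

lemma has_C1_vanishes: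
  assumes "has_C1 N f D" "vanishes_off_cube N r f" "i < N"
  shows "vanishes_off_cube N r (D i)"
  unfolding vanishes_off_cube_def
proof (intro ballI impI)
  fix x assume x: "x \<in> pts N" "x \<notin> cube N r"
  then obtain j where j: "j < N" "\<bar>x j\<bar> > r"
    by (auto simp: in_cube_iff not_le)
  have "\<forall>\<^sub>F t in nhds (x i). r < \<bar>(x(i := t)) j\<bar>"
  proof (cases "j = i")
    case True
    have "\<forall>\<^sub>F t in nhds (x i). r < \<bar>t\<bar>"
      using j True by (intro order_tendstoD(1)[of "\<lambda>t. \<bar>t\<bar>" "\<bar>x i\<bar>"] tendsto_intros) (auto simp: filterlim_ident)
    then show ?thesis using True by simp
  qed (use j in auto)
  then have "\<forall>\<^sub>F t in nhds (x i). f (x(i := t)) = 0"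
  proof eventually_elim
    case (elim t)
    then have "x(i := t) \<notin> cube N r"
      using j(1) by (subst in_cube_iff[OF upd_pts[OF x(1) assms(3)]]) (meson not_le)
    then show ?case
      using assms(2) upd_pts[OF x(1) assms(3)] by (auto simp: vanishes_off_cube_def)
  qed
  then have "((\<lambda>t. f (x(i := t))) has_real_derivative 0) (at (x i))"
    by (subst DERIV_cong_ev[OF refl _ refl]) auto
  then show "D i x = 0"
    using has_C1D(3)[OF assms(1) x(1) assms(3)] DERIV_unique by blast
qed

lemma bounded_on_pts:
  assumes "continuous_map (euclid N) euclideanreal f" "vanishes_off_cube N r f"
  obtains C where "0 \<le> C" "\<And>x. x \<in> pts N \<Longrightarrow> \<bar>f x\<bar> \<le> C"
proof -
  have "compact (f ` cube N r)"
    using image_compactin[OF compactin_cube assms(1)] by simp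
  then obtain C where C: "\<And>y. y \<in> f ` cube N r \<Longrightarrow> \<bar>y\<bar> \<le> C"
    by (meson compact_imp_bounded bounded_real)
  have "\<bar>f x\<bar> \<le> max C 0" if "x \<in> pts N" for x
    using C[of "f x"] that assms(2) by (cases "x \<in> cube N r") (auto simp: vanishes_off_cube_def le_max_iff_disj)
  then show ?thesis by (intro that[of "max C 0"]) auto
qed

lemma integrable_cube:
  assumes "f \<in> borel_measurable (lebB N)" "\<And>x. x \<in> pts N \<Longrightarrow> \<bar>f x\<bar> \<le> C" "vanishes_off_cube N r f"
  shows "integrable (lebB N) (f :: point \<Rightarrow> real)"
proof (rule integrableI_bounded_set[of "cube N (max r 0)" _ _ C])
  show "emeasure (lebB N) (cube N (max r 0)) < \<infinity>"
    by (subst emeasure_cube) auto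
  show "AE x in lebB N. x \<notin> cube N (max r 0) \<longrightarrow> f x = 0"
    using assms(3) by (intro AE_I2) (auto simp: vanishes_off_cube_def in_cube_iff le_max_iff_disj)
qed (use assms in auto)

lemma integrable_continuous:
  assumes "continuous_map (euclid N) euclideanreal f" "vanishes_off_cube N r f"
  shows "integrable (lebB N) f"
  using bounded_on_pts[OF assms] integrable_cube[OF borel_measurable_continuous_map[OF assms(1)] _ assms(2)]
  by metis

definition gnorm :: "nat \<Rightarrow> (nat \<Rightarrow> point \<Rightarrow> real) \<Rightarrow> point \<Rightarrow> real" where
  "gnorm N D x = enorm N (\<lambda>i. D i x)"

lemma gnorm_nonneg [simp]: "0 \<le> gnorm N D x"
  by (simp add: gnorm_def enorm_def L2_set_nonneg)

lemma gnorm_component: "i < N \<Longrightarrow> \<bar>D i x\<bar> \<le> gnorm N D x"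
  unfolding gnorm_def enorm_def
  using member_le_L2_set[of "{..<N}" i "\<lambda>i. \<bar>D i x\<bar>"] by (simp add: L2_set_def)

lemma gnorm_scale: "gnorm N (\<lambda>i x. c x * D i x) x = \<bar>c x\<bar> * gnorm N D x"
  unfolding gnorm_def enorm_def
  by (simp add: L2_set_def power_mult_distrib sum_distrib_left[symmetric] real_sqrt_mult)

lemma gnorm_triangle: "gnorm N (\<lambda>i x. D i x + E i x) x \<le> gnorm N D x + gnorm N E x"
  unfolding gnorm_def enorm_def by (rule L2_set_triangle_ineq)

lemma continuous_map_gnorm:
  assumes "\<And>i. i < N \<Longrightarrow> continuous_map (euclid N) euclideanreal (D i)"
  shows "continuous_map (euclid N) euclideanreal (gnorm N D)"
proof -
  have "continuous_map (euclid N) euclideanreal (sqrt \<circ> (\<lambda>x. \<Sum>i<N. (D i x)\<^sup>2))"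
    by (rule continuous_map_compose[where X'=euclideanreal])
       (auto intro!: continuous_intros assms)
  then show ?thesis
    by (simp add: gnorm_def[abs_def] enorm_def L2_set_def o_def)
qed

lemma gnorm_vanishes:
  assumes "\<And>i. i < N \<Longrightarrow> vanishes_off_cube N r (D i)"
  shows "vanishes_off_cube N r (gnorm N D)"
  using assms by (auto simp: vanishes_off_cube_def gnorm_def enorm_def L2_set_def)

lemma has_C1_integrable:
  assumes "has_C1 N f D" "vanishes_off_cube N r f"
  shows "integrable (lebB N) f"
    and "i < N \<Longrightarrow> integrable (lebB N) (D i)"
    and "integrable (lebB N) (gnorm N D)"
    and "gnorm N D \<in> borel_measurable (lebB N)"
proof -
  show "integrable (lebB N) f"
    by (rule integrable_continuous) (use assms has_C1D in auto)
  show "i < N \<Longrightarrow> integrable (lebB N) (D i)"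
    by (rule integrable_continuous[OF _ has_C1_vanishes[OF assms]]) (use assms has_C1D in auto)
  have c: "continuous_map (euclid N) euclideanreal (gnorm N D)"
    by (rule continuous_map_gnorm) (rule has_C1D[OF assms(1)])
  show "integrable (lebB N) (gnorm N D)"
    by (rule integrable_continuous[OF c]) (rule gnorm_vanishes[OF has_C1_vanishes[OF assms]])
  show "gnorm N D \<in> borel_measurable (lebB N)"
    by (rule borel_measurable_continuous_map[OF c])
qed

section \<open>Translations and integration by parts\<close>

definition shift :: "nat \<Rightarrow> nat \<Rightarrow> real \<Rightarrow> point \<Rightarrow> point" where
  "shift N i t = aff N (\<lambda>j. if j = i then t else 0) 1"

lemma shift_eq: "x \<in> pts N \<Longrightarrow> i < N \<Longrightarrow> shift N i t x = x(i := x i + t)"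
  by (auto simp: shift_def aff_def fun_eq_iff PiE_iff extensional_def)

lemma measurable_shift [measurable]: "shift N i t \<in> lebB N \<rightarrow>\<^sub>M lebB N"
  unfolding shift_def by measurable

lemma has_C1_increment_bound:
  assumes "has_C1 N f D" "i < N" "\<And>x. x \<in> pts N \<Longrightarrow> \<bar>D i x\<bar> \<le> C" "x \<in> pts N"
  shows "\<bar>f (shift N i t x) - f x\<bar> \<le> C * \<bar>t\<bar>"
proof -
  have "norm (f (x(i := x i + t)) - f (x(i := x i))) \<le> C * norm (x i + t - x i)"
    by (rule field_differentiable_bound[where S=UNIV and f="\<lambda>t. f (x(i := t))" and f'="\<lambda>t. D i (x(i := t))"])
       (use has_C1_line[OF assms(1,4,2)] assms(3) upd_pts[OF assms(4,2)] in auto)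
  then show ?thesis
    using shift_eq[OF assms(4,2)] by simp
qed

lemma shift_not_in_cube:
  assumes "x \<in> pts N" "i < N" "x \<notin> cube N (r + \<bar>t\<bar>)"
  shows "shift N i t x \<notin> cube N r" "x \<notin> cube N r"
proof -
  obtain j where j: "j < N" "\<bar>x j\<bar> > r + \<bar>t\<bar>"
    using assms by (auto simp: in_cube_iff not_le)
  then show "x \<notin> cube N r"
    using assms(1) by (force simp: in_cube_iff)
  have "\<bar>(x(i := x i + t)) j\<bar> > r"
    using j by auto
  then show "shift N i t x \<notin> cube N r"
    unfolding shift_eq[OF assms(1,2)] using j(1) in_cube_iff[OF upd_pts[OF assms(1,2)]]
    by (metis not_le)
qed

text \<open>
  The increments of \<open>f\<close> are dominated by a multiple of the indicator of a slightly larger cube, so the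
  difference quotients may be integrated to the limit. The function \<open>\<psi>\<close> will be the identity and the
  absolute value.
\<close>

lemma difference_quotient_integral_tendsto:
  assumes f: "has_C1 N f D" "vanishes_off_cube N r f" "i < N"
    and h: "h \<longlonglongrightarrow> 0" "\<And>n. h n \<noteq> 0" "\<And>n. \<bar>h n\<bar> \<le> T"
    and \<psi>: "continuous_on UNIV \<psi>" "\<And>y. \<bar>\<psi> y\<bar> \<le> \<bar>y::real\<bar>"
  shows "(\<lambda>n. \<integral>x. \<psi> ((f (shift N i (h n) x) - f x) / h n) \<partial>lebB N)
           \<longlonglongrightarrow> (\<integral>x. \<psi> (D i x) \<partial>lebB N)"
proof -
  obtain C where C: "0 \<le> C" "\<And>x. x \<in> pts N \<Longrightarrow> \<bar>D i x\<bar> \<le> C"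
    using bounded_on_pts[OF has_C1D(2)[OF f(1,3)] has_C1_vanishes[OF f]] by blast
  have T: "0 \<le> T" using h(3)[of 0] by linarith
  have [measurable]: "f \<in> borel_measurable (lebB N)" "D i \<in> borel_measurable (lebB N)"
    using has_C1D[OF f(1)] f(3) by auto
  have [measurable]: "\<psi> \<in> borel_measurable borel"
    using \<psi>(1) by (rule borel_measurable_continuous_onI)
  let ?B = "cube N (max r 0 + T)"
  have fin: "emeasure (lebB N) ?B < \<infinity>"
    using T by (subst emeasure_cube) auto
  show ?thesis
  proof (rule integral_dominated_convergence[where w="\<lambda>x. C * indicator ?B x"])
    show "integrable (lebB N) (\<lambda>x. C * indicator ?B x)"
      using fin by (intro integrable_mult_right integrable_real_indicator) auto
    show "AE x in lebB N. (\<lambda>n. \<psi> ((f (shift N i (h n) x) - f x) / h n)) \<longlonglongrightarrow> \<psi> (D i x)"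
    proof (rule AE_I2)
      fix x assume "x \<in> space (lebB N)"
      then have x: "x \<in> pts N" by simp
      have "((\<lambda>k. (f (x(i := x i + k)) - f (x(i := x i))) / k) \<longlongrightarrow> D i x) (at 0)"
        using has_C1D(3)[OF f(1) x f(3)] by (simp add: DERIV_def)
      then have "(\<lambda>n. (f (x(i := x i + h n)) - f (x(i := x i))) / h n) \<longlonglongrightarrow> D i x"
        by (rule filterlim_compose) (use h in \<open>auto simp: filterlim_at\<close>)
      then have "(\<lambda>n. (f (shift N i (h n) x) - f x) / h n) \<longlonglongrightarrow> D i x"
        by (simp add: shift_eq[OF x f(3)])
      then show "(\<lambda>n. \<psi> ((f (shift N i (h n) x) - f x) / h n)) \<longlonglongrightarrow> \<psi> (D i x)"
        using \<psi>(1) by (auto intro: continuous_on_tendsto_compose)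
    qed
    show "AE x in lebB N. norm (\<psi> ((f (shift N i (h n) x) - f x) / h n)) \<le> C * indicator ?B x" for n
    proof (rule AE_I2)
      fix x assume "x \<in> space (lebB N)"
      then have x: "x \<in> pts N" by simp
      have le: "\<bar>(f (shift N i (h n) x) - f x) / h n\<bar> \<le> C"
        using has_C1_increment_bound[OF f(1,3) C(2) x, of "h n"] h(2)[of n]
        by (simp add: abs_divide divide_le_eq)
      show "norm (\<psi> ((f (shift N i (h n) x) - f x) / h n)) \<le> C * indicator ?B x"
      proof (cases "x \<in> ?B")
        case True
        then show ?thesis using \<psi>(2) le by (force intro: order_trans)
      next
        case False
        then have "x \<notin> cube N (r + \<bar>h n\<bar>)"
          using h(3)[of n] x by (force simp: in_cube_iff)
        from shift_not_in_cube[OF x f(3) this]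
        have "f (shift N i (h n) x) = 0" "f x = 0"
          using f(2) x unfolding vanishes_off_cube_def shift_def by auto
        then show ?thesis
          using False \<psi>(2)[of 0] by simp
      qed
    qed
  qed simp_all
qed

text \<open>
  By translation invariance all difference quotients have integral zero.
\<close>

lemma integral_partial_eq_0:
  assumes f: "has_C1 N f D" "vanishes_off_cube N r f" "i < N"
  shows "(\<integral>x. D i x \<partial>lebB N) = 0"
proof -
  let ?h = "\<lambda>n. 1 / real (Suc n)"
  have "(\<lambda>n. \<integral>x. ((f (shift N i (?h n) x) - f x) / ?h n) \<partial>lebB N) \<longlonglongrightarrow> (\<integral>x. D i x \<partial>lebB N)"
    by (rule difference_quotient_integral_tendsto[OF f, where \<psi>="\<lambda>y. y" and T=1])
       (use LIMSEQ_inverse_real_of_nat in \<open>auto simp: inverse_eq_divide\<close>)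
  moreover have eq0: "(\<integral>x. ((f (shift N i t x) - f x) / t) \<partial>lebB N) = 0" for t
    using has_C1_integrable(1)[OF f(1,2)] integrable_shift[OF has_C1_integrable(1)[OF f(1,2)]]
      integral_shift[OF has_C1D(4)[OF f(1)]]
    by (simp add: shift_def)
  ultimately show ?thesis
    unfolding eq0 by (simp add: LIMSEQ_const_iff)
qed

lemma integral_by_parts:
  assumes f: "has_C1 N f D" and g: "has_C1 N g E" and v: "vanishes_off_cube N r f" and i: "i < N"
  shows "(\<integral>x. f x * E i x \<partial>lebB N) = - (\<integral>x. D i x * g x \<partial>lebB N)"
proof -
  have fg: "vanishes_off_cube N r (\<lambda>x. f x * g x)"
    using v by (auto simp: vanishes_off_cube_def)
  have "integrable (lebB N) (\<lambda>x. f x * E i x)"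
    by (rule integrable_continuous[where r=r])
       (use v has_C1D(1)[OF f] has_C1D(2)[OF g i] in \<open>auto simp: vanishes_off_cube_def intro!: continuous_intros\<close>)
  moreover have "integrable (lebB N) (\<lambda>x. D i x * g x)"
    by (rule integrable_continuous[where r=r])
       (use has_C1_vanishes[OF f v i] has_C1D(2)[OF f i] has_C1D(1)[OF g] in \<open>auto simp: vanishes_off_cube_def intro!: continuous_intros\<close>)
  ultimately show ?thesis
    using integral_partial_eq_0[OF has_C1_mult[OF f g] fg i] by simp
qed

lemma integrable_shift_diff:
  assumes "integrable (lebB N) (f :: point \<Rightarrow> real)"
  shows "integrable (lebB N) (\<lambda>x. \<bar>f (shift N i t x) - f x\<bar>)"
  using integrable_shift[OF assms] assms by (simp add: shift_def)

lemma shift_L1_subadd: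
  assumes f: "integrable (lebB N) (f :: point \<Rightarrow> real)" and i: "i < N"
  shows "(\<integral>x. \<bar>f (shift N i (s + t) x) - f x\<bar> \<partial>lebB N)
       \<le> (\<integral>x. \<bar>f (shift N i s x) - f x\<bar> \<partial>lebB N) + (\<integral>x. \<bar>f (shift N i t x) - f x\<bar> \<partial>lebB N)"
proof -
  have [measurable]: "f \<in> borel_measurable (lebB N)" using f by auto
  have eq: "shift N i (s + t) x = shift N i s (shift N i t x)" if "x \<in> pts N" for x
    using that i by (simp add: shift_eq upd_pts add_ac)
  have int: "integrable (lebB N) (\<lambda>x. \<bar>f (shift N i s (shift N i t x)) - f (shift N i t x)\<bar>)"
    using integrable_shift[OF integrable_shift_diff[OF f]] by (simp add: shift_def)
  have "(\<integral>x. \<bar>f (shift N i (s + t) x) - f x\<bar> \<partial>lebB N)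
     \<le> (\<integral>x. \<bar>f (shift N i s (shift N i t x)) - f (shift N i t x)\<bar> + \<bar>f (shift N i t x) - f x\<bar> \<partial>lebB N)"
    by (intro integral_mono Bochner_Integration.integrable_add integrable_shift_diff f int) (auto simp: eq)
  also have "\<dots> = (\<integral>x. \<bar>f (shift N i s (shift N i t x)) - f (shift N i t x)\<bar> \<partial>lebB N)
       + (\<integral>x. \<bar>f (shift N i t x) - f x\<bar> \<partial>lebB N)"
    by (intro Bochner_Integration.integral_add integrable_shift_diff f int)
  also have "(\<integral>x. \<bar>f (shift N i s (shift N i t x)) - f (shift N i t x)\<bar> \<partial>lebB N)
       = (\<integral>x. \<bar>f (shift N i s x) - f x\<bar> \<partial>lebB N)"
    unfolding shift_def[of N i t] by (rule integral_shift) measurable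
  finally show ?thesis .
qed

text \<open>
  The quantity \<open>\<Phi>(t) = \<integral>|f(x + t e\<^sub>i) - f(x)|\<close> is subadditive in \<open>t\<close>, hence \<open>\<Phi>(t) \<le> n \<Phi>(t/n)\<close>, and the right side
  tends to \<open>|t| \<integral>|D\<^sub>i f|\<close>.
\<close>

lemma shift_L1_le:
  assumes f: "has_C1 N f D" "vanishes_off_cube N r f" "i < N"
  shows "(\<integral>x. \<bar>f (shift N i t x) - f x\<bar> \<partial>lebB N) \<le> \<bar>t\<bar> * (\<integral>x. \<bar>D i x\<bar> \<partial>lebB N)"
proof (cases "t = 0")
  case True
  have "shift N i 0 x = x" if "x \<in> pts N" for x
    using shift_eq[OF that f(3)] by simp
  then show ?thesis
    using True by (subst Bochner_Integration.integral_cong[where g="\<lambda>_. 0"]) auto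
next
  case False
  define \<Phi> where "\<Phi> t = (\<integral>x. \<bar>f (shift N i t x) - f x\<bar> \<partial>lebB N)" for t
  have int: "integrable (lebB N) f" by (rule has_C1_integrable[OF f(1,2)])
  have mul: "\<Phi> (real (Suc n) * s) \<le> real (Suc n) * \<Phi> s" for n s
  proof (induction n)
    case (Suc n)
    have "\<Phi> (real (Suc (Suc n)) * s) \<le> \<Phi> (real (Suc n) * s) + \<Phi> s"
      using shift_L1_subadd[OF int f(3), of "real (Suc n) * s" s] by (simp add: \<Phi>_def algebra_simps)
    with Suc show ?case by (simp add: algebra_simps)
  qed simp
  let ?h = "\<lambda>n. t / real (Suc n)"
  have h0: "?h \<longlonglongrightarrow> 0"
    using tendsto_mult[OF tendsto_const[of t] LIMSEQ_inverse_real_of_nat] by (simp add: divide_inverse)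
  have "(\<lambda>n. \<integral>x. \<bar>(f (shift N i (?h n) x) - f x) / ?h n\<bar> \<partial>lebB N) \<longlonglongrightarrow> (\<integral>x. \<bar>D i x\<bar> \<partial>lebB N)"
    by (rule difference_quotient_integral_tendsto[OF f h0, where T="\<bar>t\<bar>"])
       (use False in \<open>auto simp: field_simps mult_le_cancel_left1 intro!: continuous_intros\<close>)
  then have lim: "(\<lambda>n. \<bar>t\<bar> * (\<integral>x. \<bar>(f (shift N i (?h n) x) - f x) / ?h n\<bar> \<partial>lebB N)) \<longlonglongrightarrow> \<bar>t\<bar> * (\<integral>x. \<bar>D i x\<bar> \<partial>lebB N)"
    by (rule tendsto_mult_left)
  have "\<Phi> t \<le> \<bar>t\<bar> * (\<integral>x. \<bar>(f (shift N i (?h n) x) - f x) / ?h n\<bar> \<partial>lebB N)" for n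
  proof -
    have "\<Phi> t \<le> real (Suc n) * \<Phi> (?h n)"
      using mul[of n "?h n"] by simp
    also have "\<dots> = \<bar>t\<bar> * (\<Phi> (?h n) / \<bar>?h n\<bar>)"
      using False by (simp add: abs_divide)
    also have "\<Phi> (?h n) / \<bar>?h n\<bar> = (\<integral>x. \<bar>(f (shift N i (?h n) x) - f x) / ?h n\<bar> \<partial>lebB N)"
      unfolding \<Phi>_def abs_divide by (rule integral_divide_zero[symmetric])
    finally show ?thesis .
  qed
  then show ?thesis
    unfolding \<Phi>_def by (intro LIMSEQ_le_const[OF lim]) auto
qed

text \<open>
  A translation is carried out one coordinate at a time.
\<close>

lemma translate_L1_le:
  assumes f: "has_C1 N f D" "vanishes_off_cube N r f" and z: "\<And>i. i < N \<Longrightarrow> \<bar>z i\<bar> \<le> l"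
  shows "(\<integral>x. \<bar>f (aff N z 1 x) - f x\<bar> \<partial>lebB N) \<le> real N * l * (\<integral>x. gnorm N D x \<partial>lebB N)"
proof -
  define part where "part j = (\<lambda>i. if i < j then z i else 0)" for j
  have int: "integrable (lebB N) f" by (rule has_C1_integrable[OF f])
  have [measurable]: "f \<in> borel_measurable (lebB N)" using int by auto
  have G: "(\<integral>x. \<bar>D i x\<bar> \<partial>lebB N) \<le> (\<integral>x. gnorm N D x \<partial>lebB N)" if "i < N" for i
    using that has_C1_integrable[OF f] by (intro integral_mono gnorm_component) auto
  have G0: "0 \<le> (\<integral>x. gnorm N D x \<partial>lebB N)" by simp
  have inta: "integrable (lebB N) (\<lambda>x. \<bar>f (aff N w 1 x) - f x\<bar>)" for w
    using integrable_shift[OF int] int by simp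
  have "(\<integral>x. \<bar>f (aff N (part j) 1 x) - f x\<bar> \<partial>lebB N) \<le> real j * l * (\<integral>x. gnorm N D x \<partial>lebB N)"
    if "j \<le> N" for j
    using that
  proof (induction j)
    case 0
    have "aff N (part 0) 1 x = x" if "x \<in> pts N" for x
      using that by (auto simp: aff_def part_def fun_eq_iff PiE_iff extensional_def)
    then show ?case
      by (subst Bochner_Integration.integral_cong[where g="\<lambda>_. 0"]) auto
  next
    case (Suc j)
    let ?a = "aff N (part j) 1"
    have eq: "aff N (part (Suc j)) 1 x = shift N j (z j) (?a x)" for x
      by (auto simp: aff_def part_def shift_def fun_eq_iff less_Suc_eq)
    have i1: "integrable (lebB N) (\<lambda>x. \<bar>f (shift N j (z j) (?a x)) - f (?a x)\<bar>)"
      using integrable_shift[OF integrable_shift_diff[OF int]] .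
    have "(\<integral>x. \<bar>f (aff N (part (Suc j)) 1 x) - f x\<bar> \<partial>lebB N)
      \<le> (\<integral>x. \<bar>f (shift N j (z j) (?a x)) - f (?a x)\<bar> + \<bar>f (?a x) - f x\<bar> \<partial>lebB N)"
      unfolding eq[symmetric]
      by (intro integral_mono Bochner_Integration.integrable_add inta) (use i1 eq in auto)
    also have "\<dots> = (\<integral>x. \<bar>f (shift N j (z j) (?a x)) - f (?a x)\<bar> \<partial>lebB N) + (\<integral>x. \<bar>f (?a x) - f x\<bar> \<partial>lebB N)"
      by (intro Bochner_Integration.integral_add i1 inta)
    also have "(\<integral>x. \<bar>f (shift N j (z j) (?a x)) - f (?a x)\<bar> \<partial>lebB N) = (\<integral>x. \<bar>f (shift N j (z j) x) - f x\<bar> \<partial>lebB N)"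
      by (rule integral_shift) measurable
    also have "\<dots> \<le> \<bar>z j\<bar> * (\<integral>x. \<bar>D j x\<bar> \<partial>lebB N)"
      by (rule shift_L1_le[OF f]) (use Suc.prems in simp)
    also have "\<dots> \<le> l * (\<integral>x. gnorm N D x \<partial>lebB N)"
      using Suc.prems z[of j] G[of j] by (intro mult_mono) (auto intro: order_trans[OF abs_ge_zero])
    finally show ?case
      using Suc by (simp add: algebra_simps)
  qed
  from this[of N] have "(\<integral>x. \<bar>f (aff N (part N) 1 x) - f x\<bar> \<partial>lebB N) \<le> real N * l * (\<integral>x. gnorm N D x \<partial>lebB N)"
    by simp
  moreover have "aff N (part N) 1 = aff N z 1"
    by (auto simp: aff_def part_def fun_eq_iff)
  ultimately show ?thesis by simp
qed

lemma measurable_aff_pair [measurable]: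
  "(\<lambda>p. aff N (snd p) c (fst p)) \<in> lebB N \<Otimes>\<^sub>M lebB N \<rightarrow>\<^sub>M lebB N"
  unfolding aff_def by (intro measurable_restrict) measurable

lemma aff_commute: "aff N z 1 x = aff N x 1 z"
  by (auto simp: aff_def fun_eq_iff)

lemma lebB_Fubini:
  assumes "case_prod f \<in> borel_measurable (lebB N \<Otimes>\<^sub>M lebB N)"
  shows "(\<integral>\<^sup>+y. \<integral>\<^sup>+x. f x y \<partial>lebB N \<partial>lebB N) = (\<integral>\<^sup>+x. \<integral>\<^sup>+y. f x y \<partial>lebB N \<partial>lebB N)"
proof -
  interpret pair_sigma_finite "lebB N" "lebB N"
    using sigma_finite_lebB by (simp add: pair_sigma_finite_def)
  show ?thesis using assms by (rule Fubini')
qed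

text \<open>
  A Faber-Krahn type bound. Average \<open>|f(x + z) - f(x)|\<close> over \<open>z\<close> in a cube of side \<open>l\<close>. Since \<open>f\<close> vanishes
  outside a set of at most half the volume of that cube, for each \<open>x\<close> at least half of the \<open>z\<close> give
  \<open>f(x + z) = 0\<close>, so the average is at least \<open>|f(x)| / 2\<close>; translations cost at most \<open>N l \<integral>|\<nabla>f|\<close>.
\<close>

lemma small_support_L1_le:
  assumes f: "has_C1 N f D" "vanishes_off_cube N r f" and l: "0 < l"
    and small: "emeasure (lebB N) {x \<in> pts N. f x \<noteq> 0} \<le> ennreal (l ^ N / 2)"
  shows "(\<integral>x. \<bar>f x\<bar> \<partial>lebB N) \<le> 2 * real N * l * (\<integral>x. gnorm N D x \<partial>lebB N)"
proof -
  have int: "integrable (lebB N) f" by (rule has_C1_integrable[OF f])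
  have [measurable]: "f \<in> borel_measurable (lebB N)" using int by auto
  define B where "B = PiE {..<N} (\<lambda>_. {0..l})"
  have [measurable]: "B \<in> sets (lebB N)"
    unfolding B_def by (intro sets_PiM_I_finite) auto
  have eB: "emeasure (lebB N) B = ennreal (l ^ N)"
    using l unfolding B_def by (subst lb.emeasure_PiM) (auto simp: ennreal_power)
  let ?G = "\<integral>x. gnorm N D x \<partial>lebB N"
  let ?k = "\<lambda>x z. indicator B z * ennreal \<bar>f (aff N z 1 x) - f x\<bar>"
  have low: "ennreal \<bar>f x\<bar> * ennreal (l ^ N / 2) \<le> (\<integral>\<^sup>+z. ?k x z \<partial>lebB N)" for x
  proof -
    define Z where "Z = {z \<in> pts N. f (aff N x 1 z) \<noteq> 0}"
    have [measurable]: "Z \<in> sets (lebB N)" unfolding Z_def by measurable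
    have "emeasure (lebB N) Z = emeasure (distr (lebB N) (lebB N) (aff N x 1)) {z \<in> pts N. f z \<noteq> 0}"
      by (subst emeasure_distr) (auto simp: Z_def intro!: arg_cong[where f="emeasure (lebB N)"])
    also have "distr (lebB N) (lebB N) (aff N x 1) = lebB N"
      using distr_aff[of 1 N x] by simp
    finally have Z: "emeasure (lebB N) Z \<le> ennreal (l ^ N / 2)"
      using small by simp
    have "ennreal (l ^ N / 2) + ennreal (l ^ N / 2) = emeasure (lebB N) B"
      using l by (simp add: eB ennreal_plus[symmetric] del: ennreal_plus)
    also have "\<dots> \<le> emeasure (lebB N) ((B - Z) \<union> Z)"
      by (intro emeasure_mono) auto
    also have "\<dots> \<le> emeasure (lebB N) (B - Z) + emeasure (lebB N) Z"
      by (rule emeasure_subadditive) auto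
    also have "\<dots> \<le> emeasure (lebB N) (B - Z) + ennreal (l ^ N / 2)"
      using Z by (rule add_left_mono)
    finally have BZ: "ennreal (l ^ N / 2) \<le> emeasure (lebB N) (B - Z)"
      by (simp add: ennreal_add_left_cancel_le add.commute)
    have "ennreal \<bar>f x\<bar> * ennreal (l ^ N / 2) \<le> ennreal \<bar>f x\<bar> * emeasure (lebB N) (B - Z)"
      by (intro mult_left_mono BZ) auto
    also have "\<dots> = (\<integral>\<^sup>+z. ennreal \<bar>f x\<bar> * indicator (B - Z) z \<partial>lebB N)"
      by (subst nn_integral_cmult_indicator) auto
    also have "\<dots> \<le> (\<integral>\<^sup>+z. ?k x z \<partial>lebB N)"
      by (intro nn_integral_mono) (auto simp: Z_def aff_commute[of N _ x] split: split_indicator)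
    finally show ?thesis .
  qed
  have "(\<integral>\<^sup>+x. ennreal \<bar>f x\<bar> \<partial>lebB N) * ennreal (l ^ N / 2) = (\<integral>\<^sup>+x. ennreal \<bar>f x\<bar> * ennreal (l ^ N / 2) \<partial>lebB N)"
    by (rule nn_integral_multc[symmetric]) measurable
  also have "\<dots> \<le> (\<integral>\<^sup>+x. \<integral>\<^sup>+z. ?k x z \<partial>lebB N \<partial>lebB N)"
    by (intro nn_integral_mono low)
  also have "\<dots> = (\<integral>\<^sup>+z. \<integral>\<^sup>+x. ?k x z \<partial>lebB N \<partial>lebB N)"
    by (rule lebB_Fubini[symmetric]) (unfold split_beta', measurable)
  also have "\<dots> \<le> (\<integral>\<^sup>+z. indicator B z * ennreal (real N * l * ?G) \<partial>lebB N)"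
  proof (rule nn_integral_mono)
    fix z
    show "(\<integral>\<^sup>+x. ?k x z \<partial>lebB N) \<le> indicator B z * ennreal (real N * l * ?G)"
    proof (cases "z \<in> B")
      case True
      then have "\<And>i. i < N \<Longrightarrow> \<bar>z i\<bar> \<le> l" by (auto simp: B_def PiE_iff)
      from translate_L1_le[OF f this]
      have "(\<integral>\<^sup>+x. ennreal \<bar>f (aff N z 1 x) - f x\<bar> \<partial>lebB N) \<le> ennreal (real N * l * ?G)"
        using integrable_shift[OF int, of z] int
        by (subst nn_integral_eq_integral) (auto intro!: ennreal_leI)
      then show ?thesis using True by simp
    qed simp
  qed
  also have "\<dots> = ennreal (l ^ N) * ennreal (real N * l * ?G)"
    by (subst nn_integral_multc) (auto simp: eB)
  finally have "ennreal (\<integral>x. \<bar>f x\<bar> \<partial>lebB N) * ennreal (l ^ N / 2) \<le> ennreal (l ^ N) * ennreal (real N * l * ?G)"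
    using int by (subst (asm) nn_integral_eq_integral) auto
  then have "(\<integral>x. \<bar>f x\<bar> \<partial>lebB N) * (l ^ N / 2) \<le> l ^ N * (real N * l * ?G)"
    using l by (simp add: ennreal_mult[symmetric] ennreal_le_iff)
  then show ?thesis
    using l by (simp add: field_simps)
qed

section \<open>The functional form of the Cheeger inequality\<close>

lemma bounded_on_cube:
  assumes "continuous_map (euclid N) euclideanreal f"
  obtains C where "0 \<le> C" "\<And>x. x \<in> cube N r \<Longrightarrow> \<bar>f x\<bar> \<le> C"
proof -
  have "compact (f ` cube N r)"
    using image_compactin[OF compactin_cube assms(1)] by simp
  then obtain C where C: "\<And>y. y \<in> f ` cube N r \<Longrightarrow> \<bar>y\<bar> \<le> C"
    by (meson compact_imp_bounded bounded_real)
  then show ?thesis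
    by (intro that[of "max C 0"]) (auto simp: le_max_iff_disj)
qed

lemma sets_leb: "A \<in> sets (lebB N) \<Longrightarrow> A \<in> sets (leb N)"
  by (simp add: leb_def)

lemma emeasure_leb: "A \<in> sets (lebB N) \<Longrightarrow> emeasure (leb N) A = emeasure (lebB N) A"
  by (simp add: leb_def)

lemma measurable_leb: "f \<in> borel_measurable (lebB N) \<Longrightarrow> f \<in> borel_measurable (leb N)"
  unfolding leb_def by (rule measurable_completion)

lemma integral_leb_on:
  assumes [measurable]: "f \<in> borel_measurable (lebB N)" "A \<in> sets (lebB N)"
  shows "(\<integral>x. f x \<partial>leb_on N A) = (\<integral>x. indicator A x * f x \<partial>lebB N :: real)"
proof -
  have "(\<integral>x. f x \<partial>leb_on N A) = (\<integral>x. indicator A x *\<^sub>R f x \<partial>leb N)"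
    unfolding leb_on_def
    by (rule integral_restrict_space) (use assms sets_leb in \<open>auto simp: leb_def intro!: sets.Int\<close>)
  also have "\<dots> = (\<integral>x. indicator A x * f x \<partial>lebB N)"
    unfolding leb_def by (subst integral_completion) auto
  finally show ?thesis .
qed

text \<open>
  A \<open>C\<^sup>1\<close> function vanishing on a half line, from which the ramps and the polynomial cut-offs are built.
\<close>

definition psq :: "real \<Rightarrow> real" where
  "psq t = (max 0 t)\<^sup>2"

lemma DERIV_psq: "(psq has_real_derivative 2 * max 0 t) (at t)"
proof -
  consider "t > 0" | "t < 0" | "t = 0" by linarith
  then show ?thesis
  proof cases
    case 1
    have "((\<lambda>s. s\<^sup>2) has_real_derivative 2 * max 0 t) (at t)"
      using 1 by (auto intro!: derivative_eq_intros)
    moreover have "\<forall>\<^sub>F s in nhds t. psq s = s\<^sup>2"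
      using eventually_nhds_in_open[of "{0<..}" t] 1
      by (auto simp: psq_def elim!: eventually_mono)
    ultimately show ?thesis
      by (subst DERIV_cong_ev[OF refl _ refl])
  next
    case 2
    have "((\<lambda>s. 0) has_real_derivative 2 * max 0 t) (at t)"
      using 2 by simp
    moreover have "\<forall>\<^sub>F s in nhds t. psq s = 0"
      using eventually_nhds_in_open[of "{..<0}" t] 2
      by (auto simp: psq_def elim!: eventually_mono)
    ultimately show ?thesis
      by (subst DERIV_cong_ev[OF refl _ refl])
  next
    case 3
    have "((\<lambda>h. psq h / h) \<longlongrightarrow> 0) (at 0)"
    proof (rule tendsto_0_le[where K=1])
      show "((\<lambda>h::real. h) \<longlongrightarrow> 0) (at 0)" by (rule tendsto_ident_at)
      show "\<forall>\<^sub>F h in at 0. norm (psq h / h) \<le> norm h * 1"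
        by (intro always_eventually allI) (auto simp: psq_def max_def power2_eq_square)
    qed
    then show ?thesis
      using 3 by (simp add: DERIV_def psq_def)
  qed
qed

lemma psq_nonneg [simp]: "0 \<le> psq t"
  by (simp add: psq_def)

text \<open>
  A \<open>C\<^sup>1\<close> approximation of the positive part: zero for \<open>s \<le> 0\<close>, slope one for \<open>s \<ge> \<tau>\<close>, at distance at most
  \<open>\<tau>\<close> from the positive part.
\<close>

definition ramp :: "real \<Rightarrow> real \<Rightarrow> real" where
  "ramp \<tau> s = (psq s - psq (s - \<tau>)) / (2 * \<tau>)"

definition ramp' :: "real \<Rightarrow> real \<Rightarrow> real" where
  "ramp' \<tau> s = (max 0 s - max 0 (s - \<tau>)) / \<tau>"

lemma DERIV_ramp: "0 < \<tau> \<Longrightarrow> (ramp \<tau> has_real_derivative ramp' \<tau> s) (at s)"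
proof -
  assume \<tau>: "0 < \<tau>"
  have "((\<lambda>s. psq (s - \<tau>)) has_real_derivative 2 * max 0 (s - \<tau>) * 1) (at s)"
    by (rule DERIV_chain2[OF DERIV_psq]) (auto intro!: derivative_eq_intros)
  from DERIV_cdivide[OF DERIV_diff[OF DERIV_psq this], of "2 * \<tau>"]
  moreover have "(2 * max 0 s - 2 * max 0 (s - \<tau>) * 1) / (2 * \<tau>) = ramp' \<tau> s"
  proof -
    have "(2 * max 0 s - 2 * max 0 (s - \<tau>) * 1) / (2 * \<tau>) = (2 * (max 0 s - max 0 (s - \<tau>))) / (2 * \<tau>)"
      by (simp only: right_diff_distrib mult_1_right)
    also have "\<dots> = ramp' \<tau> s"
      unfolding ramp'_def by (rule mult_divide_mult_cancel_left) simp
    finally show ?thesis .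
  qed
  ultimately show ?thesis
    by (simp add: ramp_def[abs_def])
qed

lemma ramp'_bounds: "0 < \<tau> \<Longrightarrow> 0 \<le> ramp' \<tau> s" "0 < \<tau> \<Longrightarrow> ramp' \<tau> s \<le> 1"
  by (auto simp: ramp'_def field_simps max_def)

lemma ramp_approx: "0 < \<tau> \<Longrightarrow> \<bar>ramp \<tau> s - max 0 s\<bar> \<le> \<tau>"
proof -
  assume \<tau>: "0 < \<tau>"
  consider "s \<le> 0" | "0 < s" "s \<le> \<tau>" | "\<tau> < s" by linarith
  then show ?thesis
  proof cases
    case 2
    then have "ramp \<tau> s = s * (s / (2 * \<tau>))"
      by (simp add: ramp_def psq_def power2_eq_square)
    moreover have "s * (s / (2 * \<tau>)) \<le> s * 1"
      using 2 \<tau> by (intro mult_left_mono) auto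
    moreover have "0 \<le> s * (s / (2 * \<tau>))" using 2 \<tau> by simp
    moreover have "max 0 s = s" using 2 by simp
    ultimately show ?thesis using 2 by linarith
  next
    case 3
    then have "ramp \<tau> s = s - \<tau> / 2"
      using \<tau> by (simp add: ramp_def psq_def field_simps power2_eq_square)
    then show ?thesis using 3 \<tau> by (simp add: max_def)
  qed (use \<tau> in \<open>auto simp: ramp_def psq_def\<close>)
qed

lemma continuous_ramp': "continuous_on S (ramp' \<tau>)"
  unfolding ramp'_def[abs_def] divide_inverse by (intro continuous_intros)

text \<open>
  Comparison through lower right Dini derivatives. The set of \<open>t\<close> up to which the inequality holds is closed
  from the left because \<open>A\<close> is monotone and \<open>B\<close> continuous, and the hypothesis pushes its supremum
  further to the right.
\<close>

lemma dini_comparison: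
  fixes A B :: "real \<Rightarrow> real"
  assumes A: "mono A" and B: "continuous_on UNIV B"
    and step: "\<And>t. 0 \<le> t \<Longrightarrow> \<exists>d>0. \<forall>e. 0 < e \<and> e < d \<longrightarrow> B (t + e) - B t \<le> A (t + e) - A t"
    and T: "0 \<le> T"
  shows "B T - B 0 \<le> A T - A 0"
proof -
  define S where "S = {t. 0 \<le> t \<and> t \<le> T \<and> (\<forall>s. 0 \<le> s \<and> s \<le> t \<longrightarrow> B s - B 0 \<le> A s - A 0)}"
  have S0: "0 \<in> S" using T by (auto simp: S_def)
  have bdd: "bdd_above S" by (auto simp: S_def bdd_above_def)
  define u where "u = Sup S"
  have "0 \<le> u"
    unfolding u_def by (rule cSup_upper[OF S0 bdd])
  moreover have "u \<le> T"
    unfolding u_def by (rule cSup_least) (use S0 in \<open>auto simp: S_def\<close>)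
  ultimately have u: "0 \<le> u" "u \<le> T" .
  have below: "B s - B 0 \<le> A s - A 0" if s: "0 \<le> s" "s < u" for s
  proof -
    obtain t where "t \<in> S" "s < t"
      using less_cSupD[of S s] S0 s(2) unfolding u_def by (metis empty_iff)
    then show ?thesis using s by (auto simp: S_def)
  qed
  have at_u: "B u - B 0 \<le> A u - A 0"
  proof (cases "u = 0")
    case False
    then have "0 < u" using u by simp
    have "(B \<longlongrightarrow> B u) (at_left u)"
      by (rule tendsto_within_subset[OF _ subset_UNIV]) (use B in \<open>simp add: continuous_on_def\<close>)
    moreover have "\<forall>\<^sub>F s in at_left u. B s - B 0 \<le> A u - A 0"
      unfolding eventually_at_left_field
    proof (intro exI[of _ 0] conjI allI impI)
      fix s assume "0 < s" "s < u"
      then show "B s - B 0 \<le> A u - A 0"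
        using below[of s] monoD[OF A, of s u] by simp
    qed (use \<open>0 < u\<close> in simp)
    ultimately show ?thesis
      by (intro tendsto_upperbound[OF tendsto_diff[OF _ tendsto_const]]) auto
  qed simp
  show ?thesis
  proof (cases "u = T")
    case False
    then have "u < T" using u by simp
    obtain d where d: "d > 0" "\<And>e. 0 < e \<Longrightarrow> e < d \<Longrightarrow> B (u + e) - B u \<le> A (u + e) - A u"
      using step[OF u(1)] by blast
    \<comment> \<open>Half of \<open>d\<close>, because the step is available for increments strictly below \<open>d\<close>.\<close>
    define v where "v = u + min (d / 2) (T - u)"
    have v: "u < v" "v \<le> T" "v - u < d"
      using d(1) \<open>u < T\<close> by (auto simp: v_def)
    have "v \<in> S"
      unfolding S_def
    proof (intro CollectI conjI allI impI)
      fix s assume s: "0 \<le> s \<and> s \<le> v"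
      show "B s - B 0 \<le> A s - A 0"
      proof (cases "s \<le> u")
        case True
        then show ?thesis using below[of s] at_u s by (cases "s = u") auto
      next
        case False
        then show ?thesis
          using d(2)[of "s - u"] s v at_u by simp
      qed
    qed (use u v in auto)
    then have "v \<le> u" using cSup_upper[OF _ bdd] by (simp add: u_def)
    then show ?thesis using v by simp
  qed (use at_u in simp)
qed

lemma enorm_cauchy_schwarz: "\<bar>\<Sum>i<N. a i * b i\<bar> \<le> enorm N a * enorm N b"
proof -
  have "\<bar>\<Sum>i<N. a i * b i\<bar> \<le> (\<Sum>i<N. \<bar>a i\<bar> * \<bar>b i\<bar>)"
    by (rule order_trans[OF sum_abs]) (simp add: abs_mult)
  also have "\<dots> \<le> enorm N a * enorm N b"
    unfolding enorm_def by (rule L2_set_mult_ineq)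
  finally show ?thesis .
qed

text \<open>
  The fields of the perimeter in the form in which they are integrated by parts; there the other factor
  has bounded support.
\<close>

definition unit_field :: "nat \<Rightarrow> (point \<Rightarrow> point) \<Rightarrow> bool" where
  "unit_field N \<phi> \<longleftrightarrow> (\<forall>i<N. Ck N 1 (\<lambda>x. \<phi> x i)) \<and> (\<forall>x\<in>pts N. enorm N (\<phi> x) \<le> 1)"

lemma continuous_map_divergence:
  assumes "unit_field N \<phi>"
  shows "continuous_map (euclid N) euclideanreal (divergence N \<phi>)"
  unfolding divergence_def[abs_def]
  using assms Ck_1_imp_has_C1 has_C1D(2)
  by (intro continuous_map_sum) (auto simp: unit_field_def)

lemma slice_by_parts:
  assumes w: "has_C1 N w D" "vanishes_off_cube N r w" and \<phi>: "unit_field N \<phi>"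
    and g: "\<And>t. (g has_real_derivative g' t) (at t)" "continuous_on UNIV g'" "g 0 = 0"
    and J: "J \<in> sets borel" "\<And>s. 0 \<le> g' s" "\<And>s. g' s \<le> indicator J s"
  shows "(\<integral>x. g (w x) * divergence N \<phi> x \<partial>lebB N) \<le> (\<integral>x. indicator J (w x) * gnorm N D x \<partial>lebB N)"
proof -
  have [measurable]: "w \<in> borel_measurable (lebB N)" "J \<in> sets borel"
    using has_C1D(4)[OF w(1)] J by auto
  have \<phi>C: "has_C1 N (\<lambda>x. \<phi> x i) (\<lambda>j. partial_deriv j (\<lambda>x. \<phi> x i))" if "i < N" for i
    using \<phi> that Ck_1_imp_has_C1 by (auto simp: unit_field_def)
  have gw: "has_C1 N (\<lambda>x. g (w x)) (\<lambda>i x. g' (w x) * D i x)"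
    by (rule has_C1_chain[OF w(1), where S=UNIV]) (use g in auto)
  have gv: "vanishes_off_cube N r (\<lambda>x. g (w x))"
    using w(2) g(3) by (auto simp: vanishes_off_cube_def)
  have i1: "integrable (lebB N) (\<lambda>x. g (w x) * partial_deriv i (\<lambda>x. \<phi> x i) x)" if "i < N" for i
    by (rule integrable_continuous[where r=r])
       (use gv has_C1D(1)[OF gw] has_C1D(2)[OF \<phi>C[OF that] that] in
         \<open>auto simp: vanishes_off_cube_def intro!: continuous_intros\<close>)
  have i2: "integrable (lebB N) (\<lambda>x. g' (w x) * D i x * \<phi> x i)" if "i < N" for i
    by (rule integrable_continuous[where r=r])
       (use has_C1_vanishes[OF gw gv that] has_C1D(2)[OF gw that] has_C1D(1)[OF \<phi>C[OF that]] in
         \<open>auto simp: vanishes_off_cube_def intro!: continuous_intros\<close>)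
  have "(\<integral>x. g (w x) * divergence N \<phi> x \<partial>lebB N) = (\<Sum>i<N. \<integral>x. g (w x) * partial_deriv i (\<lambda>x. \<phi> x i) x \<partial>lebB N)"
    unfolding divergence_def sum_distrib_left by (rule Bochner_Integration.integral_sum) (use i1 in auto)
  also have "\<dots> = (\<Sum>i<N. - (\<integral>x. g' (w x) * D i x * \<phi> x i \<partial>lebB N))"
    by (intro sum.cong integral_by_parts[OF gw \<phi>C gv]) auto
  also have "\<dots> = (\<integral>x. (\<Sum>i<N. - (g' (w x) * D i x * \<phi> x i)) \<partial>lebB N)"
    by (subst Bochner_Integration.integral_sum) (use i2 in auto)
  also have "\<dots> \<le> (\<integral>x. indicator J (w x) * gnorm N D x \<partial>lebB N)"
  proof (rule integral_mono)
    show "integrable (lebB N) (\<lambda>x. \<Sum>i<N. - (g' (w x) * D i x * \<phi> x i))"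
      using i2 by (intro Bochner_Integration.integrable_sum) auto
    show "integrable (lebB N) (\<lambda>x. indicator J (w x) * gnorm N D x)"
      by (rule Bochner_Integration.integrable_bound[OF has_C1_integrable(3)[OF w]])
         (use has_C1_integrable(4)[OF w] in \<open>auto simp: abs_mult split: split_indicator\<close>)
    fix x assume "x \<in> space (lebB N)"
    then have x: "x \<in> pts N" by simp
    have "(\<Sum>i<N. - (g' (w x) * D i x * \<phi> x i)) = g' (w x) * (- (\<Sum>i<N. D i x * \<phi> x i))"
      by (simp add: sum_distrib_left sum_negf mult.assoc)
    also have "\<dots> \<le> g' (w x) * (enorm N (\<lambda>i. D i x) * enorm N (\<phi> x))"
      using enorm_cauchy_schwarz[of "\<lambda>i. D i x" "\<phi> x" N] by (intro mult_left_mono J(2)) linarith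
    also have "\<dots> \<le> indicator J (w x) * (gnorm N D x * 1)"
      using \<phi> x J by (intro mult_mono) (auto simp: gnorm_def unit_field_def enorm_def L2_set_nonneg intro: mult_left_mono)
    finally show "(\<Sum>i<N. - (g' (w x) * D i x * \<phi> x i)) \<le> indicator J (w x) * gnorm N D x" by simp
  qed
  finally show ?thesis .
qed

text \<open>
  The truncation of \<open>w\<close> to the slice between the levels \<open>t\<close> and \<open>t + e\<close> is only Lipschitz. It is the limit of
  \<open>C\<^sup>1\<close> functions of \<open>w\<close> whose slope lies between zero and one and is supported in the slice, and for those
  one integrates by parts.
\<close>

lemma slice_le:
  assumes w: "has_C1 N w D" "vanishes_off_cube N r w" and \<phi>: "unit_field N \<phi>"
    and t: "0 \<le> t" "0 < e"
  shows "(\<integral>x. (max 0 (w x - t) - max 0 (w x - t - e)) * divergence N \<phi> x \<partial>lebB N)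
           \<le> (\<integral>x. indicator {t<..t + e} (w x) * gnorm N D x \<partial>lebB N)"
proof -
  \<comment> \<open>Two added to \<open>n\<close> keeps \<open>\<tau>\<close> strictly below \<open>e\<close>.\<close>
  define \<tau> where "\<tau> n = e / real (Suc (Suc n))" for n
  have \<tau>: "0 < \<tau> n" "\<tau> n < e" for n
    using t mult_strict_left_mono[of 1 "real (Suc (Suc n))" e]
    by (auto simp: \<tau>_def divide_less_eq)
  have \<tau>0: "\<tau> \<longlonglongrightarrow> 0"
    using LIMSEQ_Suc[OF tendsto_mult[OF tendsto_const[of e] LIMSEQ_inverse_real_of_nat]]
    by (simp add: \<tau>_def[abs_def] divide_inverse)
  \<comment> \<open>The second ramp starts at \<open>t + e - \<tau>\<close>, so that the slope vanishes from the level \<open>t + e\<close> on.\<close>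
  define g where "g n s = ramp (\<tau> n) (s - t) - ramp (\<tau> n) (s - t - e + \<tau> n)" for n s
  define g' where "g' n s = ramp' (\<tau> n) (s - t) - ramp' (\<tau> n) (s - t - e + \<tau> n)" for n s
  have dg: "(g n has_real_derivative g' n s) (at s)" for n s
    unfolding g_def[abs_def] g'_def
  proof -
    have "((\<lambda>s. ramp (\<tau> n) (s + c)) has_real_derivative ramp' (\<tau> n) (s + c) * 1) (at s)" for c
      by (rule DERIV_chain2[OF DERIV_ramp[OF \<tau>(1)]]) (auto intro!: derivative_eq_intros)
    from DERIV_diff[OF this[of "- t"] this[of "- t - e + \<tau> n"]]
    show "((\<lambda>s. ramp (\<tau> n) (s - t) - ramp (\<tau> n) (s - t - e + \<tau> n)) has_real_derivative
        ramp' (\<tau> n) (s - t) - ramp' (\<tau> n) (s - t - e + \<tau> n)) (at s)"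
      by (simp add: algebra_simps)
  qed
  have cg: "continuous_on UNIV (g' n)" for n
    unfolding g'_def[abs_def]
    by (intro continuous_intros continuous_on_compose2[OF continuous_ramp'[of UNIV]]) auto
  have g0: "g n 0 = 0" for n
    using t \<tau>(2)[of n] \<tau>(1)[of n] by (simp add: g_def ramp_def psq_def max_def)
  have g'nn: "0 \<le> g' n s" for n s
  proof -
    have "ramp' (\<tau> n) (s - t - e + \<tau> n) \<le> ramp' (\<tau> n) (s - t)"
      using \<tau>[of n] by (auto simp: ramp'_def divide_le_cancel max_def)
    then show ?thesis by (simp add: g'_def)
  qed
  have g'le: "g' n s \<le> indicator {t<..t + e} s" for n s
  proof (cases "s \<in> {t<..t + e}")
    case True
    then show ?thesis
      using ramp'_bounds(2)[OF \<tau>(1)[of n], of "s - t"] ramp'_bounds(1)[OF \<tau>(1)[of n], of "s - t - e + \<tau> n"]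
      by (simp add: g'_def)
  next
    case False
    then show ?thesis
      using \<tau>[of n] by (auto simp: g'_def ramp'_def max_def)
  qed
  have [measurable]: "w \<in> borel_measurable (lebB N)" "divergence N \<phi> \<in> borel_measurable (lebB N)"
    using has_C1D(4)[OF w(1)] borel_measurable_continuous_map[OF continuous_map_divergence[OF \<phi>]] by auto
  have [measurable]: "g n \<in> borel_measurable borel" for n
    using dg by (intro borel_measurable_continuous_onI continuous_at_imp_continuous_on ballI) (auto intro: DERIV_isCont)
  have glip: "\<bar>g n s\<bar> \<le> \<bar>s\<bar>" for n s
  proof -
    have "norm (g n s - g n 0) \<le> 1 * norm (s - 0)"
      by (rule field_differentiable_bound[where S=UNIV and f="g n" and f'="g' n"])
         (use dg g'nn g'le order_trans[OF g'le indicator_le_1] in auto)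
    then show ?thesis by (simp add: g0)
  qed
  have "(\<lambda>n. \<integral>x. g n (w x) * divergence N \<phi> x \<partial>lebB N)
     \<longlonglongrightarrow> (\<integral>x. (max 0 (w x - t) - max 0 (w x - t - e)) * divergence N \<phi> x \<partial>lebB N)"
  proof (rule integral_dominated_convergence[where w="\<lambda>x. \<bar>w x * divergence N \<phi> x\<bar>"])
    show "integrable (lebB N) (\<lambda>x. \<bar>w x * divergence N \<phi> x\<bar>)"
      by (rule integrable_abs, rule integrable_continuous[where r=r])
         (use w(2) has_C1D(1)[OF w(1)] continuous_map_divergence[OF \<phi>] in
           \<open>auto simp: vanishes_off_cube_def intro!: continuous_intros\<close>)
    have "(\<lambda>n. g n s) \<longlonglongrightarrow> max 0 (s - t) - max 0 (s - t - e)" for s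
    proof -
      have a: "(\<lambda>n. ramp (\<tau> n) (s - t)) \<longlonglongrightarrow> max 0 (s - t)"
      proof (rule LIM_zero_cancel, rule tendsto_0_le[OF \<tau>0, where K=1])
        show "\<forall>\<^sub>F n in sequentially. norm (ramp (\<tau> n) (s - t) - max 0 (s - t)) \<le> norm (\<tau> n) * 1"
          using ramp_approx \<tau> by (auto intro!: always_eventually simp: less_imp_le)
      qed
      have b: "(\<lambda>n. ramp (\<tau> n) (s - t - e + \<tau> n) - max 0 (s - t - e + \<tau> n)) \<longlonglongrightarrow> 0"
      proof (rule tendsto_0_le[OF \<tau>0, where K=1])
        show "\<forall>\<^sub>F n in sequentially. norm (ramp (\<tau> n) (s - t - e + \<tau> n) - max 0 (s - t - e + \<tau> n)) \<le> norm (\<tau> n) * 1"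
          using ramp_approx \<tau> by (auto intro!: always_eventually simp: less_imp_le)
      qed
      have c: "(\<lambda>n. max 0 (s - t - e + \<tau> n)) \<longlonglongrightarrow> max 0 (s - t - e + 0)"
        by (intro tendsto_intros \<tau>0)
      show ?thesis
        using tendsto_diff[OF a tendsto_add[OF b c]] by (simp add: g_def)
    qed
    then show "AE x in lebB N. (\<lambda>n. g n (w x) * divergence N \<phi> x)
          \<longlonglongrightarrow> (max 0 (w x - t) - max 0 (w x - t - e)) * divergence N \<phi> x"
      by (intro AE_I2 tendsto_mult tendsto_const)
    show "AE x in lebB N. norm (g n (w x) * divergence N \<phi> x) \<le> \<bar>w x * divergence N \<phi> x\<bar>" for n
      using glip by (intro AE_I2) (auto simp: abs_mult intro!: mult_right_mono)
  qed measurable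
  then show ?thesis
    by (rule LIMSEQ_le_const2)
       (use slice_by_parts[OF w \<phi> dg cg g0 _ g'nn g'le] in auto)
qed

text \<open>
  Multiplying out the quotient \<open>P(A) / |A|\<close> gives a condition that can be used for each \<open>k\<close> below the Cheeger
  constant, also while its finiteness is still open.
\<close>

definition cheeger_bound :: "nat \<Rightarrow> point set \<Rightarrow> real \<Rightarrow> bool" where
  "cheeger_bound N E k \<longleftrightarrow> 0 \<le> k \<and>
     (\<forall>A\<in>sets (leb N). A \<subseteq> E \<longrightarrow> 0 < emeasure (leb N) A \<longrightarrow>
        ennreal k * emeasure (leb N) A \<le> perimeter N A)"

lemma exists_field_of_cheeger_bound:
  assumes k: "cheeger_bound N E k" and k': "0 \<le> k'" "k' < k"
    and A: "A \<in> sets (lebB N)" "A \<subseteq> E" "0 < measure (lebB N) A" "emeasure (lebB N) A < \<infinity>"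
  obtains \<phi> where "unit_field N \<phi>"
    "k' * measure (lebB N) A < (\<integral>x. indicator A x * divergence N \<phi> x \<partial>lebB N)"
proof -
  have eA: "emeasure (leb N) A = ennreal (measure (lebB N) A)"
    unfolding emeasure_leb[OF A(1)]
    by (rule emeasure_eq_ennreal_measure) (use A(4) in auto)
  have "ennreal (k' * measure (lebB N) A) < ennreal (k * measure (lebB N) A)"
    using k' A by (subst ennreal_less_iff) auto
  also have "\<dots> = ennreal k * emeasure (leb N) A"
    using k' A by (simp add: eA ennreal_mult)
  also have "\<dots> \<le> perimeter N A"
    using k A(1,2,3) sets_leb[OF A(1)] by (auto simp: cheeger_bound_def eA)
  finally obtain \<phi> where \<phi>: "\<phi> \<in> C1_c_fields N" "\<forall>x\<in>topspace (euclid N). enorm N (\<phi> x) \<le> 1"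
    "ennreal (k' * measure (lebB N) A) < ennreal (\<integral>x. divergence N \<phi> x \<partial>leb_on N A)"
    unfolding perimeter_def by (auto simp: less_SUP_iff)
  then have u: "unit_field N \<phi>"
    by (auto simp: unit_field_def C1_c_fields_def)
  have "(\<integral>x. divergence N \<phi> x \<partial>leb_on N A) = (\<integral>x. indicator A x * divergence N \<phi> x \<partial>lebB N)"
    by (rule integral_leb_on[OF borel_measurable_continuous_map[OF continuous_map_divergence[OF u]] A(1)])
  then show ?thesis
    using \<phi>(3) k'(1) by (intro that[OF u]) (simp add: ennreal_less_iff)
qed

text \<open>
  The normalised slices converge pointwise to the indicator of the strict superlevel set when the
  slice shrinks towards \<open>t\<close> from the right. From the left the limit would be the closed superlevel set.
\<close>

lemma superlevel_divergence_tendsto: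
  assumes w: "has_C1 N w D" "vanishes_off_cube N r w" "0 \<le> r" and \<phi>: "unit_field N \<phi>" and t: "0 \<le> t"
    and e: "e \<longlonglongrightarrow> 0" "\<And>n. 0 < e n"
  shows "(\<lambda>n. \<integral>x. (max 0 (w x - t) - max 0 (w x - t - e n)) / e n * divergence N \<phi> x \<partial>lebB N)
      \<longlonglongrightarrow> (\<integral>x. indicator {x \<in> pts N. t < w x} x * divergence N \<phi> x \<partial>lebB N)"
proof -
  have [measurable]: "w \<in> borel_measurable (lebB N)" "divergence N \<phi> \<in> borel_measurable (lebB N)"
    using has_C1D(4)[OF w(1)] borel_measurable_continuous_map[OF continuous_map_divergence[OF \<phi>]] by auto
  have [measurable]: "{x \<in> pts N. t < w x} \<in> sets (lebB N)"
    unfolding space_lebB[symmetric] by measurable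
  obtain C where C: "0 \<le> C" "\<And>x. x \<in> cube N r \<Longrightarrow> \<bar>divergence N \<phi> x\<bar> \<le> C"
    using bounded_on_cube[OF continuous_map_divergence[OF \<phi>]] by blast
  show ?thesis
  proof (rule integral_dominated_convergence[where w="\<lambda>x. C * indicator (cube N r) x"])
    have "emeasure (lebB N) (cube N r) < \<infinity>"
      using w(3) by (subst emeasure_cube) auto
    then show "integrable (lebB N) (\<lambda>x. C * indicator (cube N r) x)"
      by (intro integrable_mult_right integrable_real_indicator) auto
    have lim: "(\<lambda>n. (max 0 (s - t) - max 0 (s - t - e n)) / e n) \<longlonglongrightarrow> indicator {t<..} s" for s
    proof (cases "t < s")
      case True
      then have "\<forall>\<^sub>F n in sequentially. e n < s - t"
        using order_tendstoD(2)[OF e(1), of "s - t"] by simp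
      then have "\<forall>\<^sub>F n in sequentially. (max 0 (s - t) - max 0 (s - t - e n)) / e n = 1"
      proof eventually_elim
        case (elim n)
        then show ?case using e(2)[of n] True by (simp add: max_def)
      qed
      with True show ?thesis by (simp add: tendsto_eventually)
    next
      case False
      then have "(max 0 (s - t) - max 0 (s - t - e n)) / e n = 0" for n
        using e(2)[of n] by (simp add: max_def)
      then have "(\<lambda>n. (max 0 (s - t) - max 0 (s - t - e n)) / e n) = (\<lambda>n. 0)"
        by (rule ext)
      with False show ?thesis by (simp only: tendsto_const) simp
    qed
    show "AE x in lebB N. (\<lambda>n. (max 0 (w x - t) - max 0 (w x - t - e n)) / e n * divergence N \<phi> x)
        \<longlonglongrightarrow> indicator {x \<in> pts N. t < w x} x * divergence N \<phi> x"
    proof (rule AE_I2)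
      fix x assume "x \<in> space (lebB N)"
      then show "(\<lambda>n. (max 0 (w x - t) - max 0 (w x - t - e n)) / e n * divergence N \<phi> x)
        \<longlonglongrightarrow> indicator {x \<in> pts N. t < w x} x * divergence N \<phi> x"
        using tendsto_mult[OF lim[of "w x"] tendsto_const] by (auto simp: indicator_def)
    qed
    show "AE x in lebB N. norm ((max 0 (w x - t) - max 0 (w x - t - e n)) / e n * divergence N \<phi> x)
        \<le> C * indicator (cube N r) x" for n
    proof (rule AE_I2)
      fix x assume "x \<in> space (lebB N)"
      then have x: "x \<in> pts N" by simp
      show "norm ((max 0 (w x - t) - max 0 (w x - t - e n)) / e n * divergence N \<phi> x) \<le> C * indicator (cube N r) x"
      proof (cases "x \<in> cube N r")
        case True
        have "\<bar>(max 0 (w x - t) - max 0 (w x - t - e n)) / e n\<bar> \<le> 1"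
          using e(2)[of n] by (auto simp: max_def)
        then have "\<bar>(max 0 (w x - t) - max 0 (w x - t - e n)) / e n\<bar> * \<bar>divergence N \<phi> x\<bar> \<le> 1 * C"
          using C True by (intro mult_mono) auto
        then show ?thesis using True by (simp add: abs_mult)
      next
        case False
        then have "w x = 0" using w(2) x by (simp add: vanishes_off_cube_def)
        then show ?thesis using t e(2)[of n] False by (simp add: max_def)
      qed
    qed
  qed measurable
qed

text \<open>
  Essentially the coarea formula. Let \<open>A(t)\<close> be the integral of \<open>|\<nabla>w|\<close> over \<open>{w \<le> t}\<close> and \<open>B(t) = \<integral>min(w, t)\<close>. A
  field almost optimal for the perimeter of \<open>{w > t}\<close>, tested against thin slices above the level \<open>t\<close>, shows
  that the lower right Dini derivative of \<open>A\<close> at \<open>t\<close> is at least \<open>k' |{w > t}|\<close> for each \<open>k' < k\<close>, while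
  \<open>B\<close> grows at rate at most \<open>|{w > t}|\<close>. So \<open>k' B \<le> A\<close>, and the claim is the case of large \<open>t\<close>.
\<close>

proposition cheeger_bound_L1:
  assumes k: "cheeger_bound N E k"
    and w: "has_C1 N w D" "vanishes_off_cube N r w" "\<And>x. x \<in> pts N \<Longrightarrow> 0 \<le> w x"
    and E: "\<And>x. x \<in> pts N \<Longrightarrow> w x \<noteq> 0 \<Longrightarrow> x \<in> E"
  shows "k * (\<integral>x. w x \<partial>lebB N) \<le> (\<integral>x. gnorm N D x \<partial>lebB N)"
proof -
  define r' where "r' = max r 0"
  have r': "0 \<le> r'" "vanishes_off_cube N r' w"
    using w(2) by (auto simp: r'_def vanishes_off_cube_def in_cube_iff le_max_iff_disj)
  have [measurable]: "w \<in> borel_measurable (lebB N)" "gnorm N D \<in> borel_measurable (lebB N)"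
    using has_C1D(4)[OF w(1)] has_C1_integrable(4)[OF w(1,2)] by auto
  have iw: "integrable (lebB N) w" and iG: "integrable (lebB N) (gnorm N D)"
    using has_C1_integrable[OF w(1,2)] by auto
  have iGS: "integrable (lebB N) (\<lambda>x. indicator J (w x) * gnorm N D x)" if [measurable]: "J \<in> sets borel" for J
    by (rule Bochner_Integration.integrable_bound[OF iG]) (auto simp: abs_mult split: split_indicator)
  define A where "A t = (\<integral>x. indicator {..t} (w x) * gnorm N D x \<partial>lebB N)" for t
  define B where "B t = (\<integral>x. min (w x) t \<partial>lebB N)" for t
  have ib: "integrable (lebB N) (\<lambda>x. min (w x) t)" if "0 \<le> t" for t
    by (rule Bochner_Integration.integrable_bound[OF iw]) (use w(3) that in auto)
  define B' where "B' t = B (max t 0)" for t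
  have monoA: "mono A"
    unfolding mono_def A_def
    by (intro allI impI integral_mono iGS) (auto split: split_indicator)
  define L where "L t = {x \<in> pts N. t < w x}" for t
  have Ls [measurable]: "L t \<in> sets (lebB N)" for t
    unfolding L_def space_lebB[symmetric] by measurable
  have Lcube: "L t \<subseteq> cube N r'" if "0 \<le> t" for t
    using r'(2) that by (auto simp: L_def vanishes_off_cube_def)
  have ecube: "emeasure (lebB N) (cube N r') < \<infinity>"
    using r' by (subst emeasure_cube) auto
  have eL: "emeasure (lebB N) (L t) < \<infinity>" if "0 \<le> t" for t
    using emeasure_mono[OF Lcube[OF that], of "lebB N"] ecube by (auto simp: order_le_less_trans)
  have Bstep: "B (t + e) - B t = (\<integral>x. max 0 (w x - t) - max 0 (w x - t - e) \<partial>lebB N)" if "0 \<le> t" "0 \<le> e" for t e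
  proof -
    have "B (t + e) - B t = (\<integral>x. min (w x) (t + e) - min (w x) t \<partial>lebB N)"
      unfolding B_def using that by (intro Bochner_Integration.integral_diff[symmetric] ib) auto
    also have "\<dots> = (\<integral>x. max 0 (w x - t) - max 0 (w x - t - e) \<partial>lebB N)"
      by (intro Bochner_Integration.integral_cong) (use that in \<open>auto simp: min_def max_def\<close>)
    finally show ?thesis .
  qed
  have Ble: "B (t + e) - B t \<le> e * measure (lebB N) (L t)" if t: "0 \<le> t" "0 \<le> e" for t e
  proof -
    have "B (t + e) - B t = (\<integral>x. min (w x) (t + e) - min (w x) t \<partial>lebB N)"
      unfolding B_def using that by (intro Bochner_Integration.integral_diff[symmetric] ib) auto
    also have "\<dots> \<le> (\<integral>x. e * indicator (L t) x \<partial>lebB N)"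
    proof (rule integral_mono)
      show "integrable (lebB N) (\<lambda>x. min (w x) (t + e) - min (w x) t)"
        using t by (intro Bochner_Integration.integrable_diff ib) auto
      show "integrable (lebB N) (\<lambda>x. e * indicator (L t) x)"
        using eL[OF t(1)] by (intro integrable_mult_right integrable_real_indicator) auto
      fix x assume x: "x \<in> space (lebB N)"
      show "min (w x) (t + e) - min (w x) t \<le> e * indicator (L t) x"
      proof (cases "t < w x")
        case True
        then have "x \<in> L t" using x by (simp add: L_def)
        then show ?thesis using True by (simp add: min_def)
      next
        case False
        then have "x \<notin> L t" by (simp add: L_def)
        moreover have "min (w x) (t + e) = w x" "min (w x) t = w x"
          using False t by simp_all
        ultimately show ?thesis by simp
      qed
    qed
    also have "\<dots> = e * measure (lebB N) (L t)"
      using sets.sets_into_space[OF Ls[of t]] by (simp add: Int_absorb2)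
    finally show ?thesis .
  qed
  have Bnn: "0 \<le> B (t + e) - B t" if "0 \<le> t" "0 \<le> e" for t e
    unfolding Bstep[OF that] by (rule integral_nonneg_AE) (use that in auto)
  define V where "V = measure (lebB N) (cube N r')"
  have LV: "measure (lebB N) (L t) \<le> V" if "0 \<le> t" for t
    unfolding V_def using Lcube[OF that] ecube by (intro measure_mono_fmeasurable) (auto simp: fmeasurable_def)
  have lipB: "\<bar>B s - B t\<bar> \<le> V * \<bar>s - t\<bar>" if "0 \<le> s" "0 \<le> t" for s t
  proof -
    have *: "\<bar>B s - B t\<bar> \<le> V * \<bar>s - t\<bar>" if "0 \<le> t" "t \<le> s" for s t
      using Ble[of t "s - t"] Bnn[of t "s - t"] LV[of t] that mult_left_mono[of "measure (lebB N) (L t)" V "s - t"]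
      by (simp add: mult.commute)
    show ?thesis
      using *[of t s] *[of s t] that by (cases "t \<le> s") (auto simp: abs_minus_commute)
  qed
  have contB: "continuous_on UNIV B'"
  proof (rule continuous_at_imp_continuous_on, intro ballI)
    fix t
    have "(B' \<longlongrightarrow> B' t) (at t)"
    proof (rule LIM_zero_cancel, rule tendsto_0_le[where K=V])
      show "((\<lambda>s. s - t) \<longlongrightarrow> 0) (at t)" by (rule LIM_zero) (rule tendsto_ident_at)
      have "\<bar>B' s - B' t\<bar> \<le> \<bar>s - t\<bar> * V" for s
      proof -
        have "V * \<bar>max s 0 - max t 0\<bar> \<le> V * \<bar>s - t\<bar>"
          by (intro mult_left_mono) (auto simp: V_def)
        then show ?thesis
          using lipB[of "max s 0" "max t 0"] by (simp add: B'_def mult.commute)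
      qed
      then show "\<forall>\<^sub>F s in at t. norm (B' s - B' t) \<le> norm (s - t) * V"
        by (intro always_eventually) auto
    qed
    then show "isCont B' t" by (simp add: isCont_def)
  qed
  have main: "k' * (\<integral>x. w x \<partial>lebB N) \<le> (\<integral>x. gnorm N D x \<partial>lebB N)" if k': "0 \<le> k'" "k' < k" for k'
  proof -
    have step: "\<exists>d>0. \<forall>e. 0 < e \<and> e < d \<longrightarrow> k' * B' (t + e) - k' * B' t \<le> A (t + e) - A t"
      if t: "0 \<le> t" for t
    proof (rule ccontr)
      assume neg: "\<not> (\<exists>d>0. \<forall>e. 0 < e \<and> e < d \<longrightarrow> k' * B' (t + e) - k' * B' t \<le> A (t + e) - A t)"
      have "\<exists>e. 0 < e \<and> e < 1 / real (Suc n) \<and> A (t + e) - A t < k' * B' (t + e) - k' * B' t" for n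
        using neg[unfolded not_ex, rule_format, of "1 / real (Suc n)"] by (auto simp: not_le)
      then obtain e where e: "\<And>n. 0 < e n" "\<And>n. e n < 1 / real (Suc n)"
        "\<And>n. A (t + e n) - A t < k' * B' (t + e n) - k' * B' t" by metis
      \<comment> \<open>The step condition fails along a sequence of increments tending to zero; a field for the superlevel
        set contradicts this in the limit.\<close>
      have e0: "e \<longlonglongrightarrow> 0"
        by (rule tendsto_sandwich[OF _ _ tendsto_const LIMSEQ_inverse_real_of_nat])
           (use e(1,2) in \<open>auto simp: inverse_eq_divide less_imp_le intro!: always_eventually\<close>)
      have up: "A (t + e n) - A t < k' * (e n * measure (lebB N) (L t))" for n
        using e(3)[of n] Ble[OF t, of "e n"] e(1)[of n] t k'(1)
          mult_left_mono[of "B (t + e n) - B t" "e n * measure (lebB N) (L t)" k']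
        by (simp add: B'_def right_diff_distrib)
      have Adiff: "A (t + e n) - A t = (\<integral>x. indicator {t<..t + e n} (w x) * gnorm N D x \<partial>lebB N)" for n
      proof -
        have "A (t + e n) - A t = (\<integral>x. indicator {..t + e n} (w x) * gnorm N D x - indicator {..t} (w x) * gnorm N D x \<partial>lebB N)"
          unfolding A_def by (intro Bochner_Integration.integral_diff[symmetric] iGS) auto
        also have "\<dots> = (\<integral>x. indicator {t<..t + e n} (w x) * gnorm N D x \<partial>lebB N)"
          using e(1)[of n] by (intro Bochner_Integration.integral_cong) (auto split: split_indicator)
        finally show ?thesis .
      qed
      have "0 \<le> A (t + e n) - A t" for n
        unfolding Adiff by (rule integral_nonneg_AE) auto
      from this[of 0] up[of 0] have "0 < k' * (e 0 * measure (lebB N) (L t))" by simp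
      then have mu: "0 < measure (lebB N) (L t)"
        by (cases "measure (lebB N) (L t) = 0") (auto simp: less_le)
      have "L t \<subseteq> E" using E t by (auto simp: L_def)
      from exists_field_of_cheeger_bound[OF k k' Ls this mu eL[OF t]]
      obtain \<phi> where \<phi>: "unit_field N \<phi>"
        "k' * measure (lebB N) (L t) < (\<integral>x. indicator (L t) x * divergence N \<phi> x \<partial>lebB N)" .
      have "(\<integral>x. (max 0 (w x - t) - max 0 (w x - t - e n)) / e n * divergence N \<phi> x \<partial>lebB N) \<le> k' * measure (lebB N) (L t)" for n
      proof -
        have "(\<integral>x. (max 0 (w x - t) - max 0 (w x - t - e n)) / e n * divergence N \<phi> x \<partial>lebB N)
            = (\<integral>x. (max 0 (w x - t) - max 0 (w x - t - e n)) * divergence N \<phi> x \<partial>lebB N) / e n"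
          unfolding times_divide_eq_left by (rule integral_divide_zero)
        also have "\<dots> \<le> (A (t + e n) - A t) / e n"
          unfolding Adiff using e(1)[of n] by (intro divide_right_mono slice_le[OF w(1,2) \<phi>(1) t]) auto
        also have "\<dots> \<le> k' * measure (lebB N) (L t)"
          using up[of n] e(1)[of n] by (simp add: pos_divide_le_eq mult_ac)
        finally show ?thesis .
      qed
      then have "(\<integral>x. indicator (L t) x * divergence N \<phi> x \<partial>lebB N) \<le> k' * measure (lebB N) (L t)"
        unfolding L_def
        by (intro LIMSEQ_le_const2[OF superlevel_divergence_tendsto[OF w(1) r'(2,1) \<phi>(1) t e0 e(1)]]) auto
      with \<phi>(2) show False by simp
    qed
    obtain C where C: "0 \<le> C" "\<And>x. x \<in> pts N \<Longrightarrow> \<bar>w x\<bar> \<le> C"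
      using bounded_on_pts[OF has_C1D(1)[OF w(1)] w(2)] by blast
    have "k' * B' C - k' * B' 0 \<le> A C - A 0"
      by (rule dini_comparison[OF monoA _ step C(1)]) (intro continuous_intros contB)
    moreover have "B' C = (\<integral>x. w x \<partial>lebB N)"
      unfolding B'_def B_def using C by (intro Bochner_Integration.integral_cong) (auto simp: min_def max_def dest: C(2))
    moreover have "B' 0 = 0"
      unfolding B'_def B_def using w(3) by (subst Bochner_Integration.integral_cong[where g="\<lambda>_. 0"]) auto
    moreover have "A C \<le> (\<integral>x. gnorm N D x \<partial>lebB N)"
      unfolding A_def by (intro integral_mono iGS iG) (auto split: split_indicator)
    moreover have "0 \<le> A 0"
      unfolding A_def by (rule integral_nonneg_AE) auto
    ultimately show ?thesis by simp
  qed
  have k0: "0 \<le> k" using k by (simp add: cheeger_bound_def)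
  show ?thesis
  proof (cases "k = 0")
    case False
    show ?thesis
    proof (rule field_le_mult_one_interval)
      fix z :: real assume "0 < z" "z < 1"
      then show "z * (k * (\<integral>x. w x \<partial>lebB N)) \<le> (\<integral>x. gnorm N D x \<partial>lebB N)"
        using main[of "z * k"] k0 False by (simp add: mult.assoc)
    qed
  qed (simp add: integral_nonneg_AE)
qed

section \<open>The improved inequality in the exponent one\<close>

text \<open>
  The three terms on the right dominate \<open>t\<close> on complementary ranges: the first for \<open>t \<le> \<alpha>\<close>, the second (equal to
  \<open>G(t) - t G'(t)\<close> for the logarithmic test function \<open>G\<close>) for \<open>\<alpha> < t < 2\<beta>\<close>, and the third (\<open>8 W(t) - t W'(t)\<close> for
  the ramp \<open>W\<close>) for \<open>t \<ge> 2\<beta>\<close>. Between \<open>\<beta>\<close> and \<open>2\<beta>\<close> the third term may be negative, but not below \<open>-t\<close>, and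
  the second term is at least \<open>2t\<close> there.
\<close>

lemma level_inequality:
  fixes t \<alpha> \<beta> :: real
  assumes "0 < \<alpha>" "\<alpha> \<le> \<beta>" "0 \<le> t"
  shows "t \<le> (if t = 0 then 0 else \<alpha>) + 12 * (t\<^sup>2 * (2 * \<beta>) / ((\<alpha> + t) * (\<alpha> + t + 2 * \<beta>)))
      + (8 * ramp \<beta> (t - \<beta>) - ramp' \<beta> (t - \<beta>) * t)"
proof -
  have \<beta>: "0 < \<beta>" using assms by linarith
  define F where "F = t\<^sup>2 * (2 * \<beta>) / ((\<alpha> + t) * (\<alpha> + t + 2 * \<beta>))"
  have F0: "0 \<le> F" using assms \<beta> by (simp add: F_def)
  have F: "t / 6 \<le> F" if "\<alpha> < t" "t < 2 * \<beta>"
  proof -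
    have "t / 6 * ((\<alpha> + t) * (\<alpha> + t + 2 * \<beta>)) \<le> t / 6 * (2 * t * (6 * \<beta>))"
      using assms \<beta> that by (intro mult_left_mono mult_mono) auto
    also have "\<dots> = t\<^sup>2 * (2 * \<beta>)" by (simp add: power2_eq_square)
    finally show ?thesis
      unfolding F_def using assms \<beta> by (subst pos_le_divide_eq) (auto intro!: mult_pos_pos add_nonneg_pos)
  qed
  consider "t \<le> \<alpha>" | "\<alpha> < t" "t \<le> \<beta>" | "\<beta> < t" "t < 2 * \<beta>" | "2 * \<beta> \<le> t" by linarith
  then have "t \<le> (if t = 0 then 0 else \<alpha>) + 12 * F + (8 * ramp \<beta> (t - \<beta>) - ramp' \<beta> (t - \<beta>) * t)"
  proof cases
    case 1
    then have "ramp \<beta> (t - \<beta>) = 0" "ramp' \<beta> (t - \<beta>) = 0"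
      using assms \<beta> by (auto simp: ramp_def ramp'_def psq_def max_def)
    then show ?thesis using 1 F0 assms by auto
  next
    case 2
    then have "ramp \<beta> (t - \<beta>) = 0" "ramp' \<beta> (t - \<beta>) = 0"
      using assms \<beta> by (auto simp: ramp_def ramp'_def psq_def max_def)
    then show ?thesis using 2 F \<beta> assms by auto
  next
    case 3
    define u where "u = t - \<beta>"
    have u: "0 < u" "u < \<beta>" "t = u + \<beta>" using 3 by (auto simp: u_def)
    have r: "ramp \<beta> u = u\<^sup>2 / (2 * \<beta>)" "ramp' \<beta> u = u / \<beta>"
      using u by (auto simp: ramp_def ramp'_def psq_def max_def)
    have "8 * ramp \<beta> u - ramp' \<beta> u * t = 3 * u\<^sup>2 / \<beta> - u"
      unfolding r using \<beta> u(3) by (simp add: field_simps power2_eq_square)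
    moreover have "0 \<le> 3 * u\<^sup>2 / \<beta>" using \<beta> by simp
    moreover have "t / 6 \<le> F" using 3 assms by (intro F) auto
    ultimately have "t \<le> \<alpha> + 12 * F + (8 * ramp \<beta> u - ramp' \<beta> u * t)"
      using assms(1) u by linarith
    then show ?thesis using 3 \<beta> by (simp add: u_def)
  next
    case 4
    have "ramp' \<beta> (t - \<beta>) = 1" "ramp \<beta> (t - \<beta>) = t - 3 / 2 * \<beta>"
      using 4 \<beta> by (auto simp: ramp_def ramp'_def psq_def max_def field_simps power2_eq_square)
    then show ?thesis using 4 F0 \<beta> assms by auto
  qed
  then show ?thesis by (simp only: F_def)
qed

text \<open>
  The logarithm makes \<open>G(t) - t G'(t)\<close> comparable to \<open>t\<close> on all levels between \<open>\<alpha>\<close> and \<open>2\<beta>\<close>, while \<open>G'\<close> stays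
  below \<open>ln (1 + 2\<beta> / \<alpha>)\<close>. The test function \<open>t / (1 + t)\<close>, suitably scaled, would lose a power of \<open>\<beta> / \<alpha>\<close> here, which the
  localisation could not compensate.
\<close>

definition log_test :: "real \<Rightarrow> real \<Rightarrow> real \<Rightarrow> real" where
  "log_test \<alpha> \<beta> t = t * ln (1 + 2 * \<beta> / (\<alpha> + t))"

definition log_test' :: "real \<Rightarrow> real \<Rightarrow> real \<Rightarrow> real" where
  "log_test' \<alpha> \<beta> t = ln (1 + 2 * \<beta> / (\<alpha> + t)) - t * (2 * \<beta>) / ((\<alpha> + t) * (\<alpha> + t + 2 * \<beta>))"

lemma log_test_fractions:
  fixes p b t :: real
  assumes "0 < p" "0 < b"
  shows "1 / (1 + b / p) * (- b / p\<^sup>2) * t = - (t * b / (p * (p + b)))"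
    and "p * b / (p * (p + b)) = 1 - inverse (1 + b / p)"
proof -
  have e: "1 + b / p = (p + b) / p" using assms by (simp add: field_simps)
  have "0 < p + b" using assms by simp
  then show "1 / (1 + b / p) * (- b / p\<^sup>2) * t = - (t * b / (p * (p + b)))"
    unfolding e using assms by (simp add: power2_eq_square mult_ac)
  show "p * b / (p * (p + b)) = 1 - inverse (1 + b / p)"
    unfolding e using assms \<open>0 < p + b\<close> by (simp add: diff_divide_eq_iff[symmetric]) (simp add: field_simps)
qed

lemma DERIV_log_test:
  assumes "0 < \<alpha>" "0 < \<beta>" "0 \<le> t"
  shows "(log_test \<alpha> \<beta> has_real_derivative log_test' \<alpha> \<beta> t) (at t)"
proof -
  have p: "0 < \<alpha> + t" "0 < \<alpha> + t + 2 * \<beta>" using assms by linarith+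
  have q: "0 < 1 + 2 * \<beta> / (\<alpha> + t)" using assms p by (simp add: add_pos_pos)
  have "((\<lambda>t. 1 + 2 * \<beta> / (\<alpha> + t)) has_real_derivative - (2 * \<beta>) / (\<alpha> + t)\<^sup>2) (at t)"
    using p by (auto intro!: derivative_eq_intros simp: power2_eq_square)
  from DERIV_mult[OF DERIV_ident DERIV_chain2[OF DERIV_ln_divide[OF q] this]]
  have "(log_test \<alpha> \<beta> has_real_derivative
      1 * ln (1 + 2 * \<beta> / (\<alpha> + t)) + 1 / (1 + 2 * \<beta> / (\<alpha> + t)) * (- (2 * \<beta>) / (\<alpha> + t)\<^sup>2) * t) (at t)"
    by (simp only: log_test_def[abs_def])
  moreover have "1 / (1 + 2 * \<beta> / (\<alpha> + t)) * (- (2 * \<beta>) / (\<alpha> + t)\<^sup>2) * t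
      = - (t * (2 * \<beta>) / ((\<alpha> + t) * (\<alpha> + t + 2 * \<beta>)))"
    using log_test_fractions(1)[of "\<alpha> + t" "2 * \<beta>" t] p(1) assms by simp
  ultimately show ?thesis by (simp add: log_test'_def)
qed

lemma log_test'_bounds:
  assumes "0 < \<alpha>" "0 < \<beta>" "0 \<le> t"
  shows "0 \<le> log_test' \<alpha> \<beta> t" "log_test' \<alpha> \<beta> t \<le> ln (1 + 2 * \<beta> / \<alpha>)"
proof -
  have p: "0 < \<alpha> + t" "0 < \<alpha> + t + 2 * \<beta>" using assms by linarith+
  define y where "y = 2 * \<beta> / (\<alpha> + t)"
  have y: "0 < y" using assms p by (simp add: y_def)
  have "t * (2 * \<beta>) / ((\<alpha> + t) * (\<alpha> + t + 2 * \<beta>)) \<le> (\<alpha> + t) * (2 * \<beta>) / ((\<alpha> + t) * (\<alpha> + t + 2 * \<beta>))"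
    using assms p by (intro divide_right_mono mult_right_mono) auto
  also have "\<dots> = 1 - inverse (1 + y)"
    unfolding y_def by (rule log_test_fractions(2)) (use p assms in auto)
  also have "\<dots> \<le> ln (1 + y)"
    using ln_le_minus_one[of "inverse (1 + y)"] y by (simp add: ln_inverse)
  finally show "0 \<le> log_test' \<alpha> \<beta> t" by (simp add: log_test'_def y_def)
  have "0 \<le> t * (2 * \<beta>) / ((\<alpha> + t) * (\<alpha> + t + 2 * \<beta>))" using assms p by simp
  moreover have "ln (1 + 2 * \<beta> / (\<alpha> + t)) \<le> ln (1 + 2 * \<beta> / \<alpha>)"
  proof -
    have "2 * \<beta> / (\<alpha> + t) \<le> 2 * \<beta> / \<alpha>"
      using assms by (intro divide_left_mono) auto
    then show ?thesis using y by (intro ln_mono) (auto simp: y_def)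
  qed
  ultimately show "log_test' \<alpha> \<beta> t \<le> ln (1 + 2 * \<beta> / \<alpha>)" by (simp add: log_test'_def)
qed

lemma continuous_log_test': "0 < \<alpha> \<Longrightarrow> 0 < \<beta> \<Longrightarrow> continuous_on {0..} (log_test' \<alpha> \<beta>)"
  unfolding log_test'_def[abs_def]
proof (intro continuous_intros ballI)
  fix t :: real assume a: "0 < \<alpha>" "0 < \<beta>" "t \<in> {0..}"
  then have p: "0 < \<alpha> + t" by simp
  then show "\<alpha> + t \<noteq> 0" by simp
  have "0 < 2 * \<beta> / (\<alpha> + t)" using a p by simp
  then show "1 + 2 * \<beta> / (\<alpha> + t) \<noteq> 0" by linarith
  show "(\<alpha> + t) * (\<alpha> + t + 2 * \<beta>) \<noteq> 0" using a p by auto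
qed

lemma markov_level:
  assumes "integrable (lebB N) v" "\<And>x. x \<in> pts N \<Longrightarrow> 0 \<le> v x" "0 < b"
  shows "emeasure (lebB N) {x \<in> pts N. b < v x} \<le> ennreal ((\<integral>x. v x \<partial>lebB N) / b)"
proof -
  have [measurable]: "v \<in> borel_measurable (lebB N)" using assms by auto
  have S [measurable]: "{x \<in> pts N. b < v x} \<in> sets (lebB N)"
    unfolding space_lebB[symmetric] by measurable
  have "emeasure (lebB N) {x \<in> pts N. b < v x} = (\<integral>\<^sup>+x. indicator {x \<in> pts N. b < v x} x \<partial>lebB N)"
    by (rule nn_integral_indicator[symmetric]) (rule S)
  also have "\<dots> \<le> (\<integral>\<^sup>+x. ennreal (v x / b) \<partial>lebB N)"
  proof (rule nn_integral_mono)
    fix x assume "x \<in> space (lebB N)"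
    show "indicator {x \<in> pts N. b < v x} x \<le> ennreal (v x / b)"
      using assms(3) by (auto split: split_indicator simp: ennreal_ge_1)
  qed
  also have "\<dots> = ennreal (\<integral>x. v x / b \<partial>lebB N)"
    by (rule nn_integral_eq_integral) (use assms in auto)
  finally show ?thesis by simp
qed

text \<open>
  Replacing \<open>|\<nabla>v|\<close> by \<open>k v\<close> in \<open>\<integral>G'(v) |\<nabla>v|\<close> costs at most the supremum of \<open>G'\<close> times the distance of the two
  functions.
\<close>

lemma pushed_gradient_le:
  fixes G' :: "real \<Rightarrow> real"
  assumes v: "has_C1 N v D" "vanishes_off_cube N r v" "\<And>x. x \<in> pts N \<Longrightarrow> 0 \<le> v x"
    and G': "\<And>t. 0 \<le> t \<Longrightarrow> 0 \<le> G' t" "\<And>t. 0 \<le> t \<Longrightarrow> G' t \<le> \<Lambda>"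
    and m: "(\<lambda>x. G' (v x)) \<in> borel_measurable (lebB N)" and k: "0 \<le> k"
  shows "(\<integral>x. gnorm N (\<lambda>i x. G' (v x) * D i x) x \<partial>lebB N)
     \<le> k * (\<integral>x. G' (v x) * v x \<partial>lebB N) + \<Lambda> * (\<integral>x. \<bar>gnorm N D x - k * v x\<bar> \<partial>lebB N)"
    and "integrable (lebB N) (\<lambda>x. G' (v x) * v x)"
proof -
  have [measurable]: "v \<in> borel_measurable (lebB N)" "gnorm N D \<in> borel_measurable (lebB N)"
    using has_C1D(4)[OF v(1)] has_C1_integrable(4)[OF v(1,2)] by auto
  note m[measurable]
  have iv: "integrable (lebB N) v" and iG: "integrable (lebB N) (gnorm N D)"
    using has_C1_integrable[OF v(1,2)] by auto
  have bd: "\<bar>G' (v x)\<bar> \<le> \<Lambda>" "0 \<le> G' (v x)" if "x \<in> pts N" for x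
    using G' v(3)[OF that] by auto
  have L0: "0 \<le> \<Lambda>" using G'[of 0] by auto
  show i1: "integrable (lebB N) (\<lambda>x. G' (v x) * v x)"
    by (rule Bochner_Integration.integrable_bound[of _ "\<lambda>x. \<Lambda> * v x"])
       (use iv bd v(3) L0 in \<open>auto simp: abs_mult intro!: mult_mono\<close>)
  have i2: "integrable (lebB N) (\<lambda>x. G' (v x) * gnorm N D x)"
    by (rule Bochner_Integration.integrable_bound[of _ "\<lambda>x. \<Lambda> * gnorm N D x"])
       (use iG bd L0 in \<open>auto simp: abs_mult intro!: mult_mono\<close>)
  have i3: "integrable (lebB N) (\<lambda>x. \<bar>gnorm N D x - k * v x\<bar>)"
    using iv iG by auto
  have "(\<integral>x. gnorm N (\<lambda>i x. G' (v x) * D i x) x \<partial>lebB N) = (\<integral>x. G' (v x) * gnorm N D x \<partial>lebB N)"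
    by (intro Bochner_Integration.integral_cong) (use bd in \<open>auto simp: gnorm_scale\<close>)
  also have "\<dots> \<le> (\<integral>x. k * (G' (v x) * v x) + \<Lambda> * \<bar>gnorm N D x - k * v x\<bar> \<partial>lebB N)"
  proof (rule integral_mono)
    fix x assume "x \<in> space (lebB N)"
    then have x: "x \<in> pts N" by simp
    have "G' (v x) * (gnorm N D x - k * v x) \<le> G' (v x) * \<bar>gnorm N D x - k * v x\<bar>"
      using bd[OF x] by (intro mult_left_mono) auto
    also have "\<dots> \<le> \<Lambda> * \<bar>gnorm N D x - k * v x\<bar>"
      using bd[OF x] by (intro mult_right_mono) auto
    finally show "G' (v x) * gnorm N D x \<le> k * (G' (v x) * v x) + \<Lambda> * \<bar>gnorm N D x - k * v x\<bar>"
      by (simp add: algebra_simps)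
  qed (use i1 i2 i3 in auto)
  also have "\<dots> = k * (\<integral>x. G' (v x) * v x \<partial>lebB N) + \<Lambda> * (\<integral>x. \<bar>gnorm N D x - k * v x\<bar> \<partial>lebB N)"
    using i1 i3 by simp
  finally show "(\<integral>x. gnorm N (\<lambda>i x. G' (v x) * D i x) x \<partial>lebB N)
     \<le> k * (\<integral>x. G' (v x) * v x \<partial>lebB N) + \<Lambda> * (\<integral>x. \<bar>gnorm N D x - k * v x\<bar> \<partial>lebB N)" .
qed

lemma scaled_level_bound:
  fixes k :: real
  assumes "i \<le> a + 12 * (g - h) + (8 * w - x)" "0 < k"
  shows "k * i \<le> k * a + 12 * (k * g - k * h) + (8 * k * w - k * x)"
  using mult_left_mono[OF assms(1), of k] assms(2) by (simp add: algebra_simps)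

text \<open>
  The test functions \<open>G(v)\<close> and \<open>W(v)\<close> both satisfy a Cheeger inequality, the second one with the constant
  \<open>8k\<close> since \<open>W(v)\<close> lives on the small set \<open>{v > \<beta>}\<close>. Replacing \<open>|\<nabla>v|\<close> by \<open>k v\<close> bounds
  \<open>\<integral>(G(v) - v G'(v))\<close> and \<open>\<integral>(8 W(v) - v W'(v))\<close> by the deficit, and \<open>level_inequality\<close> bounds \<open>\<integral>v\<close> by these two
  integrals plus \<open>\<alpha>\<close> times the measure of the support.
\<close>

lemma improved_L1_bounded_support:
  fixes v :: "point \<Rightarrow> real"
  assumes k: "cheeger_bound N E k" "0 < k" and N: "1 \<le> N"
    and v: "has_C1 N v D" "vanishes_off_cube N r v" "\<And>x. x \<in> pts N \<Longrightarrow> 0 \<le> v x"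
    and E: "\<And>x. x \<in> pts N \<Longrightarrow> v x \<noteq> 0 \<Longrightarrow> x \<in> E"
    and l: "l = 1 / (16 * real N * k)"
    and V: "emeasure (lebB N) {x \<in> pts N. v x \<noteq> 0} \<le> ennreal V" "l ^ N \<le> V"
  shows "3 / 4 * k * (\<integral>x. v x \<partial>lebB N)
      \<le> (12 * ln (1 + 16 * V / l ^ N) + 1) * (\<integral>x. \<bar>gnorm N D x - k * v x\<bar> \<partial>lebB N)"
proof -
  define I where "I = (\<integral>x. v x \<partial>lebB N)"
  define X where "X = (\<integral>x. \<bar>gnorm N D x - k * v x\<bar> \<partial>lebB N)"
  have l0: "0 < l" using k N by (simp add: l)
  then have lN: "0 < l ^ N" by simp
  then have V0: "0 < V" using V(2) by linarith
  have X0: "0 \<le> X" unfolding X_def by (rule integral_nonneg_AE) auto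
  have I0: "0 \<le> I" unfolding I_def by (rule integral_nonneg_AE) (use v(3) in auto)
  have \<Lambda>0: "0 \<le> ln (1 + 16 * V / l ^ N)" using V0 lN by (intro ln_ge_zero) auto
  show ?thesis
  proof (cases "I = 0")
    case True
    then show ?thesis using X0 \<Lambda>0 unfolding I_def[symmetric] X_def[symmetric] by simp
  next
    case False
    then have Ip: "0 < I" using I0 by simp
    \<comment> \<open>With this \<open>\<alpha>\<close> the low levels carry at most a quarter of the mass. With this \<open>\<beta>\<close> Markov's inequality
      bounds the measure of \<open>{v > \<beta>}\<close> by half of \<open>l\<^sup>N\<close>, and the choice of \<open>l\<close> turns \<open>2 N l\<close> into \<open>1 / (8 k)\<close>.\<close>
    define \<alpha> where "\<alpha> = I / (4 * V)"
    define \<beta> where "\<beta> = 2 * I / l ^ N"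
    have \<alpha>: "0 < \<alpha>" and \<beta>: "0 < \<beta>" using Ip V0 lN by (auto simp: \<alpha>_def \<beta>_def)
    have \<alpha>\<beta>: "\<alpha> \<le> \<beta>"
    proof -
      have "I * l ^ N \<le> I * (8 * V)"
        using V(2) V0 Ip by (intro mult_left_mono) auto
      then show ?thesis using V0 lN by (simp add: \<alpha>_def \<beta>_def divide_le_eq le_divide_eq mult_ac)
    qed
    have \<Lambda>eq: "2 * \<beta> / \<alpha> = 16 * V / l ^ N"
      using Ip V0 lN by (simp add: \<alpha>_def \<beta>_def)
    define \<Lambda> where "\<Lambda> = ln (1 + 16 * V / l ^ N)"
    have [measurable]: "v \<in> borel_measurable (lebB N)"
      using has_C1D(4)[OF v(1)] by auto
    have iv: "integrable (lebB N) v" by (rule has_C1_integrable[OF v(1,2)])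
    have GC: "has_C1 N (\<lambda>x. log_test \<alpha> \<beta> (v x)) (\<lambda>i x. log_test' \<alpha> \<beta> (v x) * D i x)"
      by (rule has_C1_chain[OF v(1), where S="{0..}"])
         (use v(3) DERIV_log_test[OF \<alpha> \<beta>] continuous_log_test'[OF \<alpha> \<beta>] in auto)
    have Gv: "vanishes_off_cube N r (\<lambda>x. log_test \<alpha> \<beta> (v x))"
      using v(2) by (auto simp: vanishes_off_cube_def log_test_def)
    have Gm: "(\<lambda>x. log_test' \<alpha> \<beta> (v x)) \<in> borel_measurable (lebB N)"
      unfolding log_test'_def by measurable
    have Gnn: "0 \<le> log_test \<alpha> \<beta> t" if "0 \<le> t" for t
      unfolding log_test_def using that \<alpha> \<beta> by (intro mult_nonneg_nonneg ln_ge_zero) auto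
    have "k * (\<integral>x. log_test \<alpha> \<beta> (v x) \<partial>lebB N) \<le> (\<integral>x. gnorm N (\<lambda>i x. log_test' \<alpha> \<beta> (v x) * D i x) x \<partial>lebB N)"
      by (rule cheeger_bound_L1[OF k(1) GC Gv]) (use v(3) E Gnn in \<open>auto simp: log_test_def\<close>)
    also have "\<dots> \<le> k * (\<integral>x. log_test' \<alpha> \<beta> (v x) * v x \<partial>lebB N) + \<Lambda> * X"
      unfolding X_def \<Lambda>_def
      by (rule pushed_gradient_le(1)[OF v log_test'_bounds(1)[OF \<alpha> \<beta>] _ Gm])
         (use log_test'_bounds(2)[OF \<alpha> \<beta>] k \<Lambda>eq in auto)
    finally have G: "k * (\<integral>x. log_test \<alpha> \<beta> (v x) \<partial>lebB N) \<le> k * (\<integral>x. log_test' \<alpha> \<beta> (v x) * v x \<partial>lebB N) + \<Lambda> * X" .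
    have iG: "integrable (lebB N) (\<lambda>x. log_test \<alpha> \<beta> (v x))" by (rule has_C1_integrable[OF GC Gv])
    have iG': "integrable (lebB N) (\<lambda>x. log_test' \<alpha> \<beta> (v x) * v x)"
      by (rule pushed_gradient_le(2)[OF v log_test'_bounds[OF \<alpha> \<beta>] Gm order_refl])
    have WC: "has_C1 N (\<lambda>x. ramp \<beta> (v x - \<beta>)) (\<lambda>i x. ramp' \<beta> (v x - \<beta>) * D i x)"
    proof (rule has_C1_chain[OF v(1), where S=UNIV and g="\<lambda>t. ramp \<beta> (t - \<beta>)"])
      show "((\<lambda>t. ramp \<beta> (t - \<beta>)) has_real_derivative ramp' \<beta> (t - \<beta>)) (at t)" for t
      proof -
        have "((\<lambda>t. ramp \<beta> (t - \<beta>)) has_real_derivative ramp' \<beta> (t - \<beta>) * 1) (at t)"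
          by (rule DERIV_chain2[OF DERIV_ramp[OF \<beta>]]) (auto intro!: derivative_eq_intros)
        then show ?thesis by simp
      qed
      show "continuous_on UNIV (\<lambda>t. ramp' \<beta> (t - \<beta>))"
        by (rule continuous_on_compose2[OF continuous_ramp'[of UNIV]]) (auto intro!: continuous_intros)
    qed auto
    have W0: "ramp \<beta> (t - \<beta>) = 0" if "t \<le> \<beta>" for t
      using that \<beta> by (simp add: ramp_def psq_def max_def)
    have Wv: "vanishes_off_cube N r (\<lambda>x. ramp \<beta> (v x - \<beta>))"
      using v(2) W0[of 0] \<beta> by (auto simp: vanishes_off_cube_def)
    have Wm: "(\<lambda>x. ramp' \<beta> (v x - \<beta>)) \<in> borel_measurable (lebB N)"
      unfolding ramp'_def by measurable
    have Wnn: "0 \<le> ramp \<beta> s" for s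
      unfolding ramp_def psq_def using \<beta> by (auto intro!: divide_nonneg_pos power_mono)
    have small: "emeasure (lebB N) {x \<in> pts N. ramp \<beta> (v x - \<beta>) \<noteq> 0} \<le> ennreal (l ^ N / 2)"
    proof -
      have "{x \<in> pts N. ramp \<beta> (v x - \<beta>) \<noteq> 0} \<subseteq> {x \<in> pts N. \<beta> < v x}"
        using W0 by (auto simp: not_le[symmetric])
      moreover have "{x \<in> pts N. \<beta> < v x} \<in> sets (lebB N)"
        unfolding space_lebB[symmetric] by measurable
      ultimately have "emeasure (lebB N) {x \<in> pts N. ramp \<beta> (v x - \<beta>) \<noteq> 0} \<le> emeasure (lebB N) {x \<in> pts N. \<beta> < v x}"
        by (rule emeasure_mono)
      also have "\<dots> \<le> ennreal (I / \<beta>)" unfolding I_def by (rule markov_level[OF iv v(3) \<beta>])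
      also have "I / \<beta> = l ^ N / 2" using Ip by (simp add: \<beta>_def)
      finally show ?thesis .
    qed
    have "8 * k * (\<integral>x. ramp \<beta> (v x - \<beta>) \<partial>lebB N) = 8 * k * (\<integral>x. \<bar>ramp \<beta> (v x - \<beta>)\<bar> \<partial>lebB N)"
      using Wnn by simp
    also have "\<dots> \<le> 8 * k * (2 * real N * l * (\<integral>x. gnorm N (\<lambda>i x. ramp' \<beta> (v x - \<beta>) * D i x) x \<partial>lebB N))"
      using k by (intro mult_left_mono small_support_L1_le[OF WC Wv l0 small]) auto
    also have "\<dots> = (\<integral>x. gnorm N (\<lambda>i x. ramp' \<beta> (v x - \<beta>) * D i x) x \<partial>lebB N)"
      using k N by (simp add: l)
    also have "\<dots> \<le> k * (\<integral>x. ramp' \<beta> (v x - \<beta>) * v x \<partial>lebB N) + 1 * X"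
      unfolding X_def
      by (rule pushed_gradient_le(1)[OF v, where G'="\<lambda>t. ramp' \<beta> (t - \<beta>)"])
         (use ramp'_bounds[OF \<beta>] Wm k in auto)
    finally have W: "8 * k * (\<integral>x. ramp \<beta> (v x - \<beta>) \<partial>lebB N) \<le> k * (\<integral>x. ramp' \<beta> (v x - \<beta>) * v x \<partial>lebB N) + X"
      by simp
    have iW: "integrable (lebB N) (\<lambda>x. ramp \<beta> (v x - \<beta>))" by (rule has_C1_integrable[OF WC Wv])
    have iW': "integrable (lebB N) (\<lambda>x. ramp' \<beta> (v x - \<beta>) * v x)"
      by (rule pushed_gradient_le(2)[OF v, where G'="\<lambda>t. ramp' \<beta> (t - \<beta>)" and \<Lambda>=1 and k=0])
         (use ramp'_bounds[OF \<beta>] Wm in auto)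
    define Z where "Z = {x \<in> pts N. v x \<noteq> 0}"
    have Zs: "Z \<in> sets (lebB N)" unfolding Z_def space_lebB[symmetric] by measurable
    have Zf: "emeasure (lebB N) Z < \<infinity>"
      using V(1) unfolding Z_def[symmetric] by (simp add: order_le_less_trans)
    have Zm: "measure (lebB N) Z \<le> V"
      using V(1) V0 unfolding Z_def[symmetric] measure_def by (simp add: enn2real_leI)
    have iZ: "integrable (lebB N) (\<lambda>x. \<alpha> * indicator Z x)"
      using Zf Zs by (intro integrable_mult_right integrable_real_indicator) auto
    have "I \<le> (\<integral>x. \<alpha> * indicator Z x + 12 * (log_test \<alpha> \<beta> (v x) - log_test' \<alpha> \<beta> (v x) * v x)
        + (8 * ramp \<beta> (v x - \<beta>) - ramp' \<beta> (v x - \<beta>) * v x) \<partial>lebB N)"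
      unfolding I_def
    proof (rule integral_mono[OF iv])
      fix x assume "x \<in> space (lebB N)"
      then have x: "x \<in> pts N" by simp
      have "log_test \<alpha> \<beta> (v x) - log_test' \<alpha> \<beta> (v x) * v x
          = (v x)\<^sup>2 * (2 * \<beta>) / ((\<alpha> + v x) * (\<alpha> + v x + 2 * \<beta>))"
        by (simp add: log_test_def log_test'_def algebra_simps power2_eq_square)
      then show "v x \<le> \<alpha> * indicator Z x + 12 * (log_test \<alpha> \<beta> (v x) - log_test' \<alpha> \<beta> (v x) * v x)
        + (8 * ramp \<beta> (v x - \<beta>) - ramp' \<beta> (v x - \<beta>) * v x)"
        using level_inequality[OF \<alpha> \<alpha>\<beta> v(3)[OF x]] x by (auto simp: Z_def split: if_splits)
    qed (use iZ iG iG' iW iW' in auto)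
    also have "\<dots> = \<alpha> * measure (lebB N) Z + 12 * ((\<integral>x. log_test \<alpha> \<beta> (v x) \<partial>lebB N) - (\<integral>x. log_test' \<alpha> \<beta> (v x) * v x \<partial>lebB N))
        + (8 * (\<integral>x. ramp \<beta> (v x - \<beta>) \<partial>lebB N) - (\<integral>x. ramp' \<beta> (v x - \<beta>) * v x \<partial>lebB N))"
      using iZ iG iG' iW iW' Zs sets.sets_into_space[OF Zs] by (simp add: Int_absorb2)
    finally have "k * I \<le> k * (\<alpha> * measure (lebB N) Z) + 12 * (k * (\<integral>x. log_test \<alpha> \<beta> (v x) \<partial>lebB N) - k * (\<integral>x. log_test' \<alpha> \<beta> (v x) * v x \<partial>lebB N))
        + (8 * k * (\<integral>x. ramp \<beta> (v x - \<beta>) \<partial>lebB N) - k * (\<integral>x. ramp' \<beta> (v x - \<beta>) * v x \<partial>lebB N))"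
      by (rule scaled_level_bound) (rule k(2))
    moreover have "k * (\<alpha> * measure (lebB N) Z) \<le> k * (I / 4)"
    proof -
      have "\<alpha> * measure (lebB N) Z \<le> \<alpha> * V" using \<alpha> Zm by (intro mult_left_mono) auto
      also have "\<alpha> * V = I / 4" using V0 by (simp add: \<alpha>_def)
      finally show ?thesis using k by (intro mult_left_mono) auto
    qed
    ultimately have "3 / 4 * k * I \<le> 12 * (\<Lambda> * X) + X" using G W by simp
    then show ?thesis
      unfolding I_def[symmetric] X_def[symmetric] \<Lambda>_def[symmetric] by (simp add: algebra_simps)
  qed
qed

lemma measurable_aff_pair' [measurable]:
  "(\<lambda>p. aff N (fst p) c (snd p)) \<in> lebB N \<Otimes>\<^sub>M lebB N \<rightarrow>\<^sub>M lebB N"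
  unfolding aff_def by (intro measurable_restrict) measurable

lemma convolution_mass:
  assumes [measurable]: "f \<in> borel_measurable (lebB N)" "g \<in> borel_measurable (lebB N)"
  shows "(\<integral>\<^sup>+z. \<integral>\<^sup>+x. f x * g (aff N x (-1) z) \<partial>lebB N \<partial>lebB N)
     = (\<integral>\<^sup>+x. f x \<partial>lebB N) * (\<integral>\<^sup>+x. g x \<partial>lebB N)"
proof -
  have "(\<integral>\<^sup>+z. \<integral>\<^sup>+x. f x * g (aff N x (-1) z) \<partial>lebB N \<partial>lebB N)
      = (\<integral>\<^sup>+x. \<integral>\<^sup>+z. f x * g (aff N x (-1) z) \<partial>lebB N \<partial>lebB N)"
    by (rule lebB_Fubini) (unfold split_beta', measurable)
  also have "\<dots> = (\<integral>\<^sup>+x. f x * (\<integral>\<^sup>+x. g x \<partial>lebB N) \<partial>lebB N)"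
  proof (rule nn_integral_cong)
    fix x
    have "(\<integral>\<^sup>+z. f x * g (aff N x (-1) z) \<partial>lebB N) = f x * (\<integral>\<^sup>+z. g (aff N x (-1) z) \<partial>lebB N)"
      by (rule nn_integral_cmult) measurable
    also have "(\<integral>\<^sup>+z. g (aff N x (-1) z) \<partial>lebB N) = (\<integral>\<^sup>+x. g x \<partial>lebB N)"
      using nn_integral_aff[of "-1" g N x] by simp
    finally show "(\<integral>\<^sup>+z. f x * g (aff N x (-1) z) \<partial>lebB N) = f x * (\<integral>\<^sup>+x. g x \<partial>lebB N)" .
  qed
  also have "\<dots> = (\<integral>\<^sup>+x. f x \<partial>lebB N) * (\<integral>\<^sup>+x. g x \<partial>lebB N)"
    by (rule nn_integral_multc) measurable
  finally show ?thesis .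
qed

lemma gnorm_sqd: "gnorm N (\<lambda>i x. 2 * (x i - z i)) x = 2 * sqrt (sqd N z x)"
  unfolding gnorm_def enorm_def L2_set_def sqd_def
  by (simp only: power_mult_distrib sum_distrib_left[symmetric] real_sqrt_mult) simp

lemma sqd_nonneg: "0 \<le> sqd N z x"
  unfolding sqd_def by (rule sum_nonneg) auto

lemma sqd_coord: "j < N \<Longrightarrow> (x j - z j)\<^sup>2 \<le> sqd N z x"
  unfolding sqd_def by (rule member_le_sum) auto

lemma sqd_le_of_near:
  assumes "1 \<le> N" "0 < R" "\<And>j. j < N \<Longrightarrow> \<bar>x j - z j\<bar> \<le> R / (2 * real N)"
  shows "sqd N z x \<le> R\<^sup>2 / 4"
proof -
  have "(x j - z j)\<^sup>2 \<le> (R / (2 * real N))\<^sup>2" if "j < N" for j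
    using assms(3)[OF that] assms(2) by (metis abs_ge_zero power2_abs power_mono)
  then have "sqd N z x \<le> (\<Sum>j<N. (R / (2 * real N))\<^sup>2)"
    unfolding sqd_def by (intro sum_mono) auto
  also have "\<dots> = R\<^sup>2 / (4 * real N)"
    using assms by (simp add: power2_eq_square)
  also have "\<dots> \<le> R\<^sup>2 / 4"
    using assms by (intro divide_left_mono) auto
  finally show ?thesis .
qed

definition cut :: "nat \<Rightarrow> real \<Rightarrow> point \<Rightarrow> point \<Rightarrow> real" where
  "cut N R z x = psq (R\<^sup>2 - sqd N z x)"

definition cut' :: "nat \<Rightarrow> real \<Rightarrow> point \<Rightarrow> nat \<Rightarrow> point \<Rightarrow> real" where
  "cut' N R z i x = - 2 * max 0 (R\<^sup>2 - sqd N z x) * (2 * (x i - z i))"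

lemma has_C1_cut: "has_C1 N (cut N R z) (cut' N R z)"
  unfolding cut_def[abs_def] cut'_def[abs_def]
proof (rule has_C1_chain[OF has_C1_sqd, where S=UNIV and g="\<lambda>s. psq (R\<^sup>2 - s)" and g'="\<lambda>s. - 2 * max 0 (R\<^sup>2 - s)"])
  show "((\<lambda>s. psq (R\<^sup>2 - s)) has_real_derivative - 2 * max 0 (R\<^sup>2 - t)) (at t)" for t
  proof -
    have "((\<lambda>s. psq (R\<^sup>2 - s)) has_real_derivative 2 * max 0 (R\<^sup>2 - t) * (- 1)) (at t)"
      by (rule DERIV_chain2[OF DERIV_psq]) (auto intro!: derivative_eq_intros)
    then show ?thesis by simp
  qed
qed (auto intro!: continuous_intros)

lemma cut_nonneg [simp]: "0 \<le> cut N R z x"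
  by (simp add: cut_def)

lemma aff_minus: "aff N x (-1) z \<in> cube N R \<longleftrightarrow> (\<forall>j<N. \<bar>x j - z j\<bar> \<le> R)"
  by (subst in_cube_iff) (auto simp: aff_def)

lemma near_of_sqd:
  assumes "0 < R" "sqd N z x < R\<^sup>2"
  shows "aff N x (-1) z \<in> cube N R"
  unfolding aff_minus
proof (intro allI impI)
  fix j assume "j < N"
  then have "\<bar>x j - z j\<bar>\<^sup>2 \<le> R\<^sup>2"
    using sqd_coord[of j N x z] assms by simp
  then show "\<bar>x j - z j\<bar> \<le> R"
    using assms by (meson abs_ge_zero less_imp_le power2_le_imp_le)
qed

lemma cut_eq_0: "0 < R \<Longrightarrow> aff N x (-1) z \<notin> cube N R \<Longrightarrow> cut N R z x = 0"
  using near_of_sqd[of R N z x] by (cases "sqd N z x < R\<^sup>2") (auto simp: cut_def psq_def max_absorb1 not_less)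

text \<open>
  The slope of \<open>psq\<close> gives a factor \<open>2 R\<^sup>2\<close>, the gradient of the squared distance a factor \<open>2 R\<close>.
\<close>

lemma gnorm_cut_le:
  assumes "0 < R"
  shows "gnorm N (cut' N R z) x \<le> 4 * R ^ 3 * indicator (cube N R) (aff N x (-1) z)"
proof -
  have e: "gnorm N (cut' N R z) x = 2 * max 0 (R\<^sup>2 - sqd N z x) * (2 * sqrt (sqd N z x))"
    unfolding cut'_def[abs_def] gnorm_scale[of N "\<lambda>x. - 2 * max 0 (R\<^sup>2 - sqd N z x)"] gnorm_sqd
    by (simp add: abs_mult)
  show ?thesis
  proof (cases "sqd N z x < R\<^sup>2")
    case True
    have "sqrt (sqd N z x) \<le> R"
      using True assms by (intro real_le_lsqrt) (auto simp: sqd_nonneg)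
    moreover have "max 0 (R\<^sup>2 - sqd N z x) \<le> R\<^sup>2" using sqd_nonneg[of N z x] by auto
    ultimately have "2 * max 0 (R\<^sup>2 - sqd N z x) * (2 * sqrt (sqd N z x)) \<le> 2 * R\<^sup>2 * (2 * R)"
      using assms by (intro mult_mono) (auto simp: sqd_nonneg)
    then show ?thesis
      using near_of_sqd[OF assms True] e by (simp add: power2_eq_square power3_eq_cube)
  next
    case False
    then show ?thesis using e assms by (simp add: max_def)
  qed
qed

lemma gnorm_add_diff: "\<bar>gnorm N (\<lambda>i x. D i x + E i x) x - gnorm N D x\<bar> \<le> gnorm N E x"
proof -
  have "gnorm N (\<lambda>i x. D i x + E i x) x \<le> gnorm N D x + gnorm N E x" by (rule gnorm_triangle)
  moreover have "gnorm N D x \<le> gnorm N (\<lambda>i x. D i x + E i x) x + gnorm N E x"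
    using gnorm_triangle[of N "\<lambda>i x. D i x + E i x" "\<lambda>i x. - 1 * E i x" x]
      gnorm_scale[of N "\<lambda>x. - 1" E x] by simp
  ultimately show ?thesis by linarith
qed

lemma cut_as_shifted: "cut N R z x = cut N R (\<lambda>_. 0) (aff N x (-1) z)"
  unfolding cut_def sqd_def by (rule arg_cong[where f="\<lambda>s. psq (R\<^sup>2 - s)"]) (auto simp: aff_def intro!: sum.cong)

text \<open>
  The previous inequality for \<open>v\<close> times a cut-off function centred at \<open>z\<close>; the product rule produces the
  additional term with the gradient of the cut-off.
\<close>

lemma improved_L1_localised:
  fixes v :: "point \<Rightarrow> real"
  assumes k: "cheeger_bound N E k" "0 < k" and N: "1 \<le> N"
    and v: "has_C1 N v D" "vanishes_off_cube N r v" "\<And>x. x \<in> pts N \<Longrightarrow> 0 \<le> v x"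
    and E: "\<And>x. x \<in> pts N \<Longrightarrow> v x \<noteq> 0 \<Longrightarrow> x \<in> E"
    and l: "l = 1 / (16 * real N * k)" and R: "0 < R" "l \<le> 2 * R"
  shows "3 / 4 * k * (\<integral>x. v x * cut N R z x \<partial>lebB N)
      \<le> (12 * ln (1 + 16 * (2 * R / l) ^ N) + 1) *
         ((\<integral>x. cut N R z x * \<bar>gnorm N D x - k * v x\<bar> \<partial>lebB N)
           + (\<integral>x. v x * (4 * R ^ 3 * indicator (cube N R) (aff N x (-1) z)) \<partial>lebB N))"
    and "integrable (lebB N) (\<lambda>x. v x * cut N R z x)"
    and "integrable (lebB N) (\<lambda>x. cut N R z x * \<bar>gnorm N D x - k * v x\<bar>)"
    and "integrable (lebB N) (\<lambda>x. v x * (4 * R ^ 3 * indicator (cube N R) (aff N x (-1) z)))"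
proof -
  have l0: "0 < l" using k N by (simp add: l)
  have [measurable]: "v \<in> borel_measurable (lebB N)"
    using has_C1D(4)[OF v(1)] .
  have iv: "integrable (lebB N) v" by (rule has_C1_integrable[OF v(1,2)])
  define P where "P x = v x * cut N R z x" for x
  define PD where "PD i x = D i x * cut N R z x + v x * cut' N R z i x" for i x
  have PC: "has_C1 N P PD"
    unfolding P_def[abs_def] PD_def[abs_def] by (rule has_C1_mult[OF v(1) has_C1_cut])
  have Pv: "vanishes_off_cube N r P"
    using v(2) by (auto simp: vanishes_off_cube_def P_def)
  have cG: "continuous_map (euclid N) euclideanreal (gnorm N D)"
    by (rule continuous_map_gnorm) (rule has_C1D[OF v(1)])
  have vG: "vanishes_off_cube N r (gnorm N D)"
    by (rule gnorm_vanishes) (rule has_C1_vanishes[OF v(1,2)])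
  show i1: "integrable (lebB N) (\<lambda>x. v x * cut N R z x)"
    using has_C1_integrable(1)[OF PC Pv] by (simp add: P_def[abs_def])
  show i2: "integrable (lebB N) (\<lambda>x. cut N R z x * \<bar>gnorm N D x - k * v x\<bar>)"
    by (rule integrable_continuous[where r=r])
       (use vG v(2) cG has_C1D(1)[OF v(1)] has_C1D(1)[OF has_C1_cut] in
         \<open>auto simp: vanishes_off_cube_def intro!: continuous_intros\<close>)
  have eqaff: "aff N x (-1) z = aff N (\<lambda>j. - z j) 1 x" for x
    by (auto simp: aff_def)
  have mI [measurable]: "(\<lambda>x. indicator (cube N R) (aff N x (-1) z) :: real) \<in> borel_measurable (lebB N)"
    unfolding eqaff by measurable
  show i3: "integrable (lebB N) (\<lambda>x. v x * (4 * R ^ 3 * indicator (cube N R) (aff N x (-1) z)))"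
    by (rule Bochner_Integration.integrable_bound[of _ "\<lambda>x. v x * (4 * R ^ 3)"])
       (use iv R in \<open>auto split: split_indicator\<close>)
  have small: "emeasure (lebB N) {x \<in> pts N. P x \<noteq> 0} \<le> ennreal ((2 * R) ^ N)"
  proof -
    have "{x \<in> pts N. P x \<noteq> 0} \<subseteq> aff N (\<lambda>j. - z j) 1 -` cube N R \<inter> space (lebB N)"
      using cut_eq_0[OF R(1), of N _ z] by (auto simp: P_def eqaff)
    then have "emeasure (lebB N) {x \<in> pts N. P x \<noteq> 0} \<le> emeasure (lebB N) (aff N (\<lambda>j. - z j) 1 -` cube N R \<inter> space (lebB N))"
      by (rule emeasure_mono) measurable
    also have "\<dots> = emeasure (distr (lebB N) (lebB N) (aff N (\<lambda>j. - z j) 1)) (cube N R)"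
      by (rule emeasure_distr[symmetric]) measurable
    also have "distr (lebB N) (lebB N) (aff N (\<lambda>j. - z j) 1) = lebB N"
      using distr_aff[of 1 N "\<lambda>j. - z j"] by simp
    finally show ?thesis using R by (simp add: emeasure_cube)
  qed
  have "3 / 4 * k * (\<integral>x. P x \<partial>lebB N)
      \<le> (12 * ln (1 + 16 * (2 * R) ^ N / l ^ N) + 1) * (\<integral>x. \<bar>gnorm N PD x - k * P x\<bar> \<partial>lebB N)"
    by (rule improved_L1_bounded_support[OF k N PC Pv _ _ l small])
       (use v(3) E power_mono[OF R(2), of N] l0 in \<open>auto simp: P_def\<close>)
  also have "\<dots> \<le> (12 * ln (1 + 16 * (2 * R) ^ N / l ^ N) + 1) *
         (\<integral>x. cut N R z x * \<bar>gnorm N D x - k * v x\<bar> + v x * (4 * R ^ 3 * indicator (cube N R) (aff N x (-1) z)) \<partial>lebB N)"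
  proof (intro mult_left_mono integral_mono)
    show "integrable (lebB N) (\<lambda>x. \<bar>gnorm N PD x - k * P x\<bar>)"
      using has_C1_integrable(1,3)[OF PC Pv] by auto
    fix x assume "x \<in> space (lebB N)"
    then have x: "x \<in> pts N" by simp
    have a: "gnorm N (\<lambda>i x. D i x * cut N R z x) x = cut N R z x * gnorm N D x"
      using gnorm_scale[of N "cut N R z" D x] by (simp add: mult.commute)
    have b: "gnorm N (\<lambda>i x. v x * cut' N R z i x) x = v x * gnorm N (cut' N R z) x"
      using gnorm_scale[of N v "cut' N R z" x] v(3)[OF x] by simp
    have "\<bar>gnorm N PD x - cut N R z x * gnorm N D x\<bar> \<le> v x * gnorm N (cut' N R z) x"
      unfolding PD_def[abs_def] a[symmetric] b[symmetric] by (rule gnorm_add_diff)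
    also have "\<dots> \<le> v x * (4 * R ^ 3 * indicator (cube N R) (aff N x (-1) z))"
      by (intro mult_left_mono gnorm_cut_le R v(3) x)
    finally have "\<bar>gnorm N PD x - cut N R z x * gnorm N D x\<bar> \<le> v x * (4 * R ^ 3 * indicator (cube N R) (aff N x (-1) z))" .
    moreover have "\<bar>cut N R z x * gnorm N D x - k * P x\<bar> = cut N R z x * \<bar>gnorm N D x - k * v x\<bar>"
    proof -
      have "cut N R z x * gnorm N D x - k * P x = cut N R z x * (gnorm N D x - k * v x)"
        by (simp add: P_def algebra_simps)
      then show ?thesis by (simp add: abs_mult)
    qed
    ultimately show "\<bar>gnorm N PD x - k * P x\<bar> \<le> cut N R z x * \<bar>gnorm N D x - k * v x\<bar> + v x * (4 * R ^ 3 * indicator (cube N R) (aff N x (-1) z))"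
      by linarith
  next
    have "0 \<le> ln (1 + 16 * (2 * R) ^ N / l ^ N)"
      using R l0 by (intro ln_ge_zero) auto
    then show "0 \<le> 12 * ln (1 + 16 * (2 * R) ^ N / l ^ N) + 1" by linarith
  qed (use i2 i3 in auto)
  finally show "3 / 4 * k * (\<integral>x. v x * cut N R z x \<partial>lebB N)
      \<le> (12 * ln (1 + 16 * (2 * R / l) ^ N) + 1) *
         ((\<integral>x. cut N R z x * \<bar>gnorm N D x - k * v x\<bar> \<partial>lebB N)
           + (\<integral>x. v x * (4 * R ^ 3 * indicator (cube N R) (aff N x (-1) z)) \<partial>lebB N))"
    using i2 i3 by (simp add: P_def power_divide)
qed

lemma cut_mass_lower:
  assumes "0 < R" "1 \<le> N"
  shows "ennreal (9 / 16 * R ^ 4 * (R / real N) ^ N) \<le> (\<integral>\<^sup>+x. ennreal (cut N R (\<lambda>_. 0) x) \<partial>lebB N)"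
proof -
  let ?B = "cube N (R / (2 * real N))"
  have "ennreal (9 / 16 * R ^ 4 * (R / real N) ^ N) = ennreal (9 / 16 * R ^ 4) * emeasure (lebB N) ?B"
    using assms by (subst emeasure_cube) (auto simp: ennreal_mult' [symmetric])
  also have "\<dots> = (\<integral>\<^sup>+x. ennreal (9 / 16 * R ^ 4) * indicator ?B x \<partial>lebB N)"
    by (rule nn_integral_cmult_indicator[symmetric]) measurable
  also have "\<dots> \<le> (\<integral>\<^sup>+x. ennreal (cut N R (\<lambda>_. 0) x) \<partial>lebB N)"
  proof (rule nn_integral_mono)
    fix x assume "x \<in> space (lebB N)"
    then have x: "x \<in> pts N" by simp
    show "ennreal (9 / 16 * R ^ 4) * indicator ?B x \<le> ennreal (cut N R (\<lambda>_. 0) x)"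
    proof (cases "x \<in> ?B")
      case True
      then have "sqd N (\<lambda>_. 0) x \<le> R\<^sup>2 / 4"
        using assms in_cube_iff[OF x] by (intro sqd_le_of_near) auto
      then have s: "3 / 4 * R\<^sup>2 \<le> R\<^sup>2 - sqd N (\<lambda>_. 0) x" by linarith
      have "9 / 16 * R ^ 4 = (3 / 4 * R\<^sup>2)\<^sup>2"
        by (simp add: power_mult_distrib power_divide)
      also have "\<dots> \<le> (max 0 (R\<^sup>2 - sqd N (\<lambda>_. 0) x))\<^sup>2"
        using s by (intro power_mono max.coboundedI2) auto
      also have "\<dots> = cut N R (\<lambda>_. 0) x" by (simp add: cut_def psq_def)
      finally show ?thesis using True by (simp add: ennreal_leI)
    qed simp
  qed
  finally show ?thesis .
qed

text \<open>
  Integrate the localised inequality over all centres \<open>z\<close>. By Fubini every term becomes a product of an integral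
  of \<open>v\<close>, or of the deficit, with the mass of the cut-off or of its gradient, and the ratio of these two
  masses is of order \<open>1/R = k/\<rho>\<close>.
\<close>

lemma improved_L1_fixed_radius:
  fixes v :: "point \<Rightarrow> real"
  assumes k: "cheeger_bound N E k" "0 < k" and N: "1 \<le> N"
    and v: "has_C1 N v D" "vanishes_off_cube N r v" "\<And>x. x \<in> pts N \<Longrightarrow> 0 \<le> v x"
    and E: "\<And>x. x \<in> pts N \<Longrightarrow> v x \<noteq> 0 \<Longrightarrow> x \<in> E"
    and \<rho>: "1 \<le> \<rho>"
  shows "(3 / 4 / (12 * ln (1 + 16 * (32 * real N * \<rho>) ^ N) + 1) - 64 / 9 * (2 * real N) ^ N / \<rho>) * k * (\<integral>x. v x \<partial>lebB N)
      \<le> (\<integral>x. \<bar>gnorm N D x - k * v x\<bar> \<partial>lebB N)"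
proof -
  define R where "R = \<rho> / k"
  define l where "l = 1 / (16 * real N * k)"
  have R: "0 < R" using \<rho> k by (simp add: R_def)
  have Rl: "2 * R / l = 32 * real N * \<rho>" using k N by (simp add: R_def l_def)
  have lR: "l \<le> 2 * R"
  proof -
    have "1 * 1 \<le> 32 * real N * \<rho>" using N \<rho> by (intro mult_mono) auto
    then have "1 \<le> 2 * R / l" using Rl by simp
    moreover have "0 < l" using k N by (simp add: l_def)
    ultimately show ?thesis by (simp add: le_divide_eq)
  qed
  define M where "M = 12 * ln (1 + 16 * (32 * real N * \<rho>) ^ N) + 1"
  have "0 \<le> ln (1 + 16 * (32 * real N * \<rho>) ^ N)" using \<rho> by (intro ln_ge_zero) auto
  then have M: "0 < M" by (simp add: M_def)
  have [measurable]: "v \<in> borel_measurable (lebB N)" "gnorm N D \<in> borel_measurable (lebB N)"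
    using has_C1D(4)[OF v(1)] has_C1_integrable(4)[OF v(1,2)] by auto
  have iv: "integrable (lebB N) v" and iG: "integrable (lebB N) (gnorm N D)"
    using has_C1_integrable[OF v(1,2)] by auto
  define Xf where "Xf x = \<bar>gnorm N D x - k * v x\<bar>" for x
  have [measurable]: "Xf \<in> borel_measurable (lebB N)" unfolding Xf_def[abs_def] by measurable
  have iX: "integrable (lebB N) Xf" unfolding Xf_def[abs_def] using iv iG by auto
  define I where "I = (\<integral>x. v x \<partial>lebB N)"
  define X where "X = (\<integral>x. Xf x \<partial>lebB N)"
  have I0: "0 \<le> I" unfolding I_def by (rule integral_nonneg_AE) (use v(3) in auto)
  have X0: "0 \<le> X" unfolding X_def by (rule integral_nonneg_AE) (auto simp: Xf_def)
  let ?c0 = "cut N R (\<lambda>_. 0)"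
  have [measurable]: "?c0 \<in> borel_measurable (lebB N)" using has_C1D(4)[OF has_C1_cut] .
  let ?b0 = "\<lambda>y. 4 * R ^ 3 * indicator (cube N R) y"
  have loc: "ennreal (3 / 4 * k) * (\<integral>\<^sup>+x. ennreal (v x) * ennreal (?c0 (aff N x (-1) z)) \<partial>lebB N)
      \<le> ennreal M * ((\<integral>\<^sup>+x. ennreal (Xf x) * ennreal (?c0 (aff N x (-1) z)) \<partial>lebB N)
        + (\<integral>\<^sup>+x. ennreal (v x) * ennreal (?b0 (aff N x (-1) z)) \<partial>lebB N))" for z
  proof -
    note L = improved_L1_localised[OF k N v E l_def R lR, of z, unfolded Rl M_def[symmetric] Xf_def[symmetric]]
    have a: "(\<integral>\<^sup>+x. ennreal (v x) * ennreal (?c0 (aff N x (-1) z)) \<partial>lebB N) = ennreal (\<integral>x. v x * cut N R z x \<partial>lebB N)"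
      by (subst nn_integral_eq_integral[OF L(2), symmetric])
         (use v(3) in \<open>auto simp: cut_as_shifted[symmetric] ennreal_mult'[symmetric] intro!: nn_integral_cong\<close>)
    have b: "(\<integral>\<^sup>+x. ennreal (Xf x) * ennreal (?c0 (aff N x (-1) z)) \<partial>lebB N) = ennreal (\<integral>x. cut N R z x * Xf x \<partial>lebB N)"
      by (subst nn_integral_eq_integral[OF L(3), symmetric])
         (auto simp: Xf_def cut_as_shifted[symmetric] ennreal_mult'[symmetric] mult.commute intro!: nn_integral_cong)
    have c: "(\<integral>\<^sup>+x. ennreal (v x) * ennreal (?b0 (aff N x (-1) z)) \<partial>lebB N) = ennreal (\<integral>x. v x * ?b0 (aff N x (-1) z) \<partial>lebB N)"
      by (subst nn_integral_eq_integral[OF L(4), symmetric])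
         (use v(3) R in \<open>auto simp: ennreal_mult'[symmetric] intro!: nn_integral_cong\<close>)
    have nn: "0 \<le> (\<integral>x. v x * cut N R z x \<partial>lebB N)" "0 \<le> (\<integral>x. cut N R z x * Xf x \<partial>lebB N)"
      "0 \<le> (\<integral>x. v x * ?b0 (aff N x (-1) z) \<partial>lebB N)"
      using v(3) R by (auto intro!: integral_nonneg_AE simp: Xf_def)
    show ?thesis
      unfolding a b c using L(1) nn k M
      by (simp add: ennreal_mult'[symmetric] ennreal_plus[symmetric] ennreal_leI del: ennreal_plus)
  qed
  define Z where "Z = (\<integral>\<^sup>+x. ennreal (?c0 x) \<partial>lebB N)"
  have ml: "(\<lambda>z. \<integral>\<^sup>+x. ennreal (f x) * ennreal (g (aff N x (-1) z)) \<partial>lebB N) \<in> borel_measurable (lebB N)"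
    if [measurable]: "f \<in> borel_measurable (lebB N)" "g \<in> borel_measurable (lebB N)" for f g
    by (rule sigma_finite_measure.borel_measurable_nn_integral[OF sigma_finite_lebB]) (unfold split_beta', measurable)
  have eI: "(\<integral>\<^sup>+x. ennreal (v x) \<partial>lebB N) = ennreal I"
    unfolding I_def by (rule nn_integral_eq_integral[OF iv]) (use v(3) in auto)
  have eX: "(\<integral>\<^sup>+x. ennreal (Xf x) \<partial>lebB N) = ennreal X"
    unfolding X_def by (rule nn_integral_eq_integral[OF iX]) (auto simp: Xf_def)
  have eb: "(\<integral>\<^sup>+x. ennreal (?b0 x) \<partial>lebB N) = ennreal (4 * R ^ 3 * (2 * R) ^ N)"
  proof -
    have "(\<integral>\<^sup>+x. ennreal (?b0 x) \<partial>lebB N) = (\<integral>\<^sup>+x. ennreal (4 * R ^ 3) * indicator (cube N R) x \<partial>lebB N)"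
      by (intro nn_integral_cong) (auto split: split_indicator)
    also have "\<dots> = ennreal (4 * R ^ 3) * emeasure (lebB N) (cube N R)"
      by (rule nn_integral_cmult_indicator) measurable
    finally show ?thesis using R by (simp add: emeasure_cube ennreal_mult'[symmetric])
  qed
  have cv: "(\<integral>\<^sup>+z. \<integral>\<^sup>+x. ennreal (f x) * ennreal (g (aff N x (-1) z)) \<partial>lebB N \<partial>lebB N)
     = (\<integral>\<^sup>+x. ennreal (f x) \<partial>lebB N) * (\<integral>\<^sup>+x. ennreal (g x) \<partial>lebB N)"
    if [measurable]: "f \<in> borel_measurable (lebB N)" "g \<in> borel_measurable (lebB N)" for f g
    by (rule convolution_mass[of "\<lambda>x. ennreal (f x)" N "\<lambda>x. ennreal (g x)"]) measurable
  have mb: "?b0 \<in> borel_measurable (lebB N)" by measurable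
  have "ennreal (3 / 4 * k) * (ennreal I * Z) = (\<integral>\<^sup>+z. ennreal (3 / 4 * k) * (\<integral>\<^sup>+x. ennreal (v x) * ennreal (?c0 (aff N x (-1) z)) \<partial>lebB N) \<partial>lebB N)"
    unfolding Z_def eI[symmetric]
    by (subst nn_integral_cmult) (auto intro!: ml simp: cv)
  also have "\<dots> \<le> (\<integral>\<^sup>+z. ennreal M * ((\<integral>\<^sup>+x. ennreal (Xf x) * ennreal (?c0 (aff N x (-1) z)) \<partial>lebB N)
        + (\<integral>\<^sup>+x. ennreal (v x) * ennreal (?b0 (aff N x (-1) z)) \<partial>lebB N)) \<partial>lebB N)"
    by (intro nn_integral_mono loc)
  also have "\<dots> = ennreal M * (ennreal X * Z + ennreal I * ennreal (4 * R ^ 3 * (2 * R) ^ N))"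
  proof -
    have "(\<integral>\<^sup>+z. ennreal M * ((\<integral>\<^sup>+x. ennreal (Xf x) * ennreal (?c0 (aff N x (-1) z)) \<partial>lebB N)
        + (\<integral>\<^sup>+x. ennreal (v x) * ennreal (?b0 (aff N x (-1) z)) \<partial>lebB N)) \<partial>lebB N)
      = ennreal M * (\<integral>\<^sup>+z. (\<integral>\<^sup>+x. ennreal (Xf x) * ennreal (?c0 (aff N x (-1) z)) \<partial>lebB N)
        + (\<integral>\<^sup>+x. ennreal (v x) * ennreal (?b0 (aff N x (-1) z)) \<partial>lebB N) \<partial>lebB N)"
      by (rule nn_integral_cmult) (intro borel_measurable_add ml mb; measurable)
    also have "(\<integral>\<^sup>+z. (\<integral>\<^sup>+x. ennreal (Xf x) * ennreal (?c0 (aff N x (-1) z)) \<partial>lebB N)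
        + (\<integral>\<^sup>+x. ennreal (v x) * ennreal (?b0 (aff N x (-1) z)) \<partial>lebB N) \<partial>lebB N)
      = (\<integral>\<^sup>+z. (\<integral>\<^sup>+x. ennreal (Xf x) * ennreal (?c0 (aff N x (-1) z)) \<partial>lebB N) \<partial>lebB N)
        + (\<integral>\<^sup>+z. (\<integral>\<^sup>+x. ennreal (v x) * ennreal (?b0 (aff N x (-1) z)) \<partial>lebB N) \<partial>lebB N)"
      by (rule nn_integral_add) (intro ml mb; measurable)+
    also have "(\<integral>\<^sup>+z. (\<integral>\<^sup>+x. ennreal (Xf x) * ennreal (?c0 (aff N x (-1) z)) \<partial>lebB N) \<partial>lebB N)
      = (\<integral>\<^sup>+x. ennreal (Xf x) \<partial>lebB N) * (\<integral>\<^sup>+x. ennreal (?c0 x) \<partial>lebB N)"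
      by (rule cv) measurable
    also have "(\<integral>\<^sup>+z. (\<integral>\<^sup>+x. ennreal (v x) * ennreal (?b0 (aff N x (-1) z)) \<partial>lebB N) \<partial>lebB N)
      = (\<integral>\<^sup>+x. ennreal (v x) \<partial>lebB N) * (\<integral>\<^sup>+x. ennreal (?b0 x) \<partial>lebB N)"
      by (rule cv) measurable
    finally show ?thesis by (simp only: Z_def eI eX eb)
  qed
  finally have key: "ennreal (3 / 4 * k) * (ennreal I * Z) \<le> ennreal M * (ennreal X * Z + ennreal I * ennreal (4 * R ^ 3 * (2 * R) ^ N))" .
  have Zlow: "ennreal (9 / 16 * R ^ 4 * (R / real N) ^ N) \<le> Z"
    unfolding Z_def by (rule cut_mass_lower[OF R N])
  have Zfin: "Z < \<infinity>"
  proof -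
    have "Z = ennreal (\<integral>x. ?c0 x \<partial>lebB N)"
      unfolding Z_def
    proof (rule nn_integral_eq_integral)
      show "integrable (lebB N) ?c0"
        by (rule integrable_continuous[OF has_C1D(1)[OF has_C1_cut], where r=R])
           (use cut_eq_0[OF R] in \<open>auto simp: vanishes_off_cube_def aff_minus in_cube_iff\<close>)
    qed auto
    then show ?thesis by simp
  qed
  define \<zeta> where "\<zeta> = enn2real Z"
  have Z\<zeta>: "Z = ennreal \<zeta>" using Zfin by (simp add: \<zeta>_def)
  have zl: "9 / 16 * R ^ 4 * (R / real N) ^ N \<le> \<zeta>"
    using Zlow Zfin R unfolding Z\<zeta> by (subst (asm) ennreal_le_iff) (auto simp: \<zeta>_def)
  have q0: "0 < 9 / 16 * R ^ 4 * (R / real N) ^ N" using R N by simp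
  then have z0: "0 < \<zeta>" using zl by linarith
  have key': "3 / 4 * k * (I * \<zeta>) \<le> M * (X * \<zeta> + I * (4 * R ^ 3 * (2 * R) ^ N))"
    using key I0 X0 z0 M R k unfolding Z\<zeta>
    by (simp add: ennreal_mult'[symmetric] ennreal_plus[symmetric] ennreal_le_iff del: ennreal_plus)
  \<comment> \<open>\<open>\<mu>\<close> is an upper bound for the ratio of the masses of the gradient of the cut-off and of the cut-off.\<close>
  define \<mu> where "\<mu> = 64 / 9 * (2 * real N) ^ N / \<rho> * k"
  have "4 * R ^ 3 * (2 * R) ^ N = \<mu> * (9 / 16 * R ^ 4 * (R / real N) ^ N)"
    using R N k \<rho> by (simp add: \<mu>_def R_def power_mult_distrib power_divide power2_eq_square power3_eq_cube power4_eq_xxxx field_simps)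
  also have "\<dots> \<le> \<mu> * \<zeta>"
    using zl k \<rho> by (intro mult_left_mono) (auto simp: \<mu>_def)
  finally have "I * (4 * R ^ 3 * (2 * R) ^ N) \<le> I * (\<mu> * \<zeta>)"
    using I0 by (rule mult_left_mono)
  then have "M * (X * \<zeta> + I * (4 * R ^ 3 * (2 * R) ^ N)) \<le> M * (X * \<zeta> + I * (\<mu> * \<zeta>))"
    using M by (intro mult_left_mono) auto
  with key' have "\<zeta> * (3 / 4 * k * I) \<le> \<zeta> * (M * (X + I * \<mu>))"
    by (simp add: algebra_simps)
  then have "3 / 4 * k * I \<le> M * (X + I * \<mu>)"
    by (rule mult_left_le_imp_le) (rule z0)
  then have "3 / 4 * k * I / M \<le> X + I * \<mu>"
    using M by (simp add: pos_divide_le_eq mult_ac)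
  then have "(3 / 4 / M - 64 / 9 * (2 * real N) ^ N / \<rho>) * k * I \<le> X"
    by (simp add: \<mu>_def algebra_simps)
  then show ?thesis
    unfolding M_def I_def X_def Xf_def .
qed

lemma log_beats_reciprocal:
  assumes "1 \<le> N"
  obtains \<rho> where "1 \<le> \<rho>" "0 < 3 / 4 / (12 * ln (1 + 16 * (32 * real N * \<rho>) ^ N) + 1) - 64 / 9 * (2 * real N) ^ N / \<rho>"
proof -
  define C where "C = 64 / 9 * (2 * real N) ^ N"
  have C: "0 < C" using assms by (simp add: C_def)
  have "((\<lambda>\<rho>. 4 / 3 * C * ((12 * ln 17 + 12 * real N * ln (32 * real N) + 1) * inverse \<rho> + 12 * real N * (ln \<rho> / \<rho>)))
      \<longlongrightarrow> 4 / 3 * C * ((12 * ln 17 + 12 * real N * ln (32 * real N) + 1) * 0 + 12 * real N * 0)) at_top"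
    by (intro tendsto_intros tendsto_inverse_0_at_top filterlim_ident ln_x_over_x_tendsto_0)
  then have "\<forall>\<^sub>F \<rho> in at_top. 4 / 3 * C * ((12 * ln 17 + 12 * real N * ln (32 * real N) + 1) * inverse \<rho> + 12 * real N * (ln \<rho> / \<rho>)) < 1"
    by (rule order_tendstoD) simp
  then have "\<forall>\<^sub>F \<rho> in at_top. 1 \<le> \<rho> \<and> 4 / 3 * C * ((12 * ln 17 + 12 * real N * ln (32 * real N) + 1) * inverse \<rho> + 12 * real N * (ln \<rho> / \<rho>)) < 1"
    using eventually_ge_at_top[of 1] by eventually_elim auto
  then obtain \<rho> where \<rho>: "1 \<le> \<rho>"
    and s: "4 / 3 * C * ((12 * ln 17 + 12 * real N * ln (32 * real N) + 1) * inverse \<rho> + 12 * real N * (ln \<rho> / \<rho>)) < 1"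
    by (metis (mono_tags, lifting) eventually_at_top_linorder order_refl)
  define y where "y = 32 * real N * \<rho>"
  have y: "1 \<le> y"
  proof -
    have "1 * 1 \<le> 32 * real N * \<rho>" using assms \<rho> by (intro mult_mono) auto
    then show ?thesis by (simp add: y_def)
  qed
  have yN: "1 \<le> y ^ N" using y by (rule one_le_power)
  have "ln (1 + 16 * y ^ N) \<le> ln (17 * y ^ N)" using yN by (intro ln_mono) auto
  also have "\<dots> = ln 17 + real N * ln y" using y yN by (simp add: ln_mult ln_realpow)
  also have "ln y = ln (32 * real N) + ln \<rho>" using assms \<rho> unfolding y_def by (intro ln_mult_pos) auto
  finally have L: "12 * ln (1 + 16 * y ^ N) + 1 \<le> (12 * ln 17 + 12 * real N * ln (32 * real N) + 1) + 12 * real N * ln \<rho>"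
    by (simp add: algebra_simps)
  have L0: "0 < 12 * ln (1 + 16 * y ^ N) + 1" using yN ln_ge_zero[of "1 + 16 * y ^ N"] by linarith
  have "4 / 3 * C * ((12 * ln 17 + 12 * real N * ln (32 * real N) + 1) + 12 * real N * ln \<rho>) < \<rho>"
    using s \<rho> by (simp add: field_simps)
  moreover have "4 / 3 * C * (12 * ln (1 + 16 * y ^ N) + 1) \<le> 4 / 3 * C * ((12 * ln 17 + 12 * real N * ln (32 * real N) + 1) + 12 * real N * ln \<rho>)"
    using L C by (intro mult_left_mono) auto
  ultimately have "4 / 3 * C * (12 * ln (1 + 16 * y ^ N) + 1) < \<rho>" by linarith
  then have "C / \<rho> < 3 / 4 / (12 * ln (1 + 16 * y ^ N) + 1)"
    using L0 \<rho> by (simp add: field_simps)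
  then show ?thesis using that[OF \<rho>] by (simp add: C_def y_def)
qed

text \<open>
  A logarithm grows more slowly than \<open>\<rho>\<close>, so the constant of \<open>improved_L1_fixed_radius\<close> is positive for some
  \<open>\<rho>\<close> that depends on \<open>N\<close> alone.
\<close>

proposition improved_cheeger_L1:
  assumes N: "1 \<le> N"
  obtains e where "0 < e"
    "\<And>E k v D r. cheeger_bound N E k \<Longrightarrow> 0 < k \<Longrightarrow> has_C1 N v D \<Longrightarrow> vanishes_off_cube N r v
      \<Longrightarrow> (\<And>x. x \<in> pts N \<Longrightarrow> 0 \<le> v x) \<Longrightarrow> (\<And>x. x \<in> pts N \<Longrightarrow> v x \<noteq> 0 \<Longrightarrow> x \<in> E)
      \<Longrightarrow> e * k * (\<integral>x. v x \<partial>lebB N) \<le> (\<integral>x. \<bar>gnorm N D x - k * v x\<bar> \<partial>lebB N)"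
proof -
  obtain \<rho> where \<rho>: "1 \<le> \<rho>"
    "0 < 3 / 4 / (12 * ln (1 + 16 * (32 * real N * \<rho>) ^ N) + 1) - 64 / 9 * (2 * real N) ^ N / \<rho>"
    using log_beats_reciprocal[OF N] .
  show ?thesis
    by (rule that[OF \<rho>(2)]) (rule improved_L1_fixed_radius[OF _ _ N _ _ _ _ \<rho>(1)])
qed

section \<open>Passage to the exponent p\<close>

text \<open>
  The tangent line inequality for \<open>t \<mapsto> t\<^sup>p / p\<close> is Young's inequality for \<open>\<tau>\<close> and \<open>m\<close> to the power \<open>p - 1\<close>.
\<close>

lemma powr_tangent:
  fixes \<tau> m p :: real
  assumes "1 < p" "0 \<le> \<tau>" "0 \<le> m"
  shows "m powr p / p + m powr (p - 1) * (\<tau> - m) \<le> \<tau> powr p / p"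
proof -
  define q where "q = p / (p - 1)"
  have q: "1 < q" "1 / p + 1 / q = 1" "1 / q = 1 - 1 / p"
    using assms(1) by (auto simp: q_def field_simps)
  have "\<tau> * m powr (p - 1) \<le> \<tau> powr p / p + (m powr (p - 1)) powr q / q"
    by (rule Youngs_inequality) (use assms q in auto)
  also have "(m powr (p - 1)) powr q = m powr p"
    using assms(1) by (simp add: powr_powr q_def)
  also have "m powr p / q = m powr p * (1 / q)" by simp
  also have "\<dots> = m powr p - m powr p / p" unfolding q(3) by (simp add: right_diff_distrib)
  finally have "\<tau> * m powr (p - 1) \<le> \<tau> powr p / p + (m powr p - m powr p / p)" .
  moreover have "m powr (p - 1) * m = m powr p"
    using assms by (cases "m = 0") (auto simp: powr_diff)
  ultimately show ?thesis by (simp add: algebra_simps)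
qed

text \<open>
  Convexity at \<open>x + y = s (x / s) + (1 - s) (y / (1 - s))\<close>. With \<open>s\<close> close to one this splits off a small
  perturbation \<open>y\<close> and takes the place of Minkowski's inequality.
\<close>

lemma powr_sum_le:
  fixes x y p s :: real
  assumes p: "1 < p" and s: "0 < s" "s < 1" and xy: "0 \<le> x" "0 \<le> y"
  shows "(x + y) powr p \<le> s powr (1 - p) * x powr p + (1 - s) powr (1 - p) * y powr p"
proof -
  define m where "m = x + y"
  have m: "0 \<le> m" using xy by (simp add: m_def)
  have a: "s * (m powr p / p + m powr (p - 1) * (x / s - m)) \<le> s * ((x / s) powr p / p)"
    by (intro mult_left_mono powr_tangent) (use p s xy m in auto)
  have b: "(1 - s) * (m powr p / p + m powr (p - 1) * (y / (1 - s) - m)) \<le> (1 - s) * ((y / (1 - s)) powr p / p)"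
    by (intro mult_left_mono powr_tangent) (use p s xy m in auto)
  have c: "c * ((z / c) powr p / p) = c powr (1 - p) * z powr p / p" if "0 < c" "0 \<le> z" for c z
    using that by (simp add: powr_divide powr_diff)
  have "s * (m powr p / p + m powr (p - 1) * (x / s - m)) + (1 - s) * (m powr p / p + m powr (p - 1) * (y / (1 - s) - m))
      = m powr p / p + m powr (p - 1) * (s * (x / s) + (1 - s) * (y / (1 - s)) - m)"
    by (simp only: ring_distribs) (simp add: algebra_simps)
  also have "s * (x / s) + (1 - s) * (y / (1 - s)) - m = 0"
    using s by (simp add: m_def)
  finally have eq: "s * (m powr p / p + m powr (p - 1) * (x / s - m)) + (1 - s) * (m powr p / p + m powr (p - 1) * (y / (1 - s) - m))
      = m powr p / p" by simp
  have "m powr p / p \<le> s powr (1 - p) * x powr p / p + (1 - s) powr (1 - p) * y powr p / p"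
    using eq a b c[OF s(1) xy(1)] c[of "1 - s" y] s xy(2) by linarith
  then have "m powr p / p \<le> (s powr (1 - p) * x powr p + (1 - s) powr (1 - p) * y powr p) / p"
    by (simp add: add_divide_distrib)
  then show ?thesis
    using p by (simp add: m_def divide_le_cancel)
qed

text \<open>
  The deficit in Young's inequality is convex with its only zero at one, so away from one it grows at least
  linearly. The slopes are those of the tangents at \<open>1 + \<epsilon>/2\<close> and \<open>1 - \<epsilon>/2\<close>.
\<close>

lemma young_deficit:
  fixes p \<epsilon> :: real
  assumes p: "1 < p" and \<epsilon>: "0 < \<epsilon>" "\<epsilon> < 1"
  obtains C where "0 < C"
    "\<And>\<tau>. 0 \<le> \<tau> \<Longrightarrow> \<bar>\<tau> - 1\<bar> \<le> \<epsilon> + C * (\<tau> powr p / p + 1 - 1 / p - \<tau>)"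
proof -
  define d where "d \<tau> = \<tau> powr p / p + 1 - 1 / p - \<tau>" for \<tau>
  have d0: "0 \<le> d \<tau>" if "0 \<le> \<tau>" for \<tau>
    using powr_tangent[OF p that, of 1] p by (simp add: d_def algebra_simps)
  have dm: "(m powr (p - 1) - 1) * (\<tau> - m) \<le> d \<tau>" if "0 \<le> \<tau>" "0 \<le> m" for \<tau> m
  proof -
    have "m powr p / p + m powr (p - 1) * (\<tau> - m) \<le> \<tau> powr p / p"
      by (rule powr_tangent[OF p that])
    then show ?thesis
      using d0[OF that(2)] by (simp add: d_def algebra_simps)
  qed
  \<comment> \<open>Halfway to the range in question: there \<open>\<tau> - m1\<close> is at least half of \<open>\<tau> - 1\<close>.\<close>
  define m1 where "m1 = 1 + \<epsilon> / 2"
  define m2 where "m2 = 1 - \<epsilon> / 2"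
  define a1 where "a1 = m1 powr (p - 1) - 1"
  define a2 where "a2 = 1 - m2 powr (p - 1)"
  have a1: "0 < a1"
    using powr_less_mono2[of "p - 1" 1 m1] p \<epsilon> by (simp add: a1_def m1_def)
  have a2: "0 < a2"
    using powr_less_mono2[of "p - 1" m2 1] p \<epsilon> by (simp add: a2_def m2_def)
  define C where "C = max (2 / a1) (2 / a2)"
  have C: "0 < C" using a1 by (auto simp: C_def less_max_iff_disj)
  have "\<bar>\<tau> - 1\<bar> \<le> \<epsilon> + C * d \<tau>" if \<tau>: "0 \<le> \<tau>" for \<tau>
  proof -
    have Cd: "0 \<le> C * d \<tau>" using C d0[OF \<tau>] by simp
    consider "\<bar>\<tau> - 1\<bar> \<le> \<epsilon>" | "1 + \<epsilon> < \<tau>" | "\<tau> < 1 - \<epsilon>" by linarith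
    then show ?thesis
    proof cases
      case 2
      have "a1 * ((\<tau> - 1) / 2) \<le> a1 * (\<tau> - m1)"
        using 2 a1 \<epsilon> by (intro mult_left_mono) (auto simp: m1_def)
      also have "\<dots> \<le> d \<tau>" using dm[OF \<tau>, of m1] \<epsilon> by (simp add: a1_def m1_def)
      finally have "\<tau> - 1 \<le> 2 / a1 * d \<tau>" using a1 by (simp add: field_simps)
      also have "\<dots> \<le> C * d \<tau>" using d0[OF \<tau>] by (intro mult_right_mono) (auto simp: C_def)
      finally show ?thesis using 2 \<epsilon> by linarith
    next
      case 3
      have "a2 * ((1 - \<tau>) / 2) \<le> a2 * (m2 - \<tau>)"
        using 3 a2 \<epsilon> by (intro mult_left_mono) (auto simp: m2_def)
      also have "\<dots> \<le> d \<tau>" using dm[OF \<tau>, of m2] \<epsilon> by (simp add: a2_def m2_def algebra_simps)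
      finally have "1 - \<tau> \<le> 2 / a2 * d \<tau>" using a2 by (simp add: field_simps)
      also have "\<dots> \<le> C * d \<tau>" using d0[OF \<tau>] by (intro mult_right_mono) (auto simp: C_def)
      finally show ?thesis using 3 \<epsilon> by linarith
    qed (use Cd in linarith)
  qed
  then show ?thesis using that[OF C] by (simp add: d_def)
qed

lemma young_deficit_homogeneous:
  fixes p \<epsilon> C a U :: real
  assumes p: "1 < p" and C: "0 < C" "0 < \<epsilon>"
    and d: "\<And>\<tau>. 0 \<le> \<tau> \<Longrightarrow> \<bar>\<tau> - 1\<bar> \<le> \<epsilon> + C * (\<tau> powr p / p + 1 - 1 / p - \<tau>)"
    and aU: "0 \<le> a" "0 \<le> U"
  shows "U powr (p - 1) * \<bar>a - U\<bar>
     \<le> \<epsilon> * U powr p + C * (a powr p / p + (1 - 1 / p) * U powr p - a * U powr (p - 1))"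
proof (cases "U = 0")
  case True
  then show ?thesis using p C aU by simp
next
  case False
  then have U: "0 < U" using aU by simp
  have "U powr p * \<bar>a / U - 1\<bar> \<le> U powr p * (\<epsilon> + C * ((a / U) powr p / p + 1 - 1 / p - a / U))"
    using aU by (intro mult_left_mono d) auto
  also have "\<dots> = \<epsilon> * U powr p + C * (U powr p * (a / U) powr p / p + (1 - 1 / p) * U powr p - U powr p * (a / U))"
    by (simp add: algebra_simps)
  also have "U powr p * (a / U) powr p = a powr p"
    using U aU by (simp add: powr_divide)
  also have "U powr p * (a / U) = a * U powr (p - 1)"
    using U by (simp add: powr_diff)
  also have "U powr p * \<bar>a / U - 1\<bar> = U powr (p - 1) * \<bar>a - U\<bar>"
  proof -
    have "a / U - 1 = (a - U) / U" using U by (simp add: field_simps)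
    then show ?thesis using U by (simp add: powr_diff abs_divide)
  qed
  finally show ?thesis .
qed

lemma DERIV_abs_powr:
  fixes p :: real
  assumes p: "1 < p"
  shows "((\<lambda>t. \<bar>t\<bar> powr p) has_real_derivative p * \<bar>t\<bar> powr (p - 1) * sgn t) (at t)"
proof -
  consider "t > 0" | "t < 0" | "t = 0" by linarith
  then show ?thesis
  proof cases
    case 1
    have "((\<lambda>s. s powr p) has_real_derivative p * t powr (p - 1)) (at t)"
      using has_real_derivative_powr[OF 1, of p] .
    moreover have "\<forall>\<^sub>F s in nhds t. \<bar>s\<bar> powr p = s powr p"
      using eventually_nhds_in_open[of "{0<..}" t] 1 by (auto elim!: eventually_mono)
    ultimately show ?thesis
      using 1 by (subst DERIV_cong_ev[OF refl _ refl]) auto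
  next
    case 2
    have "((\<lambda>s. (- s) powr p) has_real_derivative p * (- t) powr (p - 1) * (- 1)) (at t)"
      by (rule DERIV_chain2[OF has_real_derivative_powr]) (use 2 in \<open>auto intro!: derivative_eq_intros\<close>)
    moreover have "\<forall>\<^sub>F s in nhds t. \<bar>s\<bar> powr p = (- s) powr p"
      using eventually_nhds_in_open[of "{..<0}" t] 2 by (auto elim!: eventually_mono)
    ultimately show ?thesis
      using 2 by (subst DERIV_cong_ev[OF refl _ refl]) auto
  next
    case 3
    have "((\<lambda>h. \<bar>h\<bar> powr p / h) \<longlongrightarrow> 0) (at 0)"
    proof (rule tendsto_0_le[where K=1])
      have "((\<lambda>h::real. \<bar>h\<bar> powr (p - 1)) \<longlongrightarrow> \<bar>0\<bar> powr (p - 1)) (at 0)"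
        by (rule tendsto_powr'[OF tendsto_rabs[OF tendsto_ident_at] tendsto_const]) (use p in auto)
      then show "((\<lambda>h::real. \<bar>h\<bar> powr (p - 1)) \<longlongrightarrow> 0) (at 0)" by simp
      show "\<forall>\<^sub>F h in at 0. norm (\<bar>h\<bar> powr p / h) \<le> norm (\<bar>h\<bar> powr (p - 1)) * 1"
      proof (intro always_eventually allI)
        fix h :: real
        show "norm (\<bar>h\<bar> powr p / h) \<le> norm (\<bar>h\<bar> powr (p - 1)) * 1"
          by (cases "h = 0") (auto simp: powr_diff abs_divide)
      qed
    qed
    then show ?thesis
      using 3 by (simp add: DERIV_def)
  qed
qed

lemma continuous_abs_powr: "0 < p \<Longrightarrow> continuous_on S (\<lambda>t::real. \<bar>t\<bar> powr p)"
  by (intro continuous_on_powr' continuous_intros) auto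

lemma continuous_abs_powr_deriv:
  fixes p :: real
  assumes p: "1 < p"
  shows "continuous_on UNIV (\<lambda>t. p * \<bar>t\<bar> powr (p - 1) * sgn t)"
proof -
  have "isCont (\<lambda>t. p * \<bar>t\<bar> powr (p - 1) * sgn t) t" for t
  proof (cases "t = 0")
    case False
    have "isCont (\<lambda>t. p * \<bar>t\<bar> powr (p - 1)) t"
      using continuous_abs_powr[of "p - 1" UNIV] p
      by (intro continuous_intros) (auto simp: continuous_on_eq_continuous_at)
    moreover have "isCont sgn t"
      using False by (intro isCont_sgn) auto
    ultimately show ?thesis by (rule isCont_mult)
  next
    case True
    have "((\<lambda>h. p * \<bar>h\<bar> powr (p - 1) * sgn h) \<longlongrightarrow> 0) (at 0)"
    proof (rule tendsto_0_le[where K="p"])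
      have "((\<lambda>h::real. \<bar>h\<bar> powr (p - 1)) \<longlongrightarrow> \<bar>0\<bar> powr (p - 1)) (at 0)"
        by (rule tendsto_powr'[OF tendsto_rabs[OF tendsto_ident_at] tendsto_const]) (use p in auto)
      then show "((\<lambda>h::real. \<bar>h\<bar> powr (p - 1)) \<longlongrightarrow> 0) (at 0)" by simp
      show "\<forall>\<^sub>F h in at 0. norm (p * \<bar>h\<bar> powr (p - 1) * sgn h) \<le> norm (\<bar>h\<bar> powr (p - 1)) * p"
        using p by (intro always_eventually allI) (auto simp: abs_mult sgn_if)
    qed
    then show ?thesis using True by (simp add: isCont_def)
  qed
  then show ?thesis by (simp add: continuous_on_eq_continuous_at)
qed

lemma integrable_abs_powr:
  assumes "continuous_map (euclid N) euclideanreal f" "vanishes_off_cube N r f" "0 < p"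
  shows "integrable (lebB N) (\<lambda>x. \<bar>f x\<bar> powr p)"
proof (rule integrable_continuous[where r=r])
  have "continuous_map (euclid N) euclideanreal ((\<lambda>t. \<bar>t\<bar> powr p) \<circ> f)"
    by (rule continuous_map_compose[OF assms(1)]) (simp add: continuous_abs_powr[OF assms(3)])
  then show "continuous_map (euclid N) euclideanreal (\<lambda>x. \<bar>f x\<bar> powr p)" by (simp add: o_def)
qed (use assms in \<open>auto simp: vanishes_off_cube_def\<close>)

text \<open>
  Put \<open>v = |u|\<^sup>p\<close> and \<open>a = (p/k) |\<nabla>u|\<close>. Then \<open>|\<nabla>v| = k a |u|\<close> with \<open>|u|\<close> to the power \<open>p - 1\<close>, so the distance
  of \<open>|\<nabla>v|\<close> and \<open>k v\<close> is controlled by \<open>\<epsilon> \<integral>|u|\<^sup>p\<close> and the integrated Young deficit of \<open>a\<close> and \<open>|u|\<close>. By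
  Cheeger's inequality for \<open>v\<close> that deficit is at most \<open>(\<integral>a\<^sup>p - \<integral>|u|\<^sup>p) / p\<close>, while the \<open>L\<^sup>1\<close> improvement bounds the
  distance from below.
\<close>

proposition improved_cheeger_Lp:
  fixes p :: real
  assumes N: "1 \<le> N" and p: "1 < p"
  obtains \<delta> where "0 < \<delta>"
    "\<And>E k u D r. cheeger_bound N E k \<Longrightarrow> 0 < k \<Longrightarrow> has_C1 N u D \<Longrightarrow> vanishes_off_cube N r u
      \<Longrightarrow> (\<And>x. x \<in> pts N \<Longrightarrow> u x \<noteq> 0 \<Longrightarrow> x \<in> E)
      \<Longrightarrow> (k / p) powr p * (1 + \<delta>) * (\<integral>x. \<bar>u x\<bar> powr p \<partial>lebB N) \<le> (\<integral>x. gnorm N D x powr p \<partial>lebB N)"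
proof -
  show ?thesis
  proof (rule improved_cheeger_L1[OF N])
    fix e :: real
    assume e: "0 < e"
      "\<And>E k v D r. cheeger_bound N E k \<Longrightarrow> 0 < k \<Longrightarrow> has_C1 N v D \<Longrightarrow> vanishes_off_cube N r v
        \<Longrightarrow> (\<And>x. x \<in> pts N \<Longrightarrow> 0 \<le> v x) \<Longrightarrow> (\<And>x. x \<in> pts N \<Longrightarrow> v x \<noteq> 0 \<Longrightarrow> x \<in> E)
        \<Longrightarrow> e * k * (\<integral>x. v x \<partial>lebB N) \<le> (\<integral>x. \<bar>gnorm N D x - k * v x\<bar> \<partial>lebB N)"
    \<comment> \<open>Half of \<open>e\<close> absorbs the error term of Young's inequality, the other half is the gain.\<close>
    define \<epsilon> where "\<epsilon> = min e 1 / 2"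
    have \<epsilon>: "0 < \<epsilon>" "\<epsilon> < 1" "2 * \<epsilon> \<le> e" using e(1) by (auto simp: \<epsilon>_def min_def)
    obtain C where C: "0 < C"
      "\<And>\<tau>. 0 \<le> \<tau> \<Longrightarrow> \<bar>\<tau> - 1\<bar> \<le> \<epsilon> + C * (\<tau> powr p / p + 1 - 1 / p - \<tau>)"
      by (rule young_deficit[OF p \<epsilon>(1,2)]) (rule that; blast)
    define \<delta> where "\<delta> = p * \<epsilon> / C"
    have \<delta>: "0 < \<delta>" using p \<epsilon> C by (simp add: \<delta>_def)
    have "(k / p) powr p * (1 + \<delta>) * (\<integral>x. \<bar>u x\<bar> powr p \<partial>lebB N) \<le> (\<integral>x. gnorm N D x powr p \<partial>lebB N)"
      if k: "cheeger_bound N E k" "0 < k" and u: "has_C1 N u D" "vanishes_off_cube N r u"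
        and E: "\<And>x. x \<in> pts N \<Longrightarrow> u x \<noteq> 0 \<Longrightarrow> x \<in> E" for E k u D r
    proof -
      define v where "v x = \<bar>u x\<bar> powr p" for x
      define Dv where "Dv i x = p * \<bar>u x\<bar> powr (p - 1) * sgn (u x) * D i x" for i x
      have vC: "has_C1 N v Dv"
        unfolding v_def[abs_def] Dv_def[abs_def]
        by (rule has_C1_chain[OF u(1), where S=UNIV])
           (use DERIV_abs_powr[OF p] continuous_abs_powr_deriv[OF p] in auto)
      have vv: "vanishes_off_cube N r v"
        using u(2) unfolding vanishes_off_cube_def v_def by simp
      have vE: "x \<in> pts N \<Longrightarrow> v x \<noteq> 0 \<Longrightarrow> x \<in> E" for x
        using E by (auto simp: v_def)
      define a where "a x = p / k * gnorm N D x" for x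
      have a0: "0 \<le> a x" for x using p k by (simp add: a_def)
      have gv: "gnorm N Dv x = k * (a x * \<bar>u x\<bar> powr (p - 1))" for x
      proof (cases "u x = 0")
        case True
        then have "gnorm N Dv x = 0" by (simp add: gnorm_def enorm_def Dv_def L2_set_def)
        then show ?thesis using True p by simp
      next
        case False
        have "gnorm N Dv x = \<bar>p * \<bar>u x\<bar> powr (p - 1) * sgn (u x)\<bar> * gnorm N D x"
          unfolding Dv_def[abs_def] by (rule gnorm_scale[where c="\<lambda>x. p * \<bar>u x\<bar> powr (p - 1) * sgn (u x)"])
        then show ?thesis
          using False p k by (simp add: a_def abs_mult abs_sgn_eq)
      qed
      have cG: "continuous_map (euclid N) euclideanreal (gnorm N D)"
        by (rule continuous_map_gnorm) (rule has_C1D[OF u(1)])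
      have vG: "vanishes_off_cube N r (gnorm N D)"
        by (rule gnorm_vanishes) (rule has_C1_vanishes[OF u])
      have iv: "integrable (lebB N) v" and iDv: "integrable (lebB N) (gnorm N Dv)"
        using has_C1_integrable[OF vC vv] by auto
      have iG: "integrable (lebB N) (\<lambda>x. gnorm N D x powr p)"
        using integrable_abs_powr[OF cG vG, of p] p by simp
      have ap: "a x powr p = (p / k) powr p * gnorm N D x powr p" for x
        unfolding a_def by (rule powr_mult)
      have ia: "integrable (lebB N) (\<lambda>x. a x powr p)"
        unfolding ap using iG by simp
      define J where "J = (\<integral>x. v x \<partial>lebB N)"
      define A where "A = (\<integral>x. a x powr p \<partial>lebB N)"
      have J1: "k * J \<le> (\<integral>x. gnorm N Dv x \<partial>lebB N)"
        unfolding J_def by (rule cheeger_bound_L1[OF k(1) vC vv]) (use vE in \<open>auto simp: v_def\<close>)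
      have "e * k * J \<le> (\<integral>x. \<bar>gnorm N Dv x - k * v x\<bar> \<partial>lebB N)"
        unfolding J_def by (rule e(2)[OF k vC vv]) (use vE in \<open>auto simp: v_def\<close>)
      also have "\<dots> \<le> (\<integral>x. (k * \<epsilon> + k * C * (1 - 1 / p)) * v x + k * C / p * a x powr p - C * gnorm N Dv x \<partial>lebB N)"
      proof (rule integral_mono)
        fix x
        have "gnorm N Dv x - k * v x = k * (\<bar>u x\<bar> powr (p - 1) * (a x - \<bar>u x\<bar>))"
        proof -
          have "\<bar>u x\<bar> powr (p - 1) * \<bar>u x\<bar> = v x"
            by (cases "u x = 0") (auto simp: v_def powr_diff)
          then show ?thesis unfolding gv by (simp add: algebra_simps)
        qed
        then have "\<bar>gnorm N Dv x - k * v x\<bar> = k * (\<bar>u x\<bar> powr (p - 1) * \<bar>a x - \<bar>u x\<bar>\<bar>)"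
          using k by (simp add: abs_mult)
        also have "\<dots> \<le> k * (\<epsilon> * v x + C * (a x powr p / p + (1 - 1 / p) * v x - a x * \<bar>u x\<bar> powr (p - 1)))"
          unfolding v_def using k
          by (intro mult_left_mono young_deficit_homogeneous[OF p C(1) \<epsilon>(1) C(2)] a0) auto
        also have "\<dots> = (k * \<epsilon> + k * C * (1 - 1 / p)) * v x + k * C / p * a x powr p - C * gnorm N Dv x"
          unfolding gv by (simp only: ring_distribs) (simp add: mult_ac)
        finally show "\<bar>gnorm N Dv x - k * v x\<bar> \<le> (k * \<epsilon> + k * C * (1 - 1 / p)) * v x + k * C / p * a x powr p - C * gnorm N Dv x" .
      qed (use iv iDv ia in auto)
      also have "\<dots> = (k * \<epsilon> + k * C * (1 - 1 / p)) * J + k * C / p * A - C * (\<integral>x. gnorm N Dv x \<partial>lebB N)"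
        unfolding J_def A_def using iv iDv ia by simp
      also have "\<dots> \<le> (k * \<epsilon> + k * C * (1 - 1 / p)) * J + k * C / p * A - C * (k * J)"
        using C(1) J1 by (intro diff_left_mono mult_left_mono) auto
      also have "\<dots> = k * (\<epsilon> * J + C / p * (A - J))"
        by (simp add: algebra_simps diff_divide_distrib)
      finally have "k * (e * J) \<le> k * (\<epsilon> * J + C / p * (A - J))" by (simp add: mult_ac)
      then have "e * J \<le> \<epsilon> * J + C / p * (A - J)"
        by (rule mult_left_le_imp_le) (rule k(2))
      moreover have "2 * \<epsilon> * J \<le> e * J"
        using \<epsilon>(3) by (intro mult_right_mono) (auto simp: J_def v_def intro!: integral_nonneg_AE)
      ultimately have "\<epsilon> * J \<le> C / p * (A - J)" by simp
      then have "p / C * (\<epsilon> * J) \<le> p / C * (C / p * (A - J))"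
        using p C(1) by (intro mult_left_mono) auto
      also have "\<dots> = A - J" using p C(1) by simp
      finally have "(1 + \<delta>) * J \<le> A"
        by (simp add: \<delta>_def algebra_simps)
      also have "A = (p / k) powr p * (\<integral>x. gnorm N D x powr p \<partial>lebB N)"
        unfolding A_def ap by simp
      finally have "(k / p) powr p * ((1 + \<delta>) * J) \<le> (k / p) powr p * ((p / k) powr p * (\<integral>x. gnorm N D x powr p \<partial>lebB N))"
        by (rule mult_left_mono) simp
      also have "\<dots> = (k / p) powr p * (p / k) powr p * (\<integral>x. gnorm N D x powr p \<partial>lebB N)" by simp
      also have "(k / p) powr p * (p / k) powr p = 1"
        using p k by (simp add: powr_mult[symmetric])
      finally show ?thesis unfolding J_def v_def by (simp add: mult_ac)
    qed
    then show ?thesis by (rule that[OF \<delta>])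
  qed
qed

section \<open>Sobolev pairs as limits of smooth functions\<close>

lemma integrable_leb_on_iff:
  assumes [measurable]: "f \<in> borel_measurable (lebB N)" "A \<in> sets (lebB N)"
  shows "integrable (leb_on N A) f \<longleftrightarrow> integrable (lebB N) (\<lambda>x. indicator A x * f x :: real)"
proof -
  have "integrable (leb_on N A) f \<longleftrightarrow> integrable (leb N) (\<lambda>x. indicator A x *\<^sub>R f x)"
    unfolding leb_on_def
    by (rule integrable_restrict_space) (use assms sets_leb in \<open>auto simp: leb_def intro!: sets.Int\<close>)
  also have "\<dots> \<longleftrightarrow> integrable (lebB N) (\<lambda>x. indicator A x * f x)"
    unfolding leb_def by (subst integrable_completion) auto
  finally show ?thesis .
qed

lemma measurable_leb_on: "f \<in> borel_measurable (lebB N) \<Longrightarrow> f \<in> borel_measurable (leb_on N A)"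
  unfolding leb_on_def by (intro measurable_restrict_space1 measurable_leb)

lemma integral_leb_on_supported:
  assumes f: "f \<in> borel_measurable (lebB N)" "A \<in> sets (lebB N)"
    and z: "\<And>x. x \<in> pts N \<Longrightarrow> x \<notin> A \<Longrightarrow> f x = (0::real)"
  shows "(\<integral>x. f x \<partial>leb_on N A) = (\<integral>x. f x \<partial>lebB N)"
    and "integrable (lebB N) f \<Longrightarrow> integrable (leb_on N A) f"
proof -
  have e: "indicator A x * f x = f x" if "x \<in> space (lebB N)" for x
    using z that by (auto split: split_indicator)
  show "(\<integral>x. f x \<partial>leb_on N A) = (\<integral>x. f x \<partial>lebB N)"
    unfolding integral_leb_on[OF f] by (rule Bochner_Integration.integral_cong[OF refl e])
  show "integrable (lebB N) f \<Longrightarrow> integrable (leb_on N A) f"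
    unfolding integrable_leb_on_iff[OF f] by (subst Bochner_Integration.integrable_cong[OF refl e])
qed

lemma line_continuous: "x \<in> pts N \<Longrightarrow> i < N \<Longrightarrow> continuous_map euclideanreal (euclid N) (\<lambda>t. x(i := t))"
  unfolding euclid_def
  by (subst continuous_map_componentwise) (auto simp: upd_pts intro!: extensional_arb[THEN sym] simp: PiE_iff extensional_def)

text \<open>
  The gradient vanishes off \<open>E\<close>, also at boundary points, because the support is closed and contained
  in \<open>E\<close>; so integrals over \<open>E\<close> and over the whole space agree.
\<close>

lemma Cinf_cD:
  assumes \<phi>: "\<phi> \<in> Cinf_c N E"
  shows "has_C1 N \<phi> (\<lambda>i. partial_deriv i \<phi>)"
    and "\<exists>r. vanishes_off_cube N r \<phi>"
    and "x \<in> pts N \<Longrightarrow> x \<notin> E \<Longrightarrow> \<phi> x = 0"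
    and "x \<in> pts N \<Longrightarrow> x \<notin> E \<Longrightarrow> i < N \<Longrightarrow> partial_deriv i \<phi> x = 0"
proof -
  have Ck: "Ck N 1 \<phi>" and cs: "compactin (euclid N) (supp N \<phi>)" and sE: "supp N \<phi> \<subseteq> E"
    using \<phi> unfolding Cinf_c_def by blast+
  show C1: "has_C1 N \<phi> (\<lambda>i. partial_deriv i \<phi>)" by (rule Ck_1_imp_has_C1[OF Ck])
  have sub: "x \<in> supp N \<phi>" if "x \<in> pts N" "\<phi> x \<noteq> 0" for x
  proof -
    have "{x \<in> pts N. \<phi> x \<noteq> 0} \<subseteq> supp N \<phi>"
      unfolding supp_def topspace_euclid by (rule closure_of_subset) auto
    then show ?thesis using that by blast
  qed
  have "\<exists>C. \<forall>x\<in>supp N \<phi>. \<bar>x i\<bar> \<le> C" if "i < N" for i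
  proof -
    have "continuous_map (euclid N) euclideanreal (\<lambda>x. x i)"
      unfolding euclid_def by (rule continuous_map_product_projection) (use that in simp)
    from image_compactin[OF cs this] have "compact ((\<lambda>x. x i) ` supp N \<phi>)" by simp
    then obtain C where "\<And>y. y \<in> (\<lambda>x. x i) ` supp N \<phi> \<Longrightarrow> \<bar>y\<bar> \<le> C"
      by (meson compact_imp_bounded bounded_real)
    then show ?thesis by blast
  qed
  then obtain C where C: "\<And>i x. i < N \<Longrightarrow> x \<in> supp N \<phi> \<Longrightarrow> \<bar>x i\<bar> \<le> C i"
    by metis
  show "\<exists>r. vanishes_off_cube N r \<phi>"
  proof (intro exI)
    show "vanishes_off_cube N (\<Sum>i<N. \<bar>C i\<bar>) \<phi>"
      unfolding vanishes_off_cube_def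
    proof (intro ballI impI)
      fix x assume x: "x \<in> pts N" "x \<notin> cube N (\<Sum>i<N. \<bar>C i\<bar>)"
      then obtain j where j: "j < N" "(\<Sum>i<N. \<bar>C i\<bar>) < \<bar>x j\<bar>"
        by (auto simp: in_cube_iff not_le)
      have "\<bar>C j\<bar> \<le> (\<Sum>i<N. \<bar>C i\<bar>)"
        using j(1) by (intro member_le_sum) auto
      then have "x \<notin> supp N \<phi>" using C[OF j(1), of x] j(2) by auto
      then show "\<phi> x = 0" using sub x(1) by blast
    qed
  qed
  show "x \<in> pts N \<Longrightarrow> x \<notin> E \<Longrightarrow> \<phi> x = 0" using sub sE by blast
  show "partial_deriv i \<phi> x = 0" if x: "x \<in> pts N" "x \<notin> E" and i: "i < N"
  proof -
    have "openin (euclid N) (pts N - supp N \<phi>)"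
      unfolding supp_def topspace_euclid[symmetric] by (intro openin_diff openin_topspace closedin_closure_of)
    from openin_continuous_map_preimage[OF line_continuous[OF x(1) i] this]
    have "open {t. x(i := t) \<in> pts N - supp N \<phi>}" by simp
    moreover have "x i \<in> {t. x(i := t) \<in> pts N - supp N \<phi>}" using x sE by auto
    ultimately have "\<forall>\<^sub>F t in nhds (x i). t \<in> {t. x(i := t) \<in> pts N - supp N \<phi>}"
      by (rule eventually_nhds_in_open)
    then have "\<forall>\<^sub>F t in nhds (x i). \<phi> (x(i := t)) = 0"
      by eventually_elim (use sub in auto)
    then have "((\<lambda>t. \<phi> (x(i := t))) has_real_derivative 0) (at (x i))"
      by (subst DERIV_cong_ev[OF refl _ refl]) auto
    then show ?thesis unfolding partial_deriv_def by (rule DERIV_imp_deriv)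
  qed
qed

lemma enorm_grad: "enorm N (grad \<phi> x) = gnorm N (\<lambda>i. partial_deriv i \<phi>) x"
  by (simp add: gnorm_def grad_def)

lemma enorm_nonneg [simp]: "0 \<le> enorm N x"
  by (simp add: enorm_def L2_set_nonneg)

lemma borel_measurable_enorm:
  assumes "\<And>i. i < N \<Longrightarrow> (\<lambda>x. f x i) \<in> borel_measurable M"
  shows "(\<lambda>x. enorm N (f x)) \<in> borel_measurable M"
proof -
  have [measurable]: "(\<lambda>x. \<Sum>i<N. (f x i)\<^sup>2) \<in> borel_measurable M"
    by (intro borel_measurable_sum borel_measurable_power) (use assms in auto)
  show ?thesis unfolding enorm_def L2_set_def by measurable
qed

lemma Cinf_c_integrals:
  assumes \<phi>: "\<phi> \<in> Cinf_c N E" and E: "E \<in> sets (lebB N)" and p: "0 < p"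
  shows "integrable (leb_on N E) (\<lambda>x. \<bar>\<phi> x\<bar> powr p)"
    and "(\<integral>x. \<bar>\<phi> x\<bar> powr p \<partial>leb_on N E) = (\<integral>x. \<bar>\<phi> x\<bar> powr p \<partial>lebB N)"
    and "integrable (leb_on N E) (\<lambda>x. enorm N (grad \<phi> x) powr p)"
    and "(\<integral>x. enorm N (grad \<phi> x) powr p \<partial>leb_on N E) = (\<integral>x. gnorm N (\<lambda>i. partial_deriv i \<phi>) x powr p \<partial>lebB N)"
    and "i < N \<Longrightarrow> integrable (leb_on N E) (\<lambda>x. \<bar>partial_deriv i \<phi> x\<bar> powr p)"
proof -
  obtain r where r: "vanishes_off_cube N r \<phi>" using Cinf_cD(2)[OF \<phi>] by blast
  note C1 = Cinf_cD(1)[OF \<phi>]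
  let ?G = "gnorm N (\<lambda>i. partial_deriv i \<phi>)"
  have cG: "continuous_map (euclid N) euclideanreal ?G"
    by (rule continuous_map_gnorm) (rule has_C1D[OF C1])
  have vG: "vanishes_off_cube N r ?G"
    by (rule gnorm_vanishes) (rule has_C1_vanishes[OF C1 r])
  have i1: "integrable (lebB N) (\<lambda>x. \<bar>\<phi> x\<bar> powr p)"
    by (rule integrable_abs_powr[OF has_C1D(1)[OF C1] r p])
  have i2: "integrable (lebB N) (\<lambda>x. ?G x powr p)"
    using integrable_abs_powr[OF cG vG p] by simp
  have i3: "integrable (lebB N) (\<lambda>x. \<bar>partial_deriv i \<phi> x\<bar> powr p)" if "i < N"
    by (rule integrable_abs_powr[OF has_C1D(2)[OF C1 that] has_C1_vanishes[OF C1 r that] p])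
  have z: "\<bar>\<phi> x\<bar> powr p = 0" "?G x powr p = 0" if "x \<in> pts N" "x \<notin> E" for x
    using Cinf_cD(3,4)[OF \<phi> that] by (auto simp: gnorm_def enorm_def L2_set_def)
  show "integrable (leb_on N E) (\<lambda>x. \<bar>\<phi> x\<bar> powr p)" "(\<integral>x. \<bar>\<phi> x\<bar> powr p \<partial>leb_on N E) = (\<integral>x. \<bar>\<phi> x\<bar> powr p \<partial>lebB N)"
    using integral_leb_on_supported[OF borel_measurable_integrable[OF i1] E z(1)] i1 by blast+
  show "integrable (leb_on N E) (\<lambda>x. enorm N (grad \<phi> x) powr p)"
    "(\<integral>x. enorm N (grad \<phi> x) powr p \<partial>leb_on N E) = (\<integral>x. ?G x powr p \<partial>lebB N)"
    unfolding enorm_grad using integral_leb_on_supported[OF borel_measurable_integrable[OF i2] E z(2)] i2 by blast+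
  show "i < N \<Longrightarrow> integrable (leb_on N E) (\<lambda>x. \<bar>partial_deriv i \<phi> x\<bar> powr p)"
    using integral_leb_on_supported(2)[OF borel_measurable_integrable[OF i3] E] i3 Cinf_cD(4)[OF \<phi>] by simp
qed

lemma powr_integral_split:
  fixes f g h :: "'a \<Rightarrow> real"
  assumes p: "1 < p" and f: "f \<in> borel_measurable M" and le: "\<And>x. x \<in> space M \<Longrightarrow> \<bar>f x\<bar> \<le> \<bar>g x\<bar> + \<bar>h x\<bar>"
    and g: "integrable M (\<lambda>x. \<bar>g x\<bar> powr p)" and h: "integrable M (\<lambda>x. \<bar>h x\<bar> powr p)"
  shows "integrable M (\<lambda>x. \<bar>f x\<bar> powr p)"
    and "0 < s \<Longrightarrow> s < 1 \<Longrightarrow> (\<integral>x. \<bar>f x\<bar> powr p \<partial>M)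
      \<le> s powr (1 - p) * (\<integral>x. \<bar>g x\<bar> powr p \<partial>M) + (1 - s) powr (1 - p) * (\<integral>x. \<bar>h x\<bar> powr p \<partial>M)"
proof -
  have pt: "\<bar>f x\<bar> powr p \<le> s powr (1 - p) * \<bar>g x\<bar> powr p + (1 - s) powr (1 - p) * \<bar>h x\<bar> powr p"
    if "0 < s" "s < 1" "x \<in> space M" for s x
  proof -
    have "\<bar>f x\<bar> powr p \<le> (\<bar>g x\<bar> + \<bar>h x\<bar>) powr p"
      using le[OF that(3)] p by (intro powr_mono2) auto
    also have "\<dots> \<le> s powr (1 - p) * \<bar>g x\<bar> powr p + (1 - s) powr (1 - p) * \<bar>h x\<bar> powr p"
      by (rule powr_sum_le[OF p that(1,2)]) auto
    finally show ?thesis .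
  qed
  show i: "integrable M (\<lambda>x. \<bar>f x\<bar> powr p)"
  proof (rule Bochner_Integration.integrable_bound)
    show "integrable M (\<lambda>x. (1/2) powr (1 - p) * \<bar>g x\<bar> powr p + (1 - 1/2) powr (1 - p) * \<bar>h x\<bar> powr p)"
      using g h by auto
    show "AE x in M. norm (\<bar>f x\<bar> powr p) \<le> norm ((1/2) powr (1 - p) * \<bar>g x\<bar> powr p + (1 - 1/2) powr (1 - p) * \<bar>h x\<bar> powr p)"
      using pt[of "1/2"] by (intro AE_I2) (auto simp: abs_of_nonneg)
  qed (use f in measurable)
  assume s: "0 < s" "s < 1"
  have "(\<integral>x. \<bar>f x\<bar> powr p \<partial>M) \<le> (\<integral>x. s powr (1 - p) * \<bar>g x\<bar> powr p + (1 - s) powr (1 - p) * \<bar>h x\<bar> powr p \<partial>M)"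
    by (rule integral_mono[OF i]) (use g h pt[OF s] in auto)
  also have "\<dots> = s powr (1 - p) * (\<integral>x. \<bar>g x\<bar> powr p \<partial>M) + (1 - s) powr (1 - p) * (\<integral>x. \<bar>h x\<bar> powr p \<partial>M)"
    using g h by simp
  finally show "(\<integral>x. \<bar>f x\<bar> powr p \<partial>M)
      \<le> s powr (1 - p) * (\<integral>x. \<bar>g x\<bar> powr p \<partial>M) + (1 - s) powr (1 - p) * (\<integral>x. \<bar>h x\<bar> powr p \<partial>M)" .
qed

lemma enorm_powr_le:
  assumes "0 < p"
  shows "enorm N x powr p \<le> real N powr p * (\<Sum>i<N. \<bar>x i\<bar> powr p)"
proof (cases "N = 0")
  case True
  then show ?thesis by (simp add: enorm_def)
next
  case False
  define m where "m = Max ((\<lambda>i. \<bar>x i\<bar>) ` {..<N})"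
  have "m \<in> (\<lambda>i. \<bar>x i\<bar>) ` {..<N}" unfolding m_def by (rule Max_in) (use False in auto)
  then obtain j where j: "j < N" "m = \<bar>x j\<bar>" by auto
  have le: "\<bar>x i\<bar> \<le> m" if "i < N" for i unfolding m_def by (rule Max_ge) (use that in auto)
  have "enorm N x \<le> (\<Sum>i<N. \<bar>x i\<bar>)" unfolding enorm_def by (rule L2_set_le_sum_abs)
  also have "\<dots> \<le> (\<Sum>i<N. m)" using le by (intro sum_mono) auto
  finally have "enorm N x \<le> real N * m" by simp
  then have "enorm N x powr p \<le> (real N * m) powr p"
    using assms by (intro powr_mono2) auto
  also have "\<dots> = real N powr p * m powr p" by (rule powr_mult)
  also have "m powr p \<le> (\<Sum>i<N. \<bar>x i\<bar> powr p)"
    unfolding j(2) using j(1) by (intro member_le_sum) auto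
  finally show ?thesis by (simp add: mult_left_mono)
qed

lemma Lp_norm_less_imp:
  assumes p: "1 < p" and "Lp_norm N p E f < \<epsilon>"
  shows "(\<integral>x. \<bar>f x\<bar> powr p \<partial>leb_on N E) \<le> \<epsilon> powr p"
proof -
  define I where "I = (\<integral>x. \<bar>f x\<bar> powr p \<partial>leb_on N E)"
  have I: "0 \<le> I" unfolding I_def by (rule integral_nonneg_AE) auto
  have "I powr (1 / p) \<le> \<epsilon>" using assms(2) by (simp add: Lp_norm_def I_def)
  then have "(I powr (1 / p)) powr p \<le> \<epsilon> powr p"
    using p by (intro powr_mono2) auto
  moreover have "(I powr (1 / p)) powr p = I" using p I by (simp add: powr_powr)
  ultimately show ?thesis by (simp add: I_def)
qed

text \<open>
  Approximate \<open>(u, g)\<close> by a smooth function up to \<open>\<epsilon>\<close> and split with a parameter \<open>s < 1\<close>. First \<open>\<epsilon>\<close> tends to zero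
  and then \<open>s\<close> to one.
\<close>

lemma W1p_0_lower_bound:
  assumes p: "1 < p" and E: "E \<in> sets (lebB N)"
    and K: "0 \<le> K" "\<And>\<phi>. \<phi> \<in> Cinf_c N E \<Longrightarrow> K * (\<integral>x. \<bar>\<phi> x\<bar> powr p \<partial>leb_on N E) \<le> (\<integral>x. enorm N (grad \<phi> x) powr p \<partial>leb_on N E)"
    and ug: "(u, g) \<in> W1p_0 N p E" "Lp_norm N p E u = 1"
  shows "K \<le> (\<integral>x. enorm N (g x) powr p \<partial>leb_on N E)"
proof -
  let ?M = "leb_on N E"
  have u: "u \<in> borel_measurable ?M" "integrable ?M (\<lambda>x. \<bar>u x\<bar> powr p)"
    and g: "\<And>i. i < N \<Longrightarrow> (\<lambda>x. g x i) \<in> borel_measurable ?M" "\<And>i. i < N \<Longrightarrow> integrable ?M (\<lambda>x. \<bar>g x i\<bar> powr p)"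
    using ug(1) by (auto simp: W1p_0_def W1p_def Lp_def)
  have u1: "(\<integral>x. \<bar>u x\<bar> powr p \<partial>?M) = 1"
  proof -
    have "(\<integral>x. \<bar>u x\<bar> powr p \<partial>?M) powr (1 / p) = 1" using ug(2) by (simp add: Lp_norm_def)
    moreover have "0 \<le> (\<integral>x. \<bar>u x\<bar> powr p \<partial>?M)" by (rule integral_nonneg_AE) auto
    moreover have "t = 1" if "t powr (1 / p) = 1" "0 \<le> t" for t :: real
    proof -
      have "t = (t powr (1 / p)) powr p" using p that(2) by (simp add: powr_powr)
      then show ?thesis using that(1) by simp
    qed
    ultimately show ?thesis by blast
  qed
  have mg: "(\<lambda>x. enorm N (g x)) \<in> borel_measurable ?M"
    by (rule borel_measurable_enorm) (rule g(1))
  have ig: "integrable ?M (\<lambda>x. \<bar>enorm N (g x)\<bar> powr p)"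
  proof (rule Bochner_Integration.integrable_bound)
    show "integrable ?M (\<lambda>x. real N powr p * (\<Sum>i<N. \<bar>g x i\<bar> powr p))"
      using g(2) by auto
    show "AE x in ?M. norm (\<bar>enorm N (g x)\<bar> powr p) \<le> norm (real N powr p * (\<Sum>i<N. \<bar>g x i\<bar> powr p))"
      using enorm_powr_le[of p N] p by (intro AE_I2) (auto simp: abs_of_nonneg sum_nonneg)
  qed (use mg in measurable)
  define \<Gamma> where "\<Gamma> = (\<integral>x. enorm N (g x) powr p \<partial>?M)"
  have main: "K * (1 - (1 - s) powr (1 - p) * \<epsilon> powr p)
      \<le> s powr (1 - p) * (s powr (1 - p) * \<Gamma> + (1 - s) powr (1 - p) * \<epsilon> powr p)"
    if s: "0 < s" "s < 1" and \<epsilon>: "0 < \<epsilon>" for s \<epsilon>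
  proof -
    obtain \<phi> where \<phi>: "\<phi> \<in> Cinf_c N E"
      "Lp_norm N p E (\<lambda>x. u x - \<phi> x) + Lp_norm N p E (\<lambda>x. enorm N (\<lambda>i. g x i - grad \<phi> x i)) < \<epsilon>"
      using ug(1) \<epsilon> by (auto simp: W1p_0_def)
    have "0 \<le> Lp_norm N p E (\<lambda>x. u x - \<phi> x)" "0 \<le> Lp_norm N p E (\<lambda>x. enorm N (\<lambda>i. g x i - grad \<phi> x i))"
      by (auto simp: Lp_norm_def)
    with \<phi>(2) have "Lp_norm N p E (\<lambda>x. u x - \<phi> x) < \<epsilon>" "Lp_norm N p E (\<lambda>x. enorm N (\<lambda>i. g x i - grad \<phi> x i)) < \<epsilon>"
      by linarith+
    note close = this[THEN Lp_norm_less_imp[OF p]]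
    note C1 = Cinf_cD(1)[OF \<phi>(1)]
    have m\<phi>: "\<phi> \<in> borel_measurable ?M" by (rule measurable_leb_on[OF has_C1D(4)[OF C1]])
    have md: "(\<lambda>x. grad \<phi> x i) \<in> borel_measurable ?M" if "i < N" for i
      using measurable_leb_on[OF has_C1D(5)[OF C1 that]] by (simp add: grad_def)
    have p0: "0 < p" using p by simp
    note I\<phi> = Cinf_c_integrals[OF \<phi>(1) E p0]
    have iu: "integrable ?M (\<lambda>x. \<bar>u x - \<phi> x\<bar> powr p)"
      by (rule powr_integral_split(1)[OF p _ _ u(2) I\<phi>(1)]) (use u(1) m\<phi> in auto)
    have tri: "enorm N (\<lambda>i. a i - b i) \<le> enorm N a + enorm N b" for a b
      unfolding enorm_def using L2_set_triangle_ineq[of a "\<lambda>i. - b i" "{..<N}"] by (simp add: L2_set_def)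
    have md': "(\<lambda>x. enorm N (\<lambda>i. g x i - grad \<phi> x i)) \<in> borel_measurable ?M"
      by (rule borel_measurable_enorm) (intro borel_measurable_diff g(1) md)
    have mgr: "(\<lambda>x. enorm N (grad \<phi> x)) \<in> borel_measurable ?M"
      by (rule borel_measurable_enorm) (rule md)
    have igr: "integrable ?M (\<lambda>x. \<bar>enorm N (grad \<phi> x)\<bar> powr p)" using I\<phi>(3) by simp
    have id: "integrable ?M (\<lambda>x. \<bar>enorm N (\<lambda>i. g x i - grad \<phi> x i)\<bar> powr p)"
      by (rule powr_integral_split(1)[OF p md' _ ig igr]) (use tri in auto)
    have "1 \<le> s powr (1 - p) * (\<integral>x. \<bar>\<phi> x\<bar> powr p \<partial>?M) + (1 - s) powr (1 - p) * (\<integral>x. \<bar>u x - \<phi> x\<bar> powr p \<partial>?M)"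
      by (subst u1[symmetric], rule powr_integral_split(2)[OF p u(1) _ I\<phi>(1) iu s]) auto
    also have "\<dots> \<le> s powr (1 - p) * (\<integral>x. \<bar>\<phi> x\<bar> powr p \<partial>?M) + (1 - s) powr (1 - p) * \<epsilon> powr p"
      by (intro add_left_mono mult_left_mono close) auto
    finally have "K * (1 - (1 - s) powr (1 - p) * \<epsilon> powr p) \<le> K * (s powr (1 - p) * (\<integral>x. \<bar>\<phi> x\<bar> powr p \<partial>?M))"
      using K(1) by (intro mult_left_mono) auto
    also have "\<dots> = s powr (1 - p) * (K * (\<integral>x. \<bar>\<phi> x\<bar> powr p \<partial>?M))" by simp
    also have "\<dots> \<le> s powr (1 - p) * (\<integral>x. enorm N (grad \<phi> x) powr p \<partial>?M)"
      by (intro mult_left_mono K(2) \<phi>(1)) simp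
    also have "\<dots> \<le> s powr (1 - p) * (s powr (1 - p) * \<Gamma> + (1 - s) powr (1 - p) * (\<integral>x. \<bar>enorm N (\<lambda>i. g x i - grad \<phi> x i)\<bar> powr p \<partial>?M))"
    proof (rule mult_left_mono)
      have tri': "enorm N (grad \<phi> x) \<le> enorm N (g x) + enorm N (\<lambda>i. g x i - grad \<phi> x i)" for x
        using tri[of "g x" "\<lambda>i. g x i - grad \<phi> x i"] by simp
      have "(\<integral>x. \<bar>enorm N (grad \<phi> x)\<bar> powr p \<partial>?M) \<le> s powr (1 - p) * (\<integral>x. \<bar>enorm N (g x)\<bar> powr p \<partial>?M) + (1 - s) powr (1 - p) * (\<integral>x. \<bar>enorm N (\<lambda>i. g x i - grad \<phi> x i)\<bar> powr p \<partial>?M)"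
        by (rule powr_integral_split(2)[OF p mgr _ ig id s]) (use tri' in auto)
      then show "(\<integral>x. enorm N (grad \<phi> x) powr p \<partial>?M) \<le> s powr (1 - p) * \<Gamma> + (1 - s) powr (1 - p) * (\<integral>x. \<bar>enorm N (\<lambda>i. g x i - grad \<phi> x i)\<bar> powr p \<partial>?M)"
        by (simp add: \<Gamma>_def)
    qed simp
    also have "\<dots> \<le> s powr (1 - p) * (s powr (1 - p) * \<Gamma> + (1 - s) powr (1 - p) * \<epsilon> powr p)"
      by (intro mult_left_mono add_left_mono close) auto
    finally show ?thesis .
  qed
  have lim: "((\<lambda>\<epsilon>::real. \<epsilon> powr p) \<longlongrightarrow> 0) (at_right 0)"
  proof -
    have "((\<lambda>\<epsilon>::real. \<bar>\<epsilon>\<bar> powr p) \<longlongrightarrow> \<bar>0\<bar> powr p) (at_right 0)"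
      by (rule tendsto_powr'[OF tendsto_rabs[OF tendsto_ident_at] tendsto_const]) (use p in auto)
    moreover have "\<forall>\<^sub>F \<epsilon> in at_right 0. \<bar>\<epsilon>\<bar> powr p = \<epsilon> powr p"
      by (auto simp: eventually_at_right_field intro: exI[of _ 1])
    ultimately show ?thesis by (simp add: tendsto_cong)
  qed
  have main': "K \<le> s powr (1 - p) * (s powr (1 - p) * \<Gamma>)" if s: "0 < s" "s < 1" for s
  proof (rule tendsto_le)
    show "((\<lambda>\<epsilon>. K * (1 - (1 - s) powr (1 - p) * \<epsilon> powr p)) \<longlongrightarrow> K) (at_right 0)"
      using tendsto_mult[OF tendsto_const[of K] tendsto_diff[OF tendsto_const[of 1] tendsto_mult[OF tendsto_const[of "(1 - s) powr (1 - p)"] lim]]] by simp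
    show "((\<lambda>\<epsilon>. s powr (1 - p) * (s powr (1 - p) * \<Gamma> + (1 - s) powr (1 - p) * \<epsilon> powr p)) \<longlongrightarrow> s powr (1 - p) * (s powr (1 - p) * \<Gamma>)) (at_right 0)"
      using tendsto_mult[OF tendsto_const[of "s powr (1 - p)"] tendsto_add[OF tendsto_const[of "s powr (1 - p) * \<Gamma>"] tendsto_mult[OF tendsto_const[of "(1 - s) powr (1 - p)"] lim]]] by simp
    show "\<forall>\<^sub>F \<epsilon> in at_right 0. K * (1 - (1 - s) powr (1 - p) * \<epsilon> powr p) \<le> s powr (1 - p) * (s powr (1 - p) * \<Gamma> + (1 - s) powr (1 - p) * \<epsilon> powr p)"
      using main[OF s] by (auto simp: eventually_at_right_field intro: exI[of _ 1])
  qed simp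
  have "((\<lambda>s::real. s powr (1 - p) * (s powr (1 - p) * \<Gamma>)) \<longlongrightarrow> 1 powr (1 - p) * (1 powr (1 - p) * \<Gamma>)) (at_left 1)"
    by (intro tendsto_intros) auto
  then have "K \<le> 1 powr (1 - p) * (1 powr (1 - p) * \<Gamma>)"
  proof (rule tendsto_lowerbound)
    show "\<forall>\<^sub>F s in at_left 1. K \<le> s powr (1 - p) * (s powr (1 - p) * \<Gamma>)"
      unfolding eventually_at_left_field using main' by (intro exI[of _ 0]) auto
  qed simp
  then show ?thesis by (simp add: \<Gamma>_def)
qed

section \<open>Vector fields and test functions\<close>

lemma compactin_supp:
  assumes "vanishes_off_cube N r f"
  shows "compactin (euclid N) (supp N f)"
proof (rule closed_compactin[OF compactin_cube])
  have H: "Hausdorff_space (euclid N)"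
    unfolding euclid_def by (simp add: Hausdorff_space_product_topology)
  show "supp N f \<subseteq> cube N r"
    unfolding supp_def
    by (rule closure_of_minimal[OF _ compactin_imp_closedin[OF H compactin_cube]])
       (use assms in \<open>auto simp: vanishes_off_cube_def\<close>)
  show "closedin (euclid N) (supp N f)"
    unfolding supp_def by (rule closedin_closure_of)
qed

lemma has_C1_coordinate:
  assumes "i < N"
  shows "has_C1 N (\<lambda>x. x i * c) (\<lambda>j x. if j = i then c else 0)"
  unfolding has_C1_def
proof (intro conjI allI impI ballI)
  show "continuous_map (euclid N) euclideanreal (\<lambda>x. x i * c)"
    unfolding euclid_def using assms by (intro continuous_intros) auto
  show "((\<lambda>t. (x(j := t)) i * c) has_real_derivative (if j = i then c else 0)) (at (x j))"
    for x :: point and j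
    by (cases "j = i") (auto intro!: derivative_eq_intros)
qed auto

lemma sqd_origin: "sqd N (\<lambda>_. 0) x = (enorm N x)\<^sup>2"
  by (simp add: sqd_def enorm_def L2_set_def sum_nonneg)

text \<open>
  Equal to one for \<open>s \<le> b\<close> and to zero as soon as the square of \<open>s - b\<close> reaches \<open>c\<close>.
\<close>

definition plateau :: "real \<Rightarrow> real \<Rightarrow> real \<Rightarrow> real" where
  "plateau b c s = psq (1 - psq (s - b) / c)"

lemma DERIV_plateau:
  "(plateau b c has_real_derivative
     2 * max 0 (1 - psq (s - b) / c) * (- (2 * max 0 (s - b)) / c)) (at s)"
proof -
  have "((\<lambda>s. psq (s - b)) has_real_derivative 2 * max 0 (s - b) * 1) (at s)"
    by (rule DERIV_chain2[OF DERIV_psq]) (auto intro!: derivative_eq_intros)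
  from DERIV_diff[OF DERIV_const[of 1] DERIV_cdivide[OF this, of c]]
  have "((\<lambda>s. 1 - psq (s - b) / c) has_real_derivative - (2 * max 0 (s - b)) / c) (at s)"
    by simp
  from DERIV_chain2[OF DERIV_psq this] show ?thesis
    by (simp only: plateau_def[abs_def])
qed

lemma continuous_psq: "continuous_on S (\<lambda>x. psq (f x))" if "continuous_on S f"
  unfolding psq_def using that by (intro continuous_intros)

text \<open>
  Test the perimeter with \<open>t x / R\<close> on the ball of radius \<open>R\<close>, cut off radially between the radii \<open>R\<close> and \<open>R / t\<close>.
  The factor \<open>t < 1\<close> leaves room for the cut-off: up to the radius \<open>R / t\<close> the field \<open>t x / R\<close> has length at most one.
\<close>

lemma radial_field_perimeter:
  assumes R: "0 < R" and t: "0 < t" "t < 1"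
    and A: "A \<in> sets (leb N)" "\<And>x. x \<in> A \<Longrightarrow> enorm N x \<le> R" and fin: "emeasure (leb N) A < \<infinity>"
  shows "ennreal (t * (real N / R) * measure (leb N) A) \<le> perimeter N A"
proof -
  define R' where "R' = R / t"
  have R': "R < R'" using R t by (simp add: R'_def field_simps)
  \<comment> \<open>The cut-off, as a function of \<open>|x|\<^sup>2\<close>, reaches zero when \<open>|x|\<close> reaches \<open>R'\<close>.\<close>
  define c where "c = (R'\<^sup>2 - R\<^sup>2)\<^sup>2"
  have d0: "0 < R'\<^sup>2 - R\<^sup>2" using R R' by (simp add: power_strict_mono)
  then have c: "0 < c" by (simp add: c_def)
  define \<eta> where "\<eta> = plateau (R\<^sup>2) c"
  have \<eta>01: "0 \<le> \<eta> s" "\<eta> s \<le> 1" for s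
  proof -
    have "max 0 (1 - psq (s - R\<^sup>2) / c) \<le> 1" using c by simp
    then have "(max 0 (1 - psq (s - R\<^sup>2) / c))\<^sup>2 \<le> 1\<^sup>2" by (intro power_mono) auto
    then show "0 \<le> \<eta> s" "\<eta> s \<le> 1"
      by (simp_all add: \<eta>_def plateau_def psq_def[of "1 - psq (s - R\<^sup>2) / c"])
  qed
  have \<eta>out: "\<eta> s = 0" if "R'\<^sup>2 \<le> s" for s
  proof -
    have "c \<le> psq (s - R\<^sup>2)"
      unfolding psq_def c_def using that d0 by (intro power_mono) auto
    then have "1 \<le> psq (s - R\<^sup>2) / c" using c by simp
    then show ?thesis by (simp add: \<eta>_def plateau_def psq_def[of "1 - psq (s - R\<^sup>2) / c"] max_absorb1)
  qed
  have \<eta>in: "\<eta> s = 1" if "s \<le> R\<^sup>2" for s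
    using that by (simp add: \<eta>_def plateau_def psq_def max_absorb1)
  define \<eta>' where "\<eta>' s = 2 * max 0 (1 - psq (s - R\<^sup>2) / c) * (- (2 * max 0 (s - R\<^sup>2)) / c)" for s
  have \<eta>'in: "\<eta>' s = 0" if "s \<le> R\<^sup>2" for s
    using that by (simp add: \<eta>'_def max_absorb1)
  have chiC: "has_C1 N (\<lambda>x. \<eta> (sqd N (\<lambda>_. 0) x)) (\<lambda>i x. \<eta>' (sqd N (\<lambda>_. 0) x) * (2 * (x i - 0)))"
  proof (rule has_C1_chain[OF has_C1_sqd, where S=UNIV])
    show "(\<eta> has_real_derivative \<eta>' t) (at t)" for t
      unfolding \<eta>_def \<eta>'_def by (rule DERIV_plateau)
    show "continuous_on UNIV \<eta>'"
      unfolding \<eta>'_def[abs_def] divide_inverse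
      by (intro continuous_intros continuous_psq)
  qed auto
  define \<kappa> where "\<kappa> = 1 / R'"
  define \<phi> where "\<phi> x i = x i * \<kappa> * \<eta> (sqd N (\<lambda>_. 0) x)" for x :: point and i :: nat
  define D where "D i j x = (if j = i then \<kappa> else 0) * \<eta> (sqd N (\<lambda>_. 0) x)
      + x i * \<kappa> * (\<eta>' (sqd N (\<lambda>_. 0) x) * (2 * (x j - 0)))" for i j :: nat and x :: point
  have \<phi>C: "has_C1 N (\<lambda>x. \<phi> x i) (D i)" if "i < N" for i
    unfolding \<phi>_def[abs_def] D_def[abs_def]
    by (rule has_C1_mult[OF has_C1_coordinate[OF that] chiC])
  have \<phi>v: "vanishes_off_cube N R' (\<lambda>x. \<phi> x i)" for i
    unfolding vanishes_off_cube_def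
  proof (intro ballI impI)
    fix x assume "x \<in> pts N" "x \<notin> cube N R'"
    then obtain j where j: "j < N" "R' < \<bar>x j\<bar>" by (auto simp: in_cube_iff not_le)
    have "R'\<^sup>2 \<le> \<bar>x j\<bar>\<^sup>2" using j R R' by (intro power_mono) auto
    also have "\<dots> \<le> sqd N (\<lambda>_. 0) x" using sqd_coord[OF j(1), of x "\<lambda>_. 0"] by simp
    finally show "\<phi> x i = 0" by (simp add: \<phi>_def \<eta>out)
  qed
  have fields: "\<phi> \<in> C1_c_fields N"
    unfolding C1_c_fields_def using has_C1_imp_Ck_1[OF \<phi>C] compactin_supp[OF \<phi>v] by blast
  have unit: "enorm N (\<phi> x) \<le> 1" for x
  proof -
    have "enorm N (\<phi> x) = \<bar>\<kappa> * \<eta> (sqd N (\<lambda>_. 0) x)\<bar> * enorm N x"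
    proof -
      have "\<phi> x = (\<lambda>i. \<kappa> * \<eta> (sqd N (\<lambda>_. 0) x) * x i)" by (auto simp: \<phi>_def)
      then show ?thesis
        using gnorm_scale[of N "\<lambda>x. \<kappa> * \<eta> (sqd N (\<lambda>_. 0) x)" "\<lambda>i x. x i" x] by (simp add: gnorm_def)
    qed
    also have "\<dots> \<le> 1"
    proof (cases "R' \<le> enorm N x")
      case True
      then have "R'\<^sup>2 \<le> sqd N (\<lambda>_. 0) x" unfolding sqd_origin using R R' by (intro power_mono) auto
      then show ?thesis using \<eta>out by simp
    next
      case False
      have "\<bar>\<kappa> * \<eta> (sqd N (\<lambda>_. 0) x)\<bar> \<le> \<kappa>"
        using \<eta>01[of "sqd N (\<lambda>_. 0) x"] R R' by (simp add: \<kappa>_def abs_mult divide_le_cancel)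
      then have "\<bar>\<kappa> * \<eta> (sqd N (\<lambda>_. 0) x)\<bar> * enorm N x \<le> \<kappa> * R'"
        using False R R' by (intro mult_mono) (auto simp: \<kappa>_def)
      then show ?thesis using R R' by (simp add: \<kappa>_def)
    qed
    finally show ?thesis .
  qed
  have Asp: "A \<subseteq> pts N" using sets.sets_into_space[OF A(1)] by (simp add: leb_def)
  have div: "divergence N \<phi> x = real N * \<kappa>" if "x \<in> A" for x
  proof -
    have s: "sqd N (\<lambda>_. 0) x \<le> R\<^sup>2"
      unfolding sqd_origin using A(2)[OF that] by (intro power_mono) auto
    have "divergence N \<phi> x = (\<Sum>i<N. D i i x)"
      unfolding divergence_def using partial_deriv_eq[OF \<phi>C] Asp that by (intro sum.cong) auto
    also have "\<dots> = (\<Sum>i<N. \<kappa>)"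
      using s by (intro sum.cong) (auto simp: D_def \<eta>in \<eta>'in)
    finally show ?thesis by simp
  qed
  have sp: "space (leb_on N A) = A"
    using Asp by (auto simp: leb_on_def space_restrict_space leb_def)
  have "(\<integral>x. divergence N \<phi> x \<partial>leb_on N A) = (\<integral>x. real N * \<kappa> \<partial>leb_on N A)"
    by (intro Bochner_Integration.integral_cong) (auto simp: sp div)
  also have "\<dots> = real N * \<kappa> * measure (leb_on N A) A" by (simp add: sp)
  also have "measure (leb_on N A) A = measure (leb N) A"
    unfolding leb_on_def using A(1) Asp by (subst measure_restrict_space) (auto simp: leb_def)
  finally have I: "(\<integral>x. divergence N \<phi> x \<partial>leb_on N A) = t * (real N / R) * measure (leb N) A"
    by (simp add: \<kappa>_def R'_def)
  show ?thesis
    unfolding I[symmetric] perimeter_def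
    by (rule SUP_upper) (use fields unit in auto)
qed

lemma cheeger_bound_of_bounded:
  assumes N: "1 \<le> N" and R: "0 < R" "\<And>x. x \<in> E \<Longrightarrow> enorm N x \<le> R"
  shows "cheeger_bound N E (real N / R)"
    and "A \<in> sets (leb N) \<Longrightarrow> A \<subseteq> E \<Longrightarrow> emeasure (leb N) A < \<infinity>"
proof -
  show fin: "emeasure (leb N) A < \<infinity>" if "A \<in> sets (leb N)" "A \<subseteq> E" for A
  proof -
    have "A \<subseteq> cube N R"
    proof
      fix x assume x: "x \<in> A"
      have xp: "x \<in> pts N" using sets.sets_into_space[OF that(1)] x by (auto simp: leb_def)
      have "\<bar>x j\<bar> \<le> R" if "j < N" for j
        using gnorm_component[OF that, of "\<lambda>i x. x i" x] R(2)[of x] x \<open>A \<subseteq> E\<close>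
        by (auto simp: gnorm_def)
      then show "x \<in> cube N R" using in_cube_iff[OF xp] by blast
    qed
    then have "emeasure (leb N) A \<le> emeasure (leb N) (cube N R)"
      by (rule emeasure_mono) (rule sets_leb[OF cube_sets])
    also have "\<dots> < \<infinity>" using R by (simp add: emeasure_leb emeasure_cube)
    finally show ?thesis .
  qed
  have "ennreal (real N / R) * emeasure (leb N) A \<le> perimeter N A"
    if A: "A \<in> sets (leb N)" "A \<subseteq> E" for A
  proof (cases "perimeter N A = \<infinity>")
    case False
    define q where "q = enn2real (perimeter N A)"
    have q: "perimeter N A = ennreal q" "0 \<le> q" using False by (auto simp: q_def less_top)
    have eA: "emeasure (leb N) A = ennreal (measure (leb N) A)"
      by (rule emeasure_eq_ennreal_measure) (use fin[OF A] in auto)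
    have "real N / R * measure (leb N) A \<le> q"
    proof (rule field_le_mult_one_interval)
      fix t :: real assume t: "0 < t" "t < 1"
      have "ennreal (t * (real N / R) * measure (leb N) A) \<le> ennreal q"
        unfolding q(1)[symmetric]
        by (rule radial_field_perimeter[OF R(1) t A(1) _ fin[OF A]]) (use R(2) A in blast)
      then show "t * (real N / R * measure (leb N) A) \<le> q"
        using q(2) by (simp add: ennreal_le_iff mult.assoc)
    qed
    then show ?thesis
      unfolding q(1) eA using R by (simp add: ennreal_mult'[symmetric] ennreal_leI)
  qed simp
  then show "cheeger_bound N E (real N / R)"
    unfolding cheeger_bound_def using R by auto
qed

lemma open_contains_ball:
  assumes "openin (euclid N) E" "z \<in> E"
  obtains r where "0 < r" "\<And>x. x \<in> pts N \<Longrightarrow> sqd N z x \<le> r\<^sup>2 \<Longrightarrow> x \<in> E"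
proof -
  obtain U where U: "\<And>i. i < N \<Longrightarrow> openin euclideanreal (U i)" "z \<in> PiE {..<N} U" "PiE {..<N} U \<subseteq> E"
    using assms unfolding euclid_def openin_product_topology_alt by (metis lessThan_iff)
  have "\<exists>e>0. \<forall>y. \<bar>y - z i\<bar> < e \<longrightarrow> y \<in> U i" if "i < N" for i
    using U(1)[OF that] U(2) that by (auto simp: open_real PiE_iff)
  then obtain e where e: "\<And>i. i < N \<Longrightarrow> 0 < e i" "\<And>i y. i < N \<Longrightarrow> \<bar>y - z i\<bar> < e i \<Longrightarrow> y \<in> U i"
    by metis
  \<comment> \<open>The element 1 keeps the set nonempty for \<open>N = 0\<close>, and halving makes the inequalities strict.\<close>
  define r where "r = Min (insert 1 (e ` {..<N})) / 2"
  have m: "0 < Min (insert 1 (e ` {..<N}))" using e(1) by (subst Min_gr_iff) auto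
  have r: "0 < r" using m by (simp add: r_def)
  have re: "r < e i" if "i < N" for i
  proof -
    have "Min (insert 1 (e ` {..<N})) \<le> e i" by (rule Min_le) (use that in auto)
    then show ?thesis using m e(1)[OF that] unfolding r_def by linarith
  qed
  show ?thesis
  proof (rule that[OF r])
    fix x assume x: "x \<in> pts N" "sqd N z x \<le> r\<^sup>2"
    have "x i \<in> U i" if "i < N" for i
    proof -
      have "\<bar>x i - z i\<bar>\<^sup>2 \<le> r\<^sup>2" using sqd_coord[OF that, of x z] x(2) by simp
      then have "\<bar>x i - z i\<bar> \<le> r" using r by (meson abs_ge_zero less_imp_le power2_le_imp_le)
      then show ?thesis using e(2)[OF that, of "x i"] re[OF that] by simp
    qed
    then have "x \<in> PiE {..<N} U" using x(1) by (auto simp: PiE_iff)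
    then show "x \<in> E" using U(3) by blast
  qed
qed

text \<open>
  Differentiability of order \<open>k\<close> through the total function \<open>deriv\<close>, matching the recursion of \<open>Ck\<close>. On open
  sets it is local, so functions can be glued.
\<close>

primrec smooth_on :: "nat \<Rightarrow> real set \<Rightarrow> (real \<Rightarrow> real) \<Rightarrow> bool" where
  "smooth_on 0 U g \<longleftrightarrow> continuous_on U g"
| "smooth_on (Suc k) U g \<longleftrightarrow> (\<forall>x\<in>U. g differentiable at x) \<and> smooth_on k U (deriv g)"

lemma smooth_on_cong:
  assumes "open U" "\<And>x. x \<in> U \<Longrightarrow> f x = g x" "smooth_on k U f"
  shows "smooth_on k U g"
  using assms(2,3)
proof (induction k arbitrary: f g)
  case 0
  then show ?case by (simp cong: continuous_on_cong)
next
  case (Suc k)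
  have ev: "\<forall>\<^sub>F y in nhds x. f y = g y" if "x \<in> U" for x
    using eventually_nhds_in_open[OF assms(1) that] Suc.prems(1) by (auto elim: eventually_mono)
  have d: "g differentiable at x" if xU: "x \<in> U" for x
  proof -
    obtain y where "(f has_real_derivative y) (at x)"
      using Suc.prems(2) xU by (auto simp: real_differentiable_def)
    then have "(g has_real_derivative y) (at x)"
      using DERIV_cong_ev[OF refl ev[OF xU] refl] by blast
    then show ?thesis by (auto simp: real_differentiable_def)
  qed
  have "deriv f x = deriv g x" if "x \<in> U" for x
    by (rule deriv_cong_ev[OF ev[OF that] refl])
  then have "smooth_on k U (deriv g)" using Suc.IH[of "deriv f" "deriv g"] Suc.prems(2) by simp
  then show ?case using d by simp
qed

lemma smooth_on_SucI:
  assumes "open U" "\<And>x. x \<in> U \<Longrightarrow> (g has_real_derivative g' x) (at x)" "smooth_on k U g'"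
  shows "smooth_on (Suc k) U g"
proof -
  have "smooth_on k U (deriv g)"
    by (rule smooth_on_cong[OF assms(1) _ assms(3)]) (use assms(2) DERIV_imp_deriv in force)
  then show ?thesis using assms(2) by (auto simp: real_differentiable_def)
qed

lemma smooth_on_SucD:
  assumes "smooth_on (Suc k) U g"
  shows "x \<in> U \<Longrightarrow> (g has_real_derivative deriv g x) (at x)" "smooth_on k U (deriv g)"
  using assms by (auto simp: DERIV_deriv_iff_real_differentiable)

lemma smooth_on_mono: "smooth_on (Suc k) U g \<Longrightarrow> smooth_on k U g"
proof (induction k arbitrary: g)
  case 0
  then show ?case
    using smooth_on_SucD(1)[OF 0] by (auto intro!: continuous_at_imp_continuous_on DERIV_isCont)
next
  case (Suc k)
  show ?case using Suc.prems Suc.IH[of "deriv g"] by auto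
qed

lemma smooth_on_const: "open U \<Longrightarrow> smooth_on k U (\<lambda>x. c)"
proof (induction k arbitrary: c)
  case (Suc k)
  show ?case by (rule smooth_on_SucI[OF Suc.prems _ Suc.IH[OF Suc.prems, of 0]]) auto
qed auto

lemma smooth_on_ident: "open U \<Longrightarrow> smooth_on k U (\<lambda>x. x)"
proof (induction k)
  case (Suc k)
  show ?case by (rule smooth_on_SucI[OF Suc.prems _ smooth_on_const[OF Suc.prems, of k 1]]) auto
qed (auto intro: continuous_intros)

lemma smooth_on_add: "open U \<Longrightarrow> smooth_on k U f \<Longrightarrow> smooth_on k U g \<Longrightarrow> smooth_on k U (\<lambda>x. f x + g x)"
proof (induction k arbitrary: f g)
  case (Suc k)
  show ?case
    by (rule smooth_on_SucI[OF Suc.prems(1) _ Suc.IH[OF Suc.prems(1) smooth_on_SucD(2)[OF Suc.prems(2)] smooth_on_SucD(2)[OF Suc.prems(3)]]])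
       (intro DERIV_add smooth_on_SucD(1)[OF Suc.prems(2)] smooth_on_SucD(1)[OF Suc.prems(3)])
qed (auto intro: continuous_intros)

lemma smooth_on_mult: "open U \<Longrightarrow> smooth_on k U f \<Longrightarrow> smooth_on k U g \<Longrightarrow> smooth_on k U (\<lambda>x. f x * g x)"
proof (induction k arbitrary: f g)
  case (Suc k)
  have "smooth_on k U (\<lambda>x. deriv f x * g x + deriv g x * f x)"
    using Suc.IH[OF Suc.prems(1) smooth_on_SucD(2)[OF Suc.prems(2)] smooth_on_mono[OF Suc.prems(3)]]
      Suc.IH[OF Suc.prems(1) smooth_on_SucD(2)[OF Suc.prems(3)] smooth_on_mono[OF Suc.prems(2)]]
    by (intro smooth_on_add Suc.prems)
  then show ?case
    by (rule smooth_on_SucI[OF Suc.prems(1), rotated])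
       (intro DERIV_mult smooth_on_SucD(1)[OF Suc.prems(2)] smooth_on_SucD(1)[OF Suc.prems(3)])
qed (auto intro: continuous_intros)

lemma smooth_on_compose:
  "open U \<Longrightarrow> (\<And>x. x \<in> U \<Longrightarrow> g x \<in> V) \<Longrightarrow> smooth_on k U g \<Longrightarrow> smooth_on k V f \<Longrightarrow> smooth_on k U (\<lambda>x. f (g x))"
proof (induction k arbitrary: f)
  case 0
  then show ?case by (auto intro: continuous_on_compose2)
next
  case (Suc k)
  have "smooth_on k U (\<lambda>x. deriv f (g x) * deriv g x)"
    by (rule smooth_on_mult[OF Suc.prems(1) Suc.IH[OF Suc.prems(1,2) smooth_on_mono[OF Suc.prems(3)]
          smooth_on_SucD(2)[OF Suc.prems(4)]] smooth_on_SucD(2)[OF Suc.prems(3)]])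
  then show ?case
    by (rule smooth_on_SucI[OF Suc.prems(1), rotated])
       (intro DERIV_chain2 smooth_on_SucD(1)[OF Suc.prems(3)] smooth_on_SucD(1)[OF Suc.prems(4)] Suc.prems(2))
qed

lemma smooth_on_Un: "open U \<Longrightarrow> open V \<Longrightarrow> smooth_on k U f \<Longrightarrow> smooth_on k V f \<Longrightarrow> smooth_on k (U \<union> V) f"
proof (induction k arbitrary: f)
  case 0
  then show ?case by (simp add: continuous_on_open_Un)
next
  case (Suc k)
  show ?case
    using Suc.IH[OF Suc.prems(1,2), of "deriv f"] Suc.prems(3,4) by auto
qed

text \<open>
  For \<open>n = 0\<close> this is the standard smooth function that is flat at zero. The powers of \<open>1/t\<close> make the family
  closed under differentiation up to linear combinations.
\<close>

definition flat :: "nat \<Rightarrow> real \<Rightarrow> real" where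
  "flat n t = (if 0 < t then (1 / t) ^ n * exp (- (1 / t)) else 0)"

lemma flat_tendsto_0: "(flat n \<longlongrightarrow> 0) (at 0)"
proof -
  have "((\<lambda>t::real. (inverse t) ^ n / exp (inverse t)) \<longlongrightarrow> 0) (at_right 0)"
    by (rule filterlim_compose[OF tendsto_power_div_exp_0 filterlim_inverse_at_top_right])
  then have "(flat n \<longlongrightarrow> 0) (at_right 0)"
    by (rule Lim_transform_eventually)
       (auto simp: flat_def eventually_at_right_field exp_minus divide_inverse intro!: exI[of _ 1])
  moreover have "(flat n \<longlongrightarrow> 0) (at_left 0)"
    by (rule tendsto_eventually) (auto simp: flat_def eventually_at_left_field intro!: exI[of _ "-1"])
  ultimately show ?thesis by (simp add: filterlim_at_split)
qed

lemma DERIV_flat: "(flat n has_real_derivative flat (n + 2) t - real n * flat (n + 1) t) (at t)"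
proof -
  consider "t > 0" | "t < 0" | "t = 0" by linarith
  then show ?thesis
  proof cases
    case 1
    have "((\<lambda>t. (1 / t) ^ n * exp (- (1 / t))) has_real_derivative
        real n * (1 / t) ^ (n - 1) * (- (1 / t\<^sup>2)) * exp (- (1 / t)) + exp (- (1 / t)) * (1 / t\<^sup>2) * (1 / t) ^ n) (at t)"
      using 1 by (auto intro!: derivative_eq_intros simp: power2_eq_square)
    moreover have "real n * (1 / t) ^ (n - 1) * (- (1 / t\<^sup>2)) * exp (- (1 / t)) + exp (- (1 / t)) * (1 / t\<^sup>2) * (1 / t) ^ n
        = flat (n + 2) t - real n * flat (n + 1) t"
      using 1 by (cases n) (auto simp: flat_def power2_eq_square field_simps)
    moreover have "\<forall>\<^sub>F s in nhds t. flat n s = (1 / s) ^ n * exp (- (1 / s))"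
      using eventually_nhds_in_open[of "{0<..}" t] 1 by (auto simp: flat_def elim!: eventually_mono)
    ultimately show ?thesis
      by (subst DERIV_cong_ev[OF refl _ refl]) auto
  next
    case 2
    have "\<forall>\<^sub>F s in nhds t. flat n s = 0"
      using eventually_nhds_in_open[of "{..<0}" t] 2 by (auto simp: flat_def elim!: eventually_mono)
    then show ?thesis
      using 2 by (subst DERIV_cong_ev[OF refl _ refl]) (auto simp: flat_def)
  next
    case 3
    have "flat n h / h = flat (n + 1) h" for h
      by (simp add: flat_def)
    then show ?thesis
      using 3 flat_tendsto_0[of "n + 1"] by (simp add: DERIV_def flat_def[of _ 0])
  qed
qed

lemma smooth_flat: "smooth_on k UNIV (flat n)"
proof (induction k arbitrary: n)
  case 0
  show ?case by (auto intro!: continuous_at_imp_continuous_on DERIV_isCont DERIV_flat)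
next
  case (Suc k)
  have "smooth_on k UNIV (\<lambda>t. flat (n + 2) t + (- real n) * flat (n + 1) t)"
    by (intro smooth_on_add smooth_on_mult smooth_on_const Suc.IH) auto
  then show ?case
    by (rule smooth_on_SucI[rotated 2]) (use DERIV_flat in auto)
qed

lemma flat_nonneg [simp]: "0 \<le> flat n t" and flat_pos: "0 < t \<Longrightarrow> 0 < flat n t"
  and flat_eq_0: "t \<le> 0 \<Longrightarrow> flat n t = 0"
  by (auto simp: flat_def)

lemma partial_deriv_cong:
  assumes "\<And>x. x \<in> pts N \<Longrightarrow> f x = g x" "x \<in> pts N" "i < N"
  shows "partial_deriv i f x = partial_deriv i g x"
  unfolding partial_deriv_def using assms(1)[OF upd_pts[OF assms(2,3)]] by simp

lemma Ck_cong:
  assumes "\<And>x. x \<in> pts N \<Longrightarrow> f x = g x" "Ck N k f"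
  shows "Ck N k g"
  using assms
proof (induction k arbitrary: f g)
  case 0
  have "continuous_map (euclid N) euclideanreal g"
    by (rule continuous_map_eq_on_pts[of N euclideanreal f]) (use 0 in auto)
  then show ?case by simp
next
  case (Suc k)
  have "(\<lambda>t. g (x(i := t))) differentiable at (x i)" if "x \<in> pts N" "i < N" for x i
  proof -
    have "(\<lambda>t. f (x(i := t))) = (\<lambda>t. g (x(i := t)))"
      using Suc.prems(1) upd_pts[OF that] by auto
    moreover have "(\<lambda>t. f (x(i := t))) differentiable at (x i)" using Suc.prems(2) that by simp
    ultimately show ?thesis by simp
  qed
  moreover have "Ck N k (partial_deriv i g)" if "i < N" for i
    by (rule Suc.IH[of "partial_deriv i f"]) (use Suc.prems that partial_deriv_cong[of N f g] in auto)
  moreover have "continuous_map (euclid N) euclideanreal g"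
    using continuous_map_eq_on_pts[of N euclideanreal f g] Suc.prems by auto
  ultimately show ?case by auto
qed

lemma Ck_SucI:
  assumes "has_C1 N f D" "\<And>i. i < N \<Longrightarrow> Ck N k (D i)"
  shows "Ck N (Suc k) f"
proof -
  have "Ck N k (partial_deriv i f)" if "i < N" for i
    by (rule Ck_cong[OF _ assms(2)[OF that]]) (use partial_deriv_eq[OF assms(1) _ that] in auto)
  then show ?thesis
    using has_C1D(1)[OF assms(1)] has_C1D(3)[OF assms(1)] by (auto simp: real_differentiable_def)
qed

lemma Ck_mono: "Ck N (Suc k) f \<Longrightarrow> Ck N k f"
proof (induction k arbitrary: f)
  case (Suc k)
  then show ?case by auto
qed auto

lemma Ck_Suc_has_C1: "Ck N (Suc k) f \<Longrightarrow> has_C1 N f (\<lambda>i. partial_deriv i f)"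
proof (rule Ck_1_imp_has_C1)
  show "Ck N (Suc k) f \<Longrightarrow> Ck N 1 f"
    by (induction k) (auto dest: Ck_mono simp del: Ck.simps simp: One_nat_def)
qed

lemma Ck_Suc_partial: "Ck N (Suc k) f \<Longrightarrow> i < N \<Longrightarrow> Ck N k (partial_deriv i f)"
  by simp

lemma has_C1_add:
  assumes "has_C1 N f D" "has_C1 N g E"
  shows "has_C1 N (\<lambda>x. f x + g x) (\<lambda>i x. D i x + E i x)"
  unfolding has_C1_def
  by (auto intro!: continuous_intros has_C1D[OF assms(1)] has_C1D[OF assms(2)] DERIV_add)

lemma has_C1_const: "has_C1 N (\<lambda>x. c) (\<lambda>i x. 0)"
  by (auto simp: has_C1_def)

lemma Ck_const: "Ck N k (\<lambda>x. c)"
proof (induction k arbitrary: c)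
  case (Suc k)
  show ?case by (rule Ck_SucI[OF has_C1_const]) (rule Suc.IH)
qed auto

lemma Ck_add: "Ck N k f \<Longrightarrow> Ck N k g \<Longrightarrow> Ck N k (\<lambda>x. f x + g x)"
proof (induction k arbitrary: f g)
  case 0
  then show ?case by (auto intro: continuous_intros)
next
  case (Suc k)
  show ?case
    by (rule Ck_SucI[OF has_C1_add[OF Ck_Suc_has_C1[OF Suc.prems(1)] Ck_Suc_has_C1[OF Suc.prems(2)]]])
       (intro Suc.IH Ck_Suc_partial[OF Suc.prems(1)] Ck_Suc_partial[OF Suc.prems(2)])
qed

lemma Ck_mult: "Ck N k f \<Longrightarrow> Ck N k g \<Longrightarrow> Ck N k (\<lambda>x. f x * g x)"
proof (induction k arbitrary: f g)
  case 0
  then show ?case by (auto intro: continuous_intros)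
next
  case (Suc k)
  show ?case
    by (rule Ck_SucI[OF has_C1_mult[OF Ck_Suc_has_C1[OF Suc.prems(1)] Ck_Suc_has_C1[OF Suc.prems(2)]]])
       (intro Ck_add Suc.IH Ck_Suc_partial[OF Suc.prems(1)] Ck_Suc_partial[OF Suc.prems(2)]
          Ck_mono[OF Suc.prems(1)] Ck_mono[OF Suc.prems(2)])
qed

lemma Ck_coordinate: "i < N \<Longrightarrow> Ck N k (\<lambda>x. x i * c)"
proof (cases k)
  case 0
  assume "i < N"
  then show ?thesis using 0 has_C1D(1)[OF has_C1_coordinate] by simp
next
  case (Suc j)
  assume "i < N"
  show ?thesis unfolding Suc
    by (rule Ck_SucI[OF has_C1_coordinate[OF \<open>i < N\<close>]]) (rule Ck_const)
qed

lemma has_C1_radial: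
  assumes "\<And>s. (g has_real_derivative g' s) (at s)" "continuous_on UNIV g'"
  shows "has_C1 N (\<lambda>x. g (sqd N z x)) (\<lambda>i x. g' (sqd N z x) * (2 * (x i - z i)))"
  by (rule has_C1_chain[OF has_C1_sqd, where S=UNIV]) (use assms in auto)

text \<open>
  The partial derivatives of a radial function are again radial functions times coordinates.
\<close>

lemma Ck_radial: "smooth_on k UNIV g \<Longrightarrow> Ck N k (\<lambda>x. g (sqd N z x))"
proof (induction k arbitrary: g)
  case 0
  have "continuous_map (euclid N) euclideanreal (g \<circ> sqd N z)"
    by (rule continuous_map_compose[OF has_C1D(1)[OF has_C1_sqd]]) (use 0 in simp)
  then show ?case by (simp add: o_def)
next
  case (Suc k)
  have c: "continuous_on UNIV (deriv g)"
    using smooth_on_SucD(2)[OF Suc.prems] by (induction k) (auto dest: smooth_on_mono simp del: smooth_on.simps(2))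
  show ?case
  proof (rule Ck_SucI[OF has_C1_radial[OF smooth_on_SucD(1)[OF Suc.prems UNIV_I] c]])
    fix i assume i: "i < N"
    have "Ck N k (\<lambda>x. deriv g (sqd N z x) * (x i * 2 + (- 2 * z i)))"
      by (intro Ck_mult Ck_add Ck_const Ck_coordinate i Suc.IH smooth_on_SucD(2)[OF Suc.prems])
    then show "Ck N k (\<lambda>x. deriv g (sqd N z x) * (2 * (x i - z i)))"
      by (rule Ck_cong[rotated]) (simp add: algebra_simps)
  qed
qed

lemma radial_in_Cinf_c:
  assumes g: "\<And>k. smooth_on k UNIV g" "\<And>s. r\<^sup>2 < s \<Longrightarrow> g s = 0" and r: "0 < r"
    and E: "\<And>x. x \<in> pts N \<Longrightarrow> sqd N z x \<le> r\<^sup>2 \<Longrightarrow> x \<in> E"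
  shows "(\<lambda>x. g (sqd N z x)) \<in> Cinf_c N E"
proof -
  let ?f = "\<lambda>x. g (sqd N z x)"
  have sub: "supp N ?f \<subseteq> {x \<in> topspace (euclid N). sqd N z x \<in> {..r\<^sup>2}}"
    unfolding supp_def
  proof (rule closure_of_minimal)
    show "closedin (euclid N) {x \<in> topspace (euclid N). sqd N z x \<in> {..r\<^sup>2}}"
      by (rule closedin_continuous_map_preimage[OF has_C1D(1)[OF has_C1_sqd]]) simp
  qed (use g(2) in \<open>auto simp: not_less[symmetric]\<close>)
  have "vanishes_off_cube N (r + (\<Sum>j<N. \<bar>z j\<bar>)) ?f"
    unfolding vanishes_off_cube_def
  proof (intro ballI impI)
    fix x assume "x \<in> pts N" "x \<notin> cube N (r + (\<Sum>j<N. \<bar>z j\<bar>))"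
    then obtain j where j: "j < N" "r + (\<Sum>j<N. \<bar>z j\<bar>) < \<bar>x j\<bar>" by (auto simp: in_cube_iff not_le)
    have "\<bar>z j\<bar> \<le> (\<Sum>j<N. \<bar>z j\<bar>)" using j(1) by (intro member_le_sum) auto
    then have "r < \<bar>x j - z j\<bar>" using j(2) by linarith
    then have "r\<^sup>2 < \<bar>x j - z j\<bar>\<^sup>2" using r by (intro power_strict_mono) auto
    also have "\<dots> \<le> sqd N z x" using sqd_coord[OF j(1), of x z] by simp
    finally show "?f x = 0" by (rule g(2))
  qed
  then have "compactin (euclid N) (supp N ?f)" by (rule compactin_supp)
  moreover have "supp N ?f \<subseteq> E" using sub E by auto
  ultimately show ?thesis
    unfolding Cinf_c_def using Ck_radial[OF g(1)] by blast
qed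

lemma ball_positive_measure:
  assumes "1 \<le> N" "0 < r"
  shows "0 < emeasure (lebB N) {x \<in> pts N. sqd N z x < r\<^sup>2}"
proof -
  let ?S = "aff N (\<lambda>j. - z j) 1 -` cube N (r / (2 * real N)) \<inter> space (lebB N)"
  have "distr (lebB N) (lebB N) (aff N (\<lambda>j. - z j) 1) = lebB N"
    using distr_aff[of 1 N "\<lambda>j. - z j"] by simp
  then have "emeasure (lebB N) ?S = emeasure (lebB N) (cube N (r / (2 * real N)))"
    using emeasure_distr[OF measurable_aff cube_sets, of N "\<lambda>j. - z j" 1 "r / (2 * real N)"] by simp
  also have "0 < \<dots>" using assms by (subst emeasure_cube) auto
  finally have "0 < emeasure (lebB N) ?S" .
  also have "\<dots> \<le> emeasure (lebB N) {x \<in> pts N. sqd N z x < r\<^sup>2}"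
  proof (rule emeasure_mono)
    show "{x \<in> pts N. sqd N z x < r\<^sup>2} \<in> sets (lebB N)"
      unfolding space_lebB[symmetric] by measurable
    show "?S \<subseteq> {x \<in> pts N. sqd N z x < r\<^sup>2}"
    proof
      fix x assume x: "x \<in> ?S"
      then have "\<bar>x j - z j\<bar> \<le> r / (2 * real N)" if "j < N" for j
        using that by (auto simp: in_cube_iff aff_def)
      then have "sqd N z x \<le> r\<^sup>2 / 4" by (rule sqd_le_of_near[OF assms])
      also have "\<dots> < r\<^sup>2" using assms by simp
      finally show "x \<in> {x \<in> pts N. sqd N z x < r\<^sup>2}" using x by simp
    qed
  qed
  finally show ?thesis .
qed

text \<open>
  It shows that the infimum defining the eigenvalue runs over a nonempty set and that the Cheeger constant is
  finite.
\<close>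

lemma exists_test_function:
  assumes N: "1 \<le> N" and p: "0 < p" and E: "openin (euclid N) E" "E \<noteq> {}"
  obtains \<phi> where "\<phi> \<in> Cinf_c N E" "\<And>x. 0 \<le> \<phi> x" "0 < (\<integral>x. \<bar>\<phi> x\<bar> powr p \<partial>lebB N)"
proof -
  obtain z where z: "z \<in> E" using E by auto
  obtain r where r: "0 < r" "\<And>x. x \<in> pts N \<Longrightarrow> sqd N z x \<le> r\<^sup>2 \<Longrightarrow> x \<in> E"
    using open_contains_ball[OF E(1) z] by metis
  define g where "g s = flat 0 (r\<^sup>2 + (- 1) * s)" for s
  define \<phi> where "\<phi> x = g (sqd N z x)" for x
  have g: "smooth_on k UNIV g" for k
    unfolding g_def[abs_def]
    by (rule smooth_on_compose[where V=UNIV, OF open_UNIV UNIV_I _ smooth_flat])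
       (intro smooth_on_add smooth_on_mult smooth_on_const smooth_on_ident open_UNIV)
  have \<phi>: "\<phi> \<in> Cinf_c N E"
    unfolding \<phi>_def[abs_def]
    by (rule radial_in_Cinf_c[OF g _ r]) (auto simp: g_def flat_eq_0)
  have Es: "E \<in> sets (lebB N)" by (rule openin_imp_sets[OF E(1)])
  obtain r' where r': "vanishes_off_cube N r' \<phi>" using Cinf_cD(2)[OF \<phi>] by blast
  have int: "integrable (lebB N) (\<lambda>x. \<bar>\<phi> x\<bar> powr p)"
    by (rule integrable_abs_powr[OF has_C1D(1)[OF Cinf_cD(1)[OF \<phi>]] r' p])
  have "(\<integral>x. \<bar>\<phi> x\<bar> powr p \<partial>lebB N) \<noteq> 0"
  proof
    assume "(\<integral>x. \<bar>\<phi> x\<bar> powr p \<partial>lebB N) = 0"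
    then have "AE x in lebB N. \<bar>\<phi> x\<bar> powr p = 0"
      by (subst (asm) integral_nonneg_eq_0_iff_AE[OF int]) auto
    then have ae: "AE x in lebB N. \<not> sqd N z x < r\<^sup>2"
    proof eventually_elim
      case (elim x)
      then show ?case
        using flat_pos[where n=0 and t="r\<^sup>2 - sqd N z x"] by (auto simp: \<phi>_def g_def)
    qed
    have "{x \<in> pts N. sqd N z x < r\<^sup>2} \<in> sets (lebB N)"
      using has_C1D(4)[OF has_C1_sqd, of N z] unfolding space_lebB[symmetric] by measurable
    then have "emeasure (lebB N) {x \<in> pts N. sqd N z x < r\<^sup>2} = 0"
      using AE_iff_measurable[of "{x \<in> pts N. sqd N z x < r\<^sup>2}" "lebB N" "\<lambda>x. \<not> sqd N z x < r\<^sup>2"] ae by simp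
    then show False using ball_positive_measure[OF N r(1), of z] by simp
  qed
  moreover have "0 \<le> (\<integral>x. \<bar>\<phi> x\<bar> powr p \<partial>lebB N)" by (rule integral_nonneg_AE) auto
  ultimately have "0 < (\<integral>x. \<bar>\<phi> x\<bar> powr p \<partial>lebB N)" by linarith
  then show ?thesis
    by (intro that[OF \<phi>]) (simp_all add: \<phi>_def g_def)
qed

lemma Cinf_c_scale:
  assumes \<phi>: "\<phi> \<in> Cinf_c N E" and c: "c \<noteq> 0"
  shows "(\<lambda>x. c * \<phi> x) \<in> Cinf_c N E"
proof -
  have "supp N (\<lambda>x. c * \<phi> x) = supp N \<phi>" using c by (simp add: supp_def)
  then show ?thesis
    using \<phi> Ck_mult[OF Ck_const] unfolding Cinf_c_def by auto
qed

text \<open>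
  Integration by parts makes the classical gradient a weak one; the function is its own approximation.
\<close>

lemma Cinf_c_in_W1p_0:
  assumes \<phi>: "\<phi> \<in> Cinf_c N E" and E: "E \<in> sets (lebB N)" and p: "1 < p"
  shows "(\<phi>, grad \<phi>) \<in> W1p_0 N p E"
proof -
  have p0: "0 < p" using p by simp
  note C1 = Cinf_cD(1)[OF \<phi>]
  obtain r where r: "vanishes_off_cube N r \<phi>" using Cinf_cD(2)[OF \<phi>] by blast
  have Lp1: "\<phi> \<in> Lp N p E"
    using measurable_leb_on[OF has_C1D(4)[OF C1]] Cinf_c_integrals(1)[OF \<phi> E p0] by (simp add: Lp_def)
  have Lp2: "(\<lambda>x. grad \<phi> x i) \<in> Lp N p E" if "i < N" for i
    using measurable_leb_on[OF has_C1D(5)[OF C1 that]] Cinf_c_integrals(5)[OF \<phi> E p0 that]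
    by (simp add: Lp_def grad_def)
  have wg: "weak_gradient N E \<phi> (grad \<phi>)"
    unfolding weak_gradient_def
  proof (intro ballI allI impI)
    fix \<psi> i assume \<psi>: "\<psi> \<in> Cinf_c N E" and i: "i < N"
    note C2 = Cinf_cD(1)[OF \<psi>]
    have [measurable]: "\<phi> \<in> borel_measurable (lebB N)" "\<psi> \<in> borel_measurable (lebB N)"
      "partial_deriv i \<phi> \<in> borel_measurable (lebB N)" "partial_deriv i \<psi> \<in> borel_measurable (lebB N)"
      using has_C1D(4)[OF C1] has_C1D(4)[OF C2] has_C1D(5)[OF C1 i] has_C1D(5)[OF C2 i] by auto
    have "(\<integral>x. \<phi> x * partial_deriv i \<psi> x \<partial>leb_on N E) = (\<integral>x. \<phi> x * partial_deriv i \<psi> x \<partial>lebB N)"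
      by (rule integral_leb_on_supported(1)[OF _ E]) (use Cinf_cD(3)[OF \<phi>] in auto)
    also have "\<dots> = - (\<integral>x. partial_deriv i \<phi> x * \<psi> x \<partial>lebB N)"
      by (rule integral_by_parts[OF C1 C2 r i])
    also have "(\<integral>x. partial_deriv i \<phi> x * \<psi> x \<partial>lebB N) = (\<integral>x. partial_deriv i \<phi> x * \<psi> x \<partial>leb_on N E)"
      by (rule integral_leb_on_supported(1)[OF _ E, symmetric]) (use Cinf_cD(3)[OF \<psi>] in auto)
    finally show "(\<integral>x. \<phi> x * partial_deriv i \<psi> x \<partial>leb_on N E) = - (\<integral>x. grad \<phi> x i * \<psi> x \<partial>leb_on N E)"
      by (simp add: grad_def)
  qed
  have z: "Lp_norm N p E (\<lambda>x. \<phi> x - \<phi> x) + Lp_norm N p E (\<lambda>x. enorm N (\<lambda>i. grad \<phi> x i - grad \<phi> x i)) = 0"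
    using p by (simp add: Lp_norm_def enorm_def L2_set_def)
  show ?thesis
    unfolding W1p_0_def W1p_def using Lp1 Lp2 wg \<phi> z by (auto intro!: bexI[OF _ \<phi>])
qed

lemma eigenvalue_le_Rayleigh:
  assumes \<phi>: "\<phi> \<in> Cinf_c N E" and E: "E \<in> sets (lebB N)" and p: "1 < p"
    and pos: "0 < (\<integral>x. \<bar>\<phi> x\<bar> powr p \<partial>lebB N)"
  shows "eigenvalue_p N p E * (\<integral>x. \<bar>\<phi> x\<bar> powr p \<partial>lebB N) \<le> (\<integral>x. gnorm N (\<lambda>i. partial_deriv i \<phi>) x powr p \<partial>lebB N)"
    and "{(u, g) \<in> W1p_0 N p E. Lp_norm N p E u = 1} \<noteq> {}"
proof -
  have p0: "0 < p" using p by simp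
  define J where "J = (\<integral>x. \<bar>\<phi> x\<bar> powr p \<partial>lebB N)"
  define c where "c = J powr (- (1 / p))"
  have J: "0 < J" using pos by (simp add: J_def)
  have c: "0 < c" using J by (simp add: c_def)
  have cp: "c powr p = 1 / J" using J p by (simp add: c_def powr_powr powr_minus_divide[of J 1] del: powr_minus)
  define \<psi> where "\<psi> x = c * \<phi> x" for x
  have \<psi>: "\<psi> \<in> Cinf_c N E" unfolding \<psi>_def[abs_def] by (rule Cinf_c_scale[OF \<phi>]) (use c in simp)
  note C1 = Cinf_cD(1)[OF \<phi>]
  have pd: "partial_deriv i \<psi> x = c * partial_deriv i \<phi> x" if "x \<in> pts N" "i < N" for i x
    unfolding partial_deriv_def[of i \<psi>] \<psi>_def
    by (rule DERIV_imp_deriv, rule DERIV_cmult, rule has_C1D(3)[OF C1 that])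
  have g: "gnorm N (\<lambda>i. partial_deriv i \<psi>) x = c * gnorm N (\<lambda>i. partial_deriv i \<phi>) x" if "x \<in> pts N" for x
  proof -
    have "gnorm N (\<lambda>i. partial_deriv i \<psi>) x = gnorm N (\<lambda>i x. c * partial_deriv i \<phi> x) x"
      unfolding gnorm_def enorm_def L2_set_def using pd[OF that] by simp
    then show ?thesis using gnorm_scale[of N "\<lambda>x. c" "\<lambda>i. partial_deriv i \<phi>" x] c by simp
  qed
  have "(\<integral>x. \<bar>\<psi> x\<bar> powr p \<partial>leb_on N E) = (\<integral>x. \<bar>\<psi> x\<bar> powr p \<partial>lebB N)"
    by (rule Cinf_c_integrals(2)[OF \<psi> E p0])
  also have "\<dots> = c powr p * J"
    unfolding J_def \<psi>_def using c by (simp add: abs_mult powr_mult)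
  finally have n1: "Lp_norm N p E \<psi> = 1" using J by (simp add: Lp_norm_def cp)
  have mem: "(\<psi>, grad \<psi>) \<in> {(u, g) \<in> W1p_0 N p E. Lp_norm N p E u = 1}"
    using Cinf_c_in_W1p_0[OF \<psi> E p] n1 by simp
  then show "{(u, g) \<in> W1p_0 N p E. Lp_norm N p E u = 1} \<noteq> {}" by blast
  have "eigenvalue_p N p E \<le> (case (\<psi>, grad \<psi>) of (u, g) \<Rightarrow> \<integral>x. enorm N (g x) powr p \<partial>leb_on N E)"
    unfolding eigenvalue_p_def
    by (rule cINF_lower[OF _ mem], rule bdd_belowI2[where m=0]) (auto intro!: integral_nonneg_AE)
  also have "\<dots> = (\<integral>x. gnorm N (\<lambda>i. partial_deriv i \<psi>) x powr p \<partial>lebB N)"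
    using Cinf_c_integrals(4)[OF \<psi> E p0] by simp
  also have "\<dots> = (\<integral>x. c powr p * gnorm N (\<lambda>i. partial_deriv i \<phi>) x powr p \<partial>lebB N)"
    by (intro Bochner_Integration.integral_cong refl) (use g c in \<open>simp add: powr_mult\<close>)
  also have "\<dots> = (\<integral>x. gnorm N (\<lambda>i. partial_deriv i \<phi>) x powr p \<partial>lebB N) / J"
    by (simp add: cp)
  finally show "eigenvalue_p N p E * (\<integral>x. \<bar>\<phi> x\<bar> powr p \<partial>lebB N) \<le> (\<integral>x. gnorm N (\<lambda>i. partial_deriv i \<phi>) x powr p \<partial>lebB N)"
    using J unfolding J_def[symmetric] by (simp add: pos_le_divide_eq)
qed

section \<open>Strict inequality in every dimension\<close>

lemma ennreal_le_divide_iff: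
  assumes "0 < m"
  shows "c \<le> q / ennreal m \<longleftrightarrow> c * ennreal m \<le> q"
proof
  assume "c \<le> q / ennreal m"
  then have "c * ennreal m \<le> q / ennreal m * ennreal m" by (rule mult_right_mono) simp
  also have "\<dots> = q"
    using assms by (simp add: ennreal_divide_times)
  finally show "c * ennreal m \<le> q" .
next
  assume "c * ennreal m \<le> q"
  then have "c * ennreal m / ennreal m \<le> q / ennreal m" by (rule divide_right_mono_ennreal)
  then show "c \<le> q / ennreal m"
    using assms by (simp add: mult_divide_eq_ennreal)
qed

text \<open>
  If the infimum were infinite, then every \<open>k\<close> would be admissible in the functional inequality for a fixed test
  function. Positivity comes from the radial field. Without finiteness the convention of \<open>enn2real\<close> would
  give \<open>cheeger\<close> the value zero.
\<close>

lemma cheeger_constant: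
  assumes N: "1 \<le> N" and E: "openin (euclid N) E" "E \<noteq> {}"
    and R: "0 < R" "\<And>x. x \<in> E \<Longrightarrow> enorm N x \<le> R"
  shows "cheeger_bound N E (cheeger N E)" and "real N / R \<le> cheeger N E"
proof -
  define S where "S = {A \<in> sets (leb N). A \<subseteq> E \<and> emeasure (leb N) A > 0}"
  define I where "I = (INF A \<in> S. perimeter N A / emeasure (leb N) A)"
  have ch: "cheeger N E = enn2real I" by (simp add: cheeger_def I_def S_def)
  have em: "\<exists>m>0. emeasure (leb N) A = ennreal m" if "A \<in> S" for A
  proof -
    have A: "A \<in> sets (leb N)" "A \<subseteq> E" "0 < emeasure (leb N) A" using that by (auto simp: S_def)
    have "emeasure (leb N) A = ennreal (measure (leb N) A)"
      by (rule emeasure_eq_ennreal_measure) (use cheeger_bound_of_bounded(2)[OF N R A(1,2)] in auto)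
    then show ?thesis using A(3) by (metis ennreal_less_zero_iff)
  qed
  have cb: "cheeger_bound N E k \<longleftrightarrow> ennreal k \<le> I" if "0 \<le> k" for k
  proof -
    have "ennreal k \<le> I \<longleftrightarrow> (\<forall>A\<in>S. ennreal k \<le> perimeter N A / emeasure (leb N) A)"
      by (simp add: I_def le_INF_iff)
    also have "\<dots> \<longleftrightarrow> (\<forall>A\<in>S. ennreal k * emeasure (leb N) A \<le> perimeter N A)"
      using em ennreal_le_divide_iff by (metis (no_types))
    also have "\<dots> \<longleftrightarrow> cheeger_bound N E k"
      using that by (auto simp: cheeger_bound_def S_def)
    finally show ?thesis by simp
  qed
  have low: "ennreal (real N / R) \<le> I"
    using cheeger_bound_of_bounded(1)[OF N R] cb[of "real N / R"] R by simp
  have fin: "I < \<infinity>"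
  proof (rule ccontr)
    assume "\<not> I < \<infinity>"
    then have top: "I = \<infinity>" by (simp add: less_top[symmetric])
    obtain \<phi> where \<phi>: "\<phi> \<in> Cinf_c N E" "\<And>x. 0 \<le> \<phi> x" "0 < (\<integral>x. \<bar>\<phi> x\<bar> powr 1 \<partial>lebB N)"
      by (rule exists_test_function[OF N zero_less_one E]) (rule that; assumption)
    obtain r where r: "vanishes_off_cube N r \<phi>" using Cinf_cD(2)[OF \<phi>(1)] by blast
    define J where "J = (\<integral>x. \<phi> x \<partial>lebB N)"
    define G where "G = (\<integral>x. gnorm N (\<lambda>i. partial_deriv i \<phi>) x \<partial>lebB N)"
    have J: "0 < J" using \<phi>(2,3) by (simp add: J_def)
    have G: "0 \<le> G" unfolding G_def by (rule integral_nonneg_AE) auto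
    have "(G / J + 1) * J \<le> G"
      unfolding J_def[symmetric] G_def
      using cheeger_bound_L1[OF _ Cinf_cD(1)[OF \<phi>(1)] r \<phi>(2), of E "G / J + 1"] cb[of "G / J + 1"]
        Cinf_cD(3)[OF \<phi>(1)] top J G by (auto simp: J_def G_def)
    moreover have "(G / J + 1) * J = G + J" using J by (simp add: distrib_right)
    ultimately show False using J by linarith
  qed
  have Ieq: "I = ennreal (cheeger N E)" using fin by (simp add: ch)
  have nn: "0 \<le> cheeger N E" by (simp add: ch)
  show "cheeger_bound N E (cheeger N E)" using cb[OF nn] Ieq by simp
  show "real N / R \<le> cheeger N E" using low nn unfolding Ieq by (simp add: ennreal_le_iff)
qed

lemma F_p_lower_bound:
  assumes N: "1 \<le> N" and p: "1 < p"
  obtains \<delta> where "0 < \<delta>"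
    "\<And>E. openin (euclid N) E \<Longrightarrow> E \<noteq> {} \<Longrightarrow> bounded_in N E \<Longrightarrow> 1 / p * (1 + \<delta>) powr (1 / p) \<le> F_p N p E"
proof (rule improved_cheeger_Lp[OF N p])
  fix \<delta> :: real
  assume \<delta>: "0 < \<delta>"
    "\<And>E k u D r. cheeger_bound N E k \<Longrightarrow> 0 < k \<Longrightarrow> has_C1 N u D \<Longrightarrow> vanishes_off_cube N r u
      \<Longrightarrow> (\<And>x. x \<in> pts N \<Longrightarrow> u x \<noteq> 0 \<Longrightarrow> x \<in> E)
      \<Longrightarrow> (k / p) powr p * (1 + \<delta>) * (\<integral>x. \<bar>u x\<bar> powr p \<partial>lebB N) \<le> (\<integral>x. gnorm N D x powr p \<partial>lebB N)"
  have "1 / p * (1 + \<delta>) powr (1 / p) \<le> F_p N p E"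
    if E: "openin (euclid N) E" "E \<noteq> {}" "bounded_in N E" for E
  proof -
    obtain R0 where R0: "\<And>x. x \<in> E \<Longrightarrow> enorm N x \<le> R0" using E(3) by (auto simp: bounded_in_def)
    define R where "R = max R0 1"
    have R: "0 < R" "\<And>x. x \<in> E \<Longrightarrow> enorm N x \<le> R" using R0 by (auto simp: R_def le_max_iff_disj)
    define k where "k = cheeger N E"
    note cc = cheeger_constant[OF N E(1,2) R, folded k_def]
    have "0 < real N / R" using N R by simp
    then have k: "0 < k" using cc(2) by linarith
    have Es: "E \<in> sets (lebB N)" by (rule openin_imp_sets[OF E(1)])
    have p0: "0 < p" using p by simp
    define K where "K = (k / p) powr p * (1 + \<delta>)"
    have K0: "0 \<le> K" using \<delta> by (simp add: K_def)
    have KC: "K * (\<integral>x. \<bar>\<phi> x\<bar> powr p \<partial>leb_on N E) \<le> (\<integral>x. enorm N (grad \<phi> x) powr p \<partial>leb_on N E)"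
      if \<phi>: "\<phi> \<in> Cinf_c N E" for \<phi>
    proof -
      obtain r where r: "vanishes_off_cube N r \<phi>" using Cinf_cD(2)[OF \<phi>] by blast
      show ?thesis
        unfolding Cinf_c_integrals(2)[OF \<phi> Es p0] Cinf_c_integrals(4)[OF \<phi> Es p0] K_def
      proof (rule \<delta>(2)[OF cc(1) k Cinf_cD(1)[OF \<phi>] r])
        fix x assume "x \<in> pts N" "\<phi> x \<noteq> 0"
        then show "x \<in> E" using Cinf_cD(3)[OF \<phi>, of x] by blast
      qed
    qed
    obtain \<phi> where \<phi>: "\<phi> \<in> Cinf_c N E" "0 < (\<integral>x. \<bar>\<phi> x\<bar> powr p \<partial>lebB N)"
      by (rule exists_test_function[OF N p0 E(1,2)]) (rule that; assumption)
    have "K \<le> eigenvalue_p N p E"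
      unfolding eigenvalue_p_def
    proof (rule cINF_greatest[OF eigenvalue_le_Rayleigh(2)[OF \<phi>(1) Es p \<phi>(2)]])
      fix ug assume "ug \<in> {(u, g) \<in> W1p_0 N p E. Lp_norm N p E u = 1}"
      then obtain u g where ug: "ug = (u, g)" "(u, g) \<in> W1p_0 N p E" "Lp_norm N p E u = 1" by auto
      show "K \<le> (case ug of (u, g) \<Rightarrow> \<integral>x. enorm N (g x) powr p \<partial>leb_on N E)"
        unfolding ug(1) using W1p_0_lower_bound[OF p Es K0 KC ug(2,3)] by simp
    qed
    then have "K powr (1 / p) \<le> eigenvalue_p N p E powr (1 / p)"
      using K0 p by (intro powr_mono2) auto
    also have "K powr (1 / p) = k / p * (1 + \<delta>) powr (1 / p)"
      using k p \<delta>(1) by (simp add: K_def powr_mult powr_powr)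
    finally have "k / p * (1 + \<delta>) powr (1 / p) / k \<le> eigenvalue_p N p E powr (1 / p) / k"
      using k by (intro divide_right_mono) auto
    then show ?thesis using k by (simp add: F_p_def k_def[symmetric])
  qed
  then show ?thesis by (rule that[OF \<delta>(1)])
qed

definition uball :: "nat \<Rightarrow> point set" where
  "uball N = {x \<in> pts N. sqd N (\<lambda>_. 0) x < 1}"

lemma uball_iff: "x \<in> uball N \<longleftrightarrow> x \<in> pts N \<and> enorm N x < 1"
  unfolding uball_def sqd_origin by (auto simp: abs_square_less_1)

lemma uball_body: "uball N \<in> open_convex_bodies N"
proof -
  have "(\<lambda>i\<in>{..<N}. 0) \<in> uball N"
    by (auto simp: uball_def sqd_def)
  moreover have "openin (euclid N) (uball N)"
    using openin_continuous_map_preimage[OF has_C1D(1)[OF has_C1_sqd], of "{..<1}" N "\<lambda>_. 0"]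
    by (simp add: uball_def)
  moreover have "bounded_in N (uball N)"
    unfolding bounded_in_def by (rule exI[of _ 1]) (auto simp: uball_iff less_imp_le)
  moreover have "convex_in N (uball N)"
    unfolding convex_in_def
  proof (intro ballI)
    fix x y :: point and t :: real
    assume xy: "x \<in> uball N" "y \<in> uball N" and t: "t \<in> {0..1}"
    let ?w = "\<lambda>i\<in>{..<N}. (1 - t) * x i + t * y i"
    have "enorm N ?w = L2_set (\<lambda>i. (1 - t) * x i + t * y i) {..<N}"
      unfolding enorm_def by (rule L2_set_cong) auto
    also have "\<dots> \<le> L2_set (\<lambda>i. (1 - t) * x i) {..<N} + L2_set (\<lambda>i. t * y i) {..<N}"
      by (rule L2_set_triangle_ineq)
    also have "\<dots> = (1 - t) * enorm N x + t * enorm N y"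
      unfolding enorm_def using t by (simp add: L2_set_right_distrib)
    also have "\<dots> < 1"
    proof -
      define m where "m = max (enorm N x) (enorm N y)"
      have m: "m < 1" using xy by (simp add: m_def uball_iff)
      have "(1 - t) * enorm N x + t * enorm N y \<le> (1 - t) * m + t * m"
        using t by (intro add_mono mult_left_mono) (auto simp: m_def)
      also have "\<dots> = m" by (simp add: algebra_simps)
      finally show ?thesis using m by simp
    qed
    finally show "?w \<in> uball N" by (simp add: uball_iff)
  qed
  ultimately show ?thesis by (auto simp: open_convex_bodies_def)
qed

lemma F_p_nonneg: "0 \<le> F_p N p E"
  by (simp add: F_p_def cheeger_def)

lemma m_p_le_ball: "m_p p N \<le> F_p N p (uball N)"
  unfolding m_p_def by (rule cINF_lower[OF _ uball_body]) (rule bdd_belowI2[where m=0], rule F_p_nonneg)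

text \<open>
  The lower bound of \<open>F_p_lower_bound\<close> is uniform in the set and hence survives the infimum.
\<close>

lemma m_p_gt:
  assumes N: "1 \<le> N" and p: "1 < p"
  shows "1 / p < m_p p N"
proof (rule F_p_lower_bound[OF N p])
  fix \<delta> :: real
  assume \<delta>: "0 < \<delta>"
    "\<And>E. openin (euclid N) E \<Longrightarrow> E \<noteq> {} \<Longrightarrow> bounded_in N E \<Longrightarrow> 1 / p * (1 + \<delta>) powr (1 / p) \<le> F_p N p E"
  have "1 powr (1 / p) < (1 + \<delta>) powr (1 / p)"
    using \<delta>(1) p by (intro powr_less_mono2) auto
  then have "1 / p < 1 / p * (1 + \<delta>) powr (1 / p)" using p by (simp add: divide_less_cancel)
  also have "\<dots> \<le> m_p p N"
    unfolding m_p_def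
  proof (rule cINF_greatest)
    show "open_convex_bodies N \<noteq> {}" using uball_body by blast
  qed (use \<delta>(2) in \<open>auto simp: open_convex_bodies_def\<close>)
  finally show ?thesis .
qed

section \<open>Balls in high dimension\<close>

lemma smooth_on_exp: "smooth_on k UNIV (exp :: real \<Rightarrow> real)"
proof (induction k)
  case (Suc k)
  show ?case by (rule smooth_on_SucI[OF open_UNIV DERIV_exp Suc.IH])
qed (auto intro: continuous_intros)

lemma smooth_on_inverse: "smooth_on k {0<..} (inverse :: real \<Rightarrow> real)"
proof (induction k)
  case 0
  show ?case by (auto intro!: continuous_intros)
next
  case (Suc k)
  have "smooth_on k {0<..} (\<lambda>x::real. (- 1) * (inverse x * inverse x))"
    by (intro smooth_on_mult smooth_on_const open_greaterThan Suc.IH)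
  moreover have "(inverse has_real_derivative (- 1) * (inverse x * inverse x)) (at x)"
    if "x \<in> {0<..}" for x :: real
    using DERIV_inverse[of x UNIV] that by (simp add: power2_eq_square)
  ultimately show ?case
    by (rule smooth_on_SucI[OF open_greaterThan, rotated])
qed

lemma smooth_on_ln: "smooth_on k {0<..} (ln :: real \<Rightarrow> real)"
proof (cases k)
  case 0
  then show ?thesis by (auto intro!: continuous_intros)
next
  case (Suc j)
  show ?thesis
    unfolding Suc
    by (rule smooth_on_SucI[OF open_greaterThan _ smooth_on_inverse])
       (auto intro!: derivative_eq_intros simp: divide_inverse)
qed

text \<open>
  The cut-off in the logarithmic variable. Its support is kept away from zero because zero corresponds to
  the unit sphere, which the support of the test function has to avoid.
\<close>

definition bump :: "real \<Rightarrow> real" where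
  "bump t = flat 0 (t - 1) * flat 0 (2 - t)"

definition bump' :: "real \<Rightarrow> real" where
  "bump' t = flat 2 (t - 1) * flat 0 (2 - t) - flat 0 (t - 1) * flat 2 (2 - t)"

lemma DERIV_bump: "(bump has_real_derivative bump' t) (at t)"
proof -
  have "((\<lambda>t. flat 0 (t - 1)) has_real_derivative flat 2 (t - 1) * 1) (at t)"
    by (rule DERIV_chain2[where g="\<lambda>t. t - 1"]) (use DERIV_flat[of 0 "t - 1"] in \<open>auto intro!: derivative_eq_intros simp: numeral_2_eq_2\<close>)
  moreover have "((\<lambda>t. flat 0 (2 - t)) has_real_derivative flat 2 (2 - t) * (- 1)) (at t)"
    by (rule DERIV_chain2[where g="\<lambda>t. 2 - t"]) (use DERIV_flat[of 0 "2 - t"] in \<open>auto intro!: derivative_eq_intros simp: numeral_2_eq_2\<close>)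
  ultimately show ?thesis
    unfolding bump_def[abs_def] bump'_def using DERIV_mult by (force simp: algebra_simps)
qed

lemma bump_nonneg [simp]: "0 \<le> bump t"
  by (simp add: bump_def)

lemma bump_outside: "t \<le> 1 \<or> 2 \<le> t \<Longrightarrow> bump t = 0" "t \<le> 1 \<or> 2 \<le> t \<Longrightarrow> bump' t = 0"
  by (auto simp: bump_def bump'_def flat_def)

lemma bump_middle: "4 / 3 \<le> t \<Longrightarrow> t \<le> 5 / 3 \<Longrightarrow> exp (- 6) \<le> bump t"
proof -
  assume t: "4 / 3 \<le> t" "t \<le> 5 / 3"
  have "exp (- 3) \<le> flat 0 s" if "1 / 3 \<le> s" for s :: real
  proof -
    have "1 / s \<le> 1 / (1 / 3)" using that by (intro divide_left_mono) auto
    then show ?thesis using that by (simp add: flat_def)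
  qed
  then have "exp (- 3) * exp (- 3) \<le> bump t"
    unfolding bump_def using t by (intro mult_mono) auto
  then show ?thesis by (simp add: exp_add[symmetric])
qed

lemma smooth_bump: "smooth_on k UNIV bump"
proof -
  have "smooth_on k UNIV (\<lambda>t. flat 0 (t + (- 1)))"
    by (rule smooth_on_compose[where V=UNIV, OF open_UNIV UNIV_I _ smooth_flat])
       (intro smooth_on_add smooth_on_const smooth_on_ident open_UNIV)
  moreover have "smooth_on k UNIV (\<lambda>t. flat 0 (2 + (- 1) * t))"
    by (rule smooth_on_compose[where V=UNIV, OF open_UNIV UNIV_I _ smooth_flat])
       (intro smooth_on_add smooth_on_mult smooth_on_const smooth_on_ident open_UNIV)
  ultimately have "smooth_on k UNIV (\<lambda>t. flat 0 (t + (- 1)) * flat 0 (2 + (- 1) * t))"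
    by (intro smooth_on_mult open_UNIV)
  then show ?thesis by (simp add: bump_def[abs_def])
qed

lemma bump'_bounded: obtains K where "0 < K" "\<And>t. \<bar>bump' t\<bar> \<le> K"
proof -
  have flat: "continuous_on UNIV (flat n)" for n
    by (auto intro!: continuous_at_imp_continuous_on DERIV_isCont DERIV_flat)
  have comp: "continuous_on {1..2} (\<lambda>t. flat n (f t))" if "continuous_on {1..2} f" for n f
    by (rule continuous_on_compose2[OF flat that]) simp
  have "continuous_on {1..2} bump'"
    unfolding bump'_def[abs_def]
    by (intro continuous_on_diff continuous_on_mult comp continuous_on_const continuous_on_id)
  then have "compact (bump' ` {1..2})" by (intro compact_continuous_image) auto
  then obtain K where K: "\<And>y. y \<in> bump' ` {1..2} \<Longrightarrow> \<bar>y\<bar> \<le> K"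
    by (meson compact_imp_bounded bounded_real)
  show ?thesis
  proof (rule that[of "max K 1"])
    show "\<bar>bump' t\<bar> \<le> max K 1" for t
    proof (cases "t \<in> {1..2}")
      case True
      then have "\<bar>bump' t\<bar> \<le> K" by (intro K imageI)
      then show ?thesis by simp
    next
      case False
      then have "bump' t = 0" by (intro bump_outside(2)) auto
      then show ?thesis by simp
    qed
  qed auto
qed

text \<open>
  With \<open>q = |x|\<^sup>2\<close> the first factor is \<open>|x|\<close> to the power \<open>-2a\<close>, and the second one cuts off in the logarithmic
  variable \<open>-c ln q\<close>. In the application \<open>a = N / (2p)\<close> and \<open>c = N / (2L)\<close>.
\<close>

definition profile :: "real \<Rightarrow> real \<Rightarrow> real \<Rightarrow> real" where
  "profile a c q = (if 0 < q then exp (- a * ln q) * bump (- c * ln q) else 0)"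

definition profile' :: "real \<Rightarrow> real \<Rightarrow> real \<Rightarrow> real" where
  "profile' a c q = (if 0 < q then exp (- a * ln q) * (- a * bump (- c * ln q) - c * bump' (- c * ln q)) / q else 0)"

lemma profile_near_0:
  assumes "0 < c" "q < exp (- 2 / c)"
  shows "profile a c q = 0" "profile' a c q = 0"
proof -
  have "2 \<le> - c * ln q" if "0 < q"
  proof -
    have "ln q < - 2 / c" using assms(2) that by (metis ln_exp ln_less_cancel_iff exp_gt_zero)
    then show ?thesis using assms(1) by (simp add: field_simps)
  qed
  then show "profile a c q = 0" "profile' a c q = 0"
    by (auto simp: profile_def profile'_def bump_outside)
qed

lemma profile_beyond:
  assumes "0 < c" "exp (- 1 / c) < q"
  shows "profile a c q = 0"
proof -
  have q: "0 < q" using assms(2) exp_gt_zero[of "- 1 / c"] by linarith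
  have "- 1 / c < ln q" using assms(2) q by (metis ln_exp ln_less_cancel_iff exp_gt_zero)
  then have "- c * ln q \<le> 1" using assms(1) by (simp add: field_simps)
  then show ?thesis by (simp add: profile_def bump_outside)
qed

lemma smooth_profile:
  assumes c: "0 < c"
  shows "smooth_on k UNIV (profile a c)"
proof -
  have lin: "smooth_on k {0<..} (\<lambda>q. b * ln q)" for b
    by (intro smooth_on_mult smooth_on_const smooth_on_ln open_greaterThan)
  have "smooth_on k {0<..} (\<lambda>q. exp (- a * ln q) * bump (- c * ln q))"
    by (intro smooth_on_mult open_greaterThan
        smooth_on_compose[OF open_greaterThan UNIV_I lin smooth_on_exp]
        smooth_on_compose[OF open_greaterThan UNIV_I lin smooth_bump])
  then have 1: "smooth_on k {0<..} (profile a c)"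
    by (rule smooth_on_cong[OF open_greaterThan, rotated]) (simp add: profile_def)
  have 2: "smooth_on k {..<exp (- 2 / c)} (profile a c)"
    by (rule smooth_on_cong[OF open_lessThan _ smooth_on_const[OF open_lessThan, of k _ 0]])
       (use profile_near_0(1)[OF c] in auto)
  have "{0<..} \<union> {..<exp (- 2 / c)} = UNIV"
  proof -
    have "0 < x \<or> x < exp (- 2 / c)" for x :: real using exp_gt_zero[of "- 2 / c"] by linarith
    then show ?thesis by auto
  qed
  then show ?thesis using smooth_on_Un[OF _ _ 1 2] by simp
qed

lemma DERIV_profile:
  assumes c: "0 < c"
  shows "(profile a c has_real_derivative profile' a c q) (at q)"
proof (cases "0 < q")
  case True
  have d: "((\<lambda>q. b * ln q) has_real_derivative b * (1 / q)) (at q)" for b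
    by (rule DERIV_cmult) (rule DERIV_ln_divide[OF True])
  have "((\<lambda>q. exp (- a * ln q) * bump (- c * ln q)) has_real_derivative
      exp (- a * ln q) * (- a * (1 / q)) * bump (- c * ln q) + bump' (- c * ln q) * (- c * (1 / q)) * exp (- a * ln q)) (at q)"
    by (rule DERIV_mult[OF DERIV_chain2[OF DERIV_exp d] DERIV_chain2[OF DERIV_bump d]])
  moreover have "exp (- a * ln q) * (- a * (1 / q)) * bump (- c * ln q) + bump' (- c * ln q) * (- c * (1 / q)) * exp (- a * ln q)
      = profile' a c q"
    using True by (simp add: profile'_def field_simps)
  moreover have "\<forall>\<^sub>F s in nhds q. profile a c s = exp (- a * ln s) * bump (- c * ln s)"
    using eventually_nhds_in_open[of "{0<..}" q] True by (auto simp: profile_def elim!: eventually_mono)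
  ultimately show ?thesis
    by (subst DERIV_cong_ev[OF refl _ refl]) auto
next
  case False
  then have q: "q < exp (- 2 / c)" using exp_gt_zero[of "- 2 / c"] by linarith
  have "\<forall>\<^sub>F s in nhds q. profile a c s = 0"
    using eventually_nhds_in_open[of "{..<exp (- 2 / c)}" q] q profile_near_0(1)[OF c]
    by (auto elim!: eventually_mono)
  then show ?thesis
    using profile_near_0(2)[OF c q] by (subst DERIV_cong_ev[OF refl _ refl]) auto
qed

text \<open>
  As a function of \<open>q = |x|\<^sup>2\<close> this is \<open>|x|\<close> to the power \<open>-N\<close>, the density of a dilation invariant measure.
\<close>

definition hweight :: "nat \<Rightarrow> real \<Rightarrow> real" where
  "hweight N q = (if 0 < q then exp (- (real N / 2) * ln q) else 0)"

definition shell :: "nat \<Rightarrow> real \<Rightarrow> real \<Rightarrow> real \<Rightarrow> ennreal" where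
  "shell N c \<alpha> \<beta> = (\<integral>\<^sup>+x. ennreal (hweight N (sqd N (\<lambda>_. 0) x)) * indicator {\<alpha>..<\<beta>} (- c * ln (sqd N (\<lambda>_. 0) x)) \<partial>lebB N)"

lemma measurable_hweight [measurable]: "hweight N \<in> borel_measurable borel"
  unfolding hweight_def[abs_def] by measurable

lemma sqd_scale: "sqd N (\<lambda>_. 0) (aff N (\<lambda>_. 0) \<kappa> x) = \<kappa>\<^sup>2 * sqd N (\<lambda>_. 0) x"
  by (simp add: sqd_def aff_def power_mult_distrib sum_distrib_left)

text \<open>
  A dilation by \<open>\<kappa>\<close> with \<open>\<kappa>\<^sup>2 = exp (-\<tau> / c)\<close> shifts the logarithmic variable by \<open>\<tau>\<close> and preserves the weighted
  measure.
\<close>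

lemma shell_scale:
  assumes c: "0 < c"
  shows "shell N c (\<alpha> + \<tau>) (\<beta> + \<tau>) = shell N c \<alpha> \<beta>"
proof -
  define \<kappa> where "\<kappa> = exp (- \<tau> / (2 * c))"
  have \<kappa>: "0 < \<kappa>" by (simp add: \<kappa>_def)
  have \<kappa>N: "\<kappa> ^ N = exp (- (real N * \<tau> / (2 * c)))"
    unfolding \<kappa>_def by (simp add: exp_of_nat_mult[symmetric])
  have lnq: "ln (\<kappa>\<^sup>2 * q) = ln q - \<tau> / c" if "0 < q" for q
  proof -
    have "\<kappa>\<^sup>2 = exp (- \<tau> / c)" by (simp add: \<kappa>_def power2_eq_square exp_add[symmetric])
    then show ?thesis using that by (simp add: ln_mult)
  qed
  let ?f = "\<lambda>q. ennreal (hweight N q) * indicator {\<alpha> + \<tau>..<\<beta> + \<tau>} (- c * ln q)"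
  have pt: "ennreal (\<kappa> ^ N) * ?f (\<kappa>\<^sup>2 * q) = ennreal (hweight N q) * indicator {\<alpha>..<\<beta>} (- c * ln q)" if "0 \<le> q" for q
  proof (cases "q = 0")
    case False
    then have q: "0 < q" using that by simp
    then have q': "0 < \<kappa>\<^sup>2 * q" using \<kappa> by simp
    have w: "\<kappa> ^ N * hweight N (\<kappa>\<^sup>2 * q) = hweight N q"
    proof -
      have "\<kappa> ^ N * hweight N (\<kappa>\<^sup>2 * q) = exp (- (real N * \<tau> / (2 * c)) + - (real N / 2) * (ln q - \<tau> / c))"
        using q' by (simp only: hweight_def if_True lnq[OF q] \<kappa>N exp_add)
      also have "- (real N * \<tau> / (2 * c)) + - (real N / 2) * (ln q - \<tau> / c) = - (real N / 2) * ln q"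
        using c by (simp add: field_simps)
      finally show ?thesis using q by (simp add: hweight_def)
    qed
    have i: "- c * ln (\<kappa>\<^sup>2 * q) = - c * ln q + \<tau>"
      unfolding lnq[OF q] using c by (simp add: field_simps)
    have "ennreal (\<kappa> ^ N) * ?f (\<kappa>\<^sup>2 * q) = ennreal (\<kappa> ^ N * hweight N (\<kappa>\<^sup>2 * q)) * indicator {\<alpha> + \<tau>..<\<beta> + \<tau>} (- c * ln q + \<tau>)"
      unfolding i using \<kappa> by (simp add: ennreal_mult'[symmetric] mult.assoc[symmetric])
    also have "\<dots> = ennreal (hweight N q) * indicator {\<alpha>..<\<beta>} (- c * ln q)"
      unfolding w by (simp add: indicator_def)
    finally show ?thesis .
  qed (simp add: hweight_def)
  have "shell N c (\<alpha> + \<tau>) (\<beta> + \<tau>) = ennreal (\<bar>\<kappa>\<bar> ^ N) * (\<integral>\<^sup>+x. ?f (sqd N (\<lambda>_. 0) (aff N (\<lambda>_. 0) \<kappa> x)) \<partial>lebB N)"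
    unfolding shell_def by (rule nn_integral_aff) (use \<kappa> in simp, measurable)
  also have "\<dots> = (\<integral>\<^sup>+x. ennreal (\<kappa> ^ N) * ?f (\<kappa>\<^sup>2 * sqd N (\<lambda>_. 0) x) \<partial>lebB N)"
  proof -
    have "(\<lambda>x. ?f (\<kappa>\<^sup>2 * sqd N (\<lambda>_. 0) x)) \<in> borel_measurable (lebB N)" by measurable
    from nn_integral_cmult[OF this, of "ennreal (\<kappa> ^ N)"] \<kappa> show ?thesis
      by (simp add: sqd_scale)
  qed
  also have "\<dots> = shell N c \<alpha> \<beta>"
    unfolding shell_def by (intro nn_integral_cong pt sqd_nonneg)
  finally show ?thesis .
qed

lemma shell_split:
  assumes "\<alpha> \<le> \<beta>" "\<beta> \<le> \<gamma>"
  shows "shell N c \<alpha> \<gamma> = shell N c \<alpha> \<beta> + shell N c \<beta> \<gamma>"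
  unfolding shell_def
  by (subst nn_integral_add[symmetric])
     (measurable, use assms in \<open>auto intro!: nn_integral_cong split: split_indicator\<close>)

text \<open>
  This compares the shell where the derivative of the cut-off lives with the shell where the cut-off is
  bounded below, by a factor that does not depend on \<open>N\<close> or \<open>L\<close>.
\<close>

lemma shell_three:
  assumes "0 < c"
  shows "shell N c 1 2 = 3 * shell N c (4 / 3) (5 / 3)"
proof -
  have "shell N c 1 2 = shell N c 1 (4 / 3) + (shell N c (4 / 3) (5 / 3) + shell N c (5 / 3) 2)"
    using shell_split[of 1 "4 / 3" 2 N c] shell_split[of "4 / 3" "5 / 3" 2 N c] by simp
  also have "shell N c 1 (4 / 3) = shell N c (4 / 3) (5 / 3)"
    using shell_scale[OF assms, of N 1 "1 / 3" "4 / 3"] by simp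
  also have "shell N c (5 / 3) 2 = shell N c (4 / 3) (5 / 3)"
    using shell_scale[OF assms, of N "4 / 3" "1 / 3" "5 / 3"] by simp
  also have "shell N c (4 / 3) (5 / 3) + (shell N c (4 / 3) (5 / 3) + shell N c (4 / 3) (5 / 3)) = 3 * shell N c (4 / 3) (5 / 3)"
  proof -
    have "x + (x + x) = 3 * x" for x :: ennreal
    proof -
      have "(3 :: ennreal) = 1 + (1 + 1)" by simp
      then show ?thesis by (simp only: distrib_right mult_1)
    qed
    then show ?thesis .
  qed
  finally show ?thesis .
qed

lemma open_positive_measure:
  assumes "1 \<le> N" "openin (euclid N) E" "E \<noteq> {}"
  shows "0 < emeasure (lebB N) E"
proof -
  obtain z where "z \<in> E" using assms(3) by auto
  then obtain r where r: "0 < r" "\<And>x. x \<in> pts N \<Longrightarrow> sqd N z x \<le> r\<^sup>2 \<Longrightarrow> x \<in> E"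
    using open_contains_ball[OF assms(2)] by metis
  have "0 < emeasure (lebB N) {x \<in> pts N. sqd N z x < r\<^sup>2}"
    by (rule ball_positive_measure[OF assms(1) r(1)])
  also have "\<dots> \<le> emeasure (lebB N) E"
    by (rule emeasure_mono[OF _ openin_imp_sets[OF assms(2)]]) (use r(2) in auto)
  finally show ?thesis .
qed

text \<open>
  With \<open>\<sigma> = -(N/L) ln |x|\<close> and \<open>b\<close> the bump function, the test function is \<open>u = |x|\<close> to the power \<open>-N/p\<close> times \<open>b(\<sigma>)\<close>,
  and \<open>|\<nabla>u|\<close> is at most \<open>N/|x|\<close> times the same power times \<open>b(\<sigma>)/p + |b'(\<sigma>)|/L\<close>. On the support \<open>\<sigma> < 2\<close>, so
  \<open>1/|x|\<close> is at most \<open>exp (2L/N)\<close>. The first summand contributes the Rayleigh quotient \<open>(1/p)\<^sup>p\<close>; the second one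
  is integrated over a shell whose weighted measure is controlled by \<open>\<integral>|u|\<^sup>p\<close>.
\<close>

lemma eigenvalue_ball_le:
  fixes p s L K :: real
  assumes p: "1 < p" and N: "1 \<le> N" and L: "0 < L" and s: "0 < s" "s < 1"
    and K: "0 < K" "\<And>t. \<bar>bump' t\<bar> \<le> K"
  shows "eigenvalue_p N p (uball N) \<le>
    (real N * exp (2 * L / real N)) powr p *
      (s powr (1 - p) * (1 / p) powr p + (1 - s) powr (1 - p) * (K / L) powr p * (3 / exp (- 6) powr p))"
proof -
  define a where "a = real N / (2 * p)"
  define c where "c = real N / (2 * L)"
  have c: "0 < c" using N L by (simp add: c_def)
  have p0: "0 < p" using p by simp
  let ?q = "sqd N (\<lambda>_. 0)"
  define u where "u x = profile a c (?q x)" for x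
  define r where "r = exp (- 1 / (2 * c))"
  have r2: "r\<^sup>2 = exp (- 1 / c)" by (simp add: r_def power2_eq_square exp_add[symmetric])
  have r: "0 < r" by (simp add: r_def)
  have r1: "r\<^sup>2 < 1" unfolding r2 using c by simp
  have u: "u \<in> Cinf_c N (uball N)"
    unfolding u_def[abs_def]
  proof (rule radial_in_Cinf_c[OF smooth_profile[OF c] _ r])
    show "profile a c q = 0" if "r\<^sup>2 < q" for q
      using that unfolding r2 by (rule profile_beyond[OF c])
    show "x \<in> uball N" if "x \<in> pts N" "?q x \<le> r\<^sup>2" for x
      using that r1 by (simp add: uball_def)
  qed
  have Es: "uball N \<in> sets (lebB N)"
    using uball_body[of N] by (auto simp: open_convex_bodies_def intro: openin_imp_sets)
  define du where "du = gnorm N (\<lambda>i. partial_deriv i u)"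
  have du: "du x = \<bar>profile' a c (?q x)\<bar> * (2 * sqrt (?q x))" if x: "x \<in> pts N" for x
  proof -
    have "partial_deriv i u x = profile' a c (?q x) * (2 * (x i - 0))" if "i < N" for i
      unfolding partial_deriv_def u_def
      by (rule DERIV_imp_deriv, rule DERIV_chain2[where f="profile a c"])
         (use DERIV_profile[OF c] has_C1D(3)[OF has_C1_sqd x that, of "\<lambda>_. 0"] in auto)
    then have "du x = gnorm N (\<lambda>i x. profile' a c (?q x) * (2 * (x i - 0))) x"
      unfolding du_def gnorm_def enorm_def by (intro L2_set_cong) auto
    also have "\<dots> = \<bar>profile' a c (?q x)\<bar> * (2 * sqrt (?q x))"
      unfolding gnorm_scale[of N "\<lambda>x. profile' a c (?q x)"] gnorm_sqd ..
    finally show ?thesis .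
  qed
  define \<sigma> where "\<sigma> x = - c * ln (?q x)" for x
  define w where "w x = hweight N (?q x)" for x
  have w0: "0 \<le> w x" for x by (simp add: w_def hweight_def)
  have up: "\<bar>u x\<bar> powr p = w x * bump (\<sigma> x) powr p" for x
  proof (cases "0 < ?q x")
    case True
    have "exp (- a * ln (?q x)) powr p = w x"
      using True p by (simp add: w_def hweight_def exp_powr_real a_def)
    then show ?thesis using True by (simp add: u_def profile_def \<sigma>_def abs_mult powr_mult)
  qed (simp add: u_def profile_def w_def hweight_def)
  define M where "M = (real N * exp (2 * L / real N)) powr p"
  define A where "A = M * (s powr (1 - p) * (1 / p) powr p)"
  define B where "B = M * ((1 - s) powr (1 - p) * (K / L) powr p)"
  have M0: "0 \<le> M" and A0: "0 \<le> A" and B0: "0 \<le> B" by (auto simp: M_def A_def B_def)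
  have dup: "du x powr p \<le> A * \<bar>u x\<bar> powr p + B * (w x * indicator {1..<2} (\<sigma> x))" if x: "x \<in> pts N" for x
  proof (cases "0 < ?q x \<and> 1 < \<sigma> x \<and> \<sigma> x < 2")
    case True
    then have q: "0 < ?q x" and \<sigma>: "1 < \<sigma> x" "\<sigma> x < 2" by auto
    define y where "y = ln (?q x)"
    have qy: "?q x = exp y" using q by (simp add: y_def)
    have sq: "sqrt (?q x) / ?q x = exp (- y / 2)"
    proof -
      have "sqrt (?q x) = exp (y / 2)" unfolding qy by (rule real_sqrt_unique) (auto simp: power2_eq_square exp_add[symmetric])
      then show ?thesis unfolding qy by (simp add: exp_diff[symmetric])
    qed
    have "du x = exp (- a * y) * \<bar>a * bump (\<sigma> x) + c * bump' (\<sigma> x)\<bar> * 2 * (sqrt (?q x) / ?q x)"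
    proof -
      have "- a * bump (\<sigma> x) - c * bump' (\<sigma> x) = - (a * bump (\<sigma> x) + c * bump' (\<sigma> x))" by simp
      then have "\<bar>- a * bump (\<sigma> x) - c * bump' (\<sigma> x)\<bar> = \<bar>a * bump (\<sigma> x) + c * bump' (\<sigma> x)\<bar>"
        by (simp only: abs_minus_cancel)
      then show ?thesis
        using q unfolding du[OF x] profile'_def by (simp add: y_def \<sigma>_def abs_mult)
    qed
    also have "\<dots> \<le> exp (- a * y) * (real N / 2 * (bump (\<sigma> x) / p + K / L)) * 2 * exp (2 * L / real N)"
    proof -
      have "\<bar>a * bump (\<sigma> x) + c * bump' (\<sigma> x)\<bar> \<le> a * bump (\<sigma> x) + c * K"
      proof -
        have "\<bar>a * bump (\<sigma> x)\<bar> = a * bump (\<sigma> x)" using p by (simp add: a_def)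
        moreover have "\<bar>c * bump' (\<sigma> x)\<bar> \<le> c * K" using c K(2) by (simp add: abs_mult)
        ultimately show ?thesis by linarith
      qed
      also have "\<dots> = real N / 2 * (bump (\<sigma> x) / p + K / L)"
        using p L by (simp add: a_def c_def field_simps)
      finally have 1: "\<bar>a * bump (\<sigma> x) + c * bump' (\<sigma> x)\<bar> \<le> real N / 2 * (bump (\<sigma> x) / p + K / L)" .
      have "- y / 2 \<le> 2 * L / real N"
        using \<sigma>(2) N L by (simp add: \<sigma>_def y_def[symmetric] c_def field_simps)
      then have 2: "sqrt (?q x) / ?q x \<le> exp (2 * L / real N)" unfolding sq by simp
      have 3: "0 \<le> sqrt (?q x) / ?q x" unfolding sq by simp
      show ?thesis
        using 1 2 3 p K(1) L by (intro mult_mono) auto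
    qed
    also have "\<dots> = (real N * exp (2 * L / real N)) * exp (- a * y) * (bump (\<sigma> x) / p + K / L)"
      by simp
    finally have "du x powr p \<le> ((real N * exp (2 * L / real N)) * exp (- a * y) * (bump (\<sigma> x) / p + K / L)) powr p"
      using p0 by (intro powr_mono2) (auto simp: du_def)
    also have "\<dots> = M * w x * (bump (\<sigma> x) / p + K / L) powr p"
    proof -
      have "exp (- a * y) powr p = w x"
        using q p by (simp add: w_def hweight_def exp_powr_real a_def y_def)
      then show ?thesis by (simp only: powr_mult M_def)
    qed
    also have "\<dots> \<le> M * w x * (s powr (1 - p) * (bump (\<sigma> x) / p) powr p + (1 - s) powr (1 - p) * (K / L) powr p)"
      using p K(1) L M0 w0 by (intro mult_left_mono powr_sum_le s) auto
    also have "\<dots> = A * \<bar>u x\<bar> powr p + B * (w x * indicator {1..<2} (\<sigma> x))"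
    proof -
      have "(bump (\<sigma> x) / p) powr p = (1 / p) powr p * bump (\<sigma> x) powr p"
        using p by (simp add: powr_mult[symmetric])
      then show ?thesis
        unfolding up A_def B_def using \<sigma> by (simp only: ring_distribs) (simp add: mult_ac)
    qed
    finally show ?thesis .
  next
    case False
    have "profile' a c (?q x) = 0"
    proof (cases "0 < ?q x")
      case True
      then have "\<sigma> x \<le> 1 \<or> 2 \<le> \<sigma> x" using False by auto
      then show ?thesis using bump_outside[of "\<sigma> x"] by (simp add: profile'_def \<sigma>_def)
    qed (simp add: profile'_def)
    then have "du x powr p = 0" using p by (simp add: du[OF x])
    moreover have "0 \<le> A * \<bar>u x\<bar> powr p + B * (w x * indicator {1..<2} (\<sigma> x))"
      using A0 B0 w0 by auto
    ultimately show ?thesis by simp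
  qed
  define J where "J = (\<integral>x. \<bar>u x\<bar> powr p \<partial>lebB N)"
  obtain rr where rr: "vanishes_off_cube N rr u" using Cinf_cD(2)[OF u] by blast
  note C1 = Cinf_cD(1)[OF u]
  have iu: "integrable (lebB N) (\<lambda>x. \<bar>u x\<bar> powr p)"
    by (rule integrable_abs_powr[OF has_C1D(1)[OF C1] rr p0])
  have idu: "integrable (lebB N) (\<lambda>x. du x powr p)"
  proof -
    have "integrable (lebB N) (\<lambda>x. \<bar>du x\<bar> powr p)"
      unfolding du_def
      by (rule integrable_abs_powr[OF continuous_map_gnorm[OF has_C1D(2)[OF C1]] gnorm_vanishes[OF has_C1_vanishes[OF C1 rr]] p0])
    then show ?thesis by (simp add: du_def)
  qed
  have eJ: "(\<integral>\<^sup>+x. ennreal (\<bar>u x\<bar> powr p) \<partial>lebB N) = ennreal J"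
    unfolding J_def by (rule nn_integral_eq_integral[OF iu]) auto
  have J0: "0 \<le> J" unfolding J_def by (rule integral_nonneg_AE) auto
  define c0 where "c0 = exp (- 6 :: real) powr p"
  have c0: "0 < c0" by (simp add: c0_def)
  have [measurable]: "w \<in> borel_measurable (lebB N)" "\<sigma> \<in> borel_measurable (lebB N)"
    unfolding w_def[abs_def] \<sigma>_def[abs_def] by measurable
  have mid: "ennreal c0 * shell N c (4 / 3) (5 / 3) \<le> ennreal J"
  proof -
    have "ennreal c0 * shell N c (4 / 3) (5 / 3) = (\<integral>\<^sup>+x. ennreal c0 * (ennreal (w x) * indicator {4/3..<5/3} (\<sigma> x)) \<partial>lebB N)"
      unfolding shell_def w_def[symmetric] \<sigma>_def[symmetric] by (rule nn_integral_cmult[symmetric]) measurable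
    also have "\<dots> \<le> (\<integral>\<^sup>+x. ennreal (\<bar>u x\<bar> powr p) \<partial>lebB N)"
    proof (rule nn_integral_mono)
      fix x
      show "ennreal c0 * (ennreal (w x) * indicator {4/3..<5/3} (\<sigma> x)) \<le> ennreal (\<bar>u x\<bar> powr p)"
      proof (cases "\<sigma> x \<in> {4/3..<5/3}")
        case True
        then have "c0 \<le> bump (\<sigma> x) powr p"
          unfolding c0_def using p0 bump_middle[of "\<sigma> x"] by (intro powr_mono2) auto
        then have "c0 * w x \<le> \<bar>u x\<bar> powr p" unfolding up mult.commute[of "w x"] by (intro mult_right_mono w0)
        then show ?thesis using True w0[of x] c0 by (simp add: ennreal_mult'[symmetric] ennreal_leI)
      qed simp
    qed
    finally show ?thesis unfolding eJ .
  qed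
  define m where "m = enn2real (shell N c (4 / 3) (5 / 3))"
  have shf: "shell N c (4 / 3) (5 / 3) = ennreal m"
  proof -
    have "shell N c (4 / 3) (5 / 3) \<noteq> \<infinity>"
    proof
      assume "shell N c (4 / 3) (5 / 3) = \<infinity>"
      then show False using mid c0 by (simp add: ennreal_mult_top top_unique)
    qed
    then show ?thesis by (simp add: m_def less_top)
  qed
  have m0: "0 \<le> m" by (simp add: m_def)
  have mJ: "c0 * m \<le> J"
    using mid c0 m0 J0 unfolding shf by (simp add: ennreal_mult'[symmetric] ennreal_le_iff)
  have "ennreal (\<integral>x. du x powr p \<partial>lebB N) = (\<integral>\<^sup>+x. ennreal (du x powr p) \<partial>lebB N)"
    by (rule nn_integral_eq_integral[OF idu, symmetric]) auto
  also have "\<dots> \<le> (\<integral>\<^sup>+x. ennreal A * ennreal (\<bar>u x\<bar> powr p) + ennreal B * (ennreal (w x) * indicator {1..<2} (\<sigma> x)) \<partial>lebB N)"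
  proof (rule nn_integral_mono)
    fix x assume "x \<in> space (lebB N)"
    then have x: "x \<in> pts N" by simp
    have "ennreal (du x powr p) \<le> ennreal (A * \<bar>u x\<bar> powr p + B * (w x * indicator {1..<2} (\<sigma> x)))"
      by (rule ennreal_leI[OF dup[OF x]])
    also have "\<dots> = ennreal A * ennreal (\<bar>u x\<bar> powr p) + ennreal B * (ennreal (w x) * indicator {1..<2} (\<sigma> x))"
      using A0 B0 w0[of x] by (cases "\<sigma> x \<in> {1..<2}") (auto simp: ennreal_mult'[symmetric] ennreal_plus[symmetric] simp del: ennreal_plus)
    finally show "ennreal (du x powr p) \<le> ennreal A * ennreal (\<bar>u x\<bar> powr p) + ennreal B * (ennreal (w x) * indicator {1..<2} (\<sigma> x))" .
  qed
  also have "\<dots> = ennreal A * ennreal J + ennreal B * shell N c 1 2"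
  proof -
    have [measurable]: "u \<in> borel_measurable (lebB N)" by (rule has_C1D(4)[OF C1])
    have "(\<integral>\<^sup>+x. ennreal A * ennreal (\<bar>u x\<bar> powr p) + ennreal B * (ennreal (w x) * indicator {1..<2} (\<sigma> x)) \<partial>lebB N)
      = (\<integral>\<^sup>+x. ennreal A * ennreal (\<bar>u x\<bar> powr p) \<partial>lebB N) + (\<integral>\<^sup>+x. ennreal B * (ennreal (w x) * indicator {1..<2} (\<sigma> x)) \<partial>lebB N)"
      by (rule nn_integral_add) measurable
    also have "(\<integral>\<^sup>+x. ennreal A * ennreal (\<bar>u x\<bar> powr p) \<partial>lebB N) = ennreal A * ennreal J"
      unfolding eJ[symmetric] by (rule nn_integral_cmult) measurable
    also have "(\<integral>\<^sup>+x. ennreal B * (ennreal (w x) * indicator {1..<2} (\<sigma> x)) \<partial>lebB N) = ennreal B * shell N c 1 2"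
      unfolding shell_def w_def[symmetric] \<sigma>_def[symmetric] by (rule nn_integral_cmult) measurable
    finally show ?thesis .
  qed
  also have "\<dots> = ennreal (A * J + B * (3 * m))"
  proof -
    have "3 * ennreal m = ennreal (3 * m)"
      using m0 by (simp add: ennreal_mult)
    then show ?thesis
      unfolding shell_three[OF c] shf using A0 B0 J0 m0
      by (simp only: ennreal_mult[symmetric] ennreal_plus[symmetric] mult_nonneg_nonneg zero_le_numeral)
  qed
  finally have "(\<integral>x. du x powr p \<partial>lebB N) \<le> A * J + B * (3 * m)"
    using A0 B0 J0 m0 by (subst (asm) ennreal_le_iff) auto
  also have "\<dots> \<le> A * J + B * (3 / c0 * J)"
  proof -
    have "3 * m \<le> 3 / c0 * J" using mJ c0 by (simp add: field_simps)
    then show ?thesis using B0 by (intro add_left_mono mult_left_mono) auto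
  qed
  also have "\<dots> = (A + B * (3 / c0)) * J" by (simp add: algebra_simps)
  finally have up_bound: "(\<integral>x. du x powr p \<partial>lebB N) \<le> (A + B * (3 / c0)) * J" .
  have Jpos: "0 < J"
  proof (rule ccontr)
    assume "\<not> 0 < J"
    then have "J = 0" using J0 by linarith
    then have "(\<integral>x. \<bar>u x\<bar> powr p \<partial>lebB N) = 0" by (simp only: J_def)
    then have "AE x in lebB N. \<bar>u x\<bar> powr p = 0"
      by (subst (asm) integral_nonneg_eq_0_iff_AE[OF iu]) auto
    moreover define Q where "Q = {x \<in> topspace (euclid N). ?q x \<in> {exp (- (5/3) / c)<..<exp (- (4/3) / c)}}"
    have Q: "openin (euclid N) Q"
      unfolding Q_def by (rule openin_continuous_map_preimage[OF has_C1D(1)[OF has_C1_sqd]]) simp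
    have upos: "0 < \<bar>u x\<bar> powr p" if "x \<in> Q" for x
    proof -
      have b: "exp (- (5/3) / c) < ?q x" "?q x < exp (- (4/3) / c)" using that by (auto simp: Q_def)
      have q: "0 < ?q x" using b(1) exp_gt_zero[of "- (5/3) / c"] by linarith
      have "- (5/3) / c < ln (?q x)" "ln (?q x) < - (4/3) / c"
        using b q by (metis ln_exp ln_less_cancel_iff exp_gt_zero)+
      then have "4 / 3 \<le> \<sigma> x" "\<sigma> x \<le> 5 / 3" using c by (auto simp: \<sigma>_def field_simps)
      from bump_middle[OF this] have "0 < bump (\<sigma> x)" using exp_gt_zero[of "-6"] by linarith
      then show ?thesis unfolding up using q by (simp add: w_def hweight_def)
    qed
    ultimately have "AE x in lebB N. x \<notin> Q" by (auto elim!: eventually_mono dest: upos)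
    then have "emeasure (lebB N) Q = 0"
      using AE_iff_measurable[OF openin_imp_sets[OF Q], of "\<lambda>x. x \<notin> Q"] openin_subset[OF Q] by auto
    moreover have "Q \<noteq> {}"
    proof -
      \<comment> \<open>The point on the first axis in the middle of the shell.\<close>
      define \<theta> where "\<theta> = exp (- (3/2) / (2 * c))"
      define x :: point where "x = (\<lambda>i\<in>{..<N}. if i = 0 then \<theta> else 0)"
      have "?q x = \<theta>\<^sup>2"
      proof -
        have "?q x = (\<Sum>i<N. if i = 0 then \<theta>\<^sup>2 else 0)"
          unfolding sqd_def by (intro sum.cong) (auto simp: x_def)
        then show ?thesis using N by simp
      qed
      also have "\<dots> = exp (- (3/2) / c)" by (simp add: \<theta>_def power2_eq_square exp_add[symmetric])
      finally have "?q x = exp (- (3/2) / c)" .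
      moreover have "- (5/3) / c < - (3/2) / c" "- (3/2) / c < - (4/3) / c"
        using c by (intro divide_strict_right_mono; simp)+
      moreover have "x \<in> pts N" by (simp add: x_def)
      ultimately have "x \<in> Q"
        unfolding Q_def by (simp only: mem_Collect_eq topspace_euclid greaterThanLessThan_iff exp_less_cancel_iff simp_thms)
      then show ?thesis by blast
    qed
    ultimately show False using open_positive_measure[OF N Q] by simp
  qed
  have "eigenvalue_p N p (uball N) * J \<le> (A + B * (3 / c0)) * J"
    using order_trans[OF eigenvalue_le_Rayleigh(1)[OF u Es p Jpos[unfolded J_def]] up_bound[unfolded du_def]]
    by (simp only: J_def)
  then have "eigenvalue_p N p (uball N) \<le> A + B * (3 / c0)"
    by (rule mult_right_le_imp_le) (rule Jpos)
  also have "\<dots> = M * (s powr (1 - p) * (1 / p) powr p + (1 - s) powr (1 - p) * (K / L) powr p * (3 / c0))"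
    by (simp add: A_def B_def algebra_simps)
  finally show ?thesis unfolding M_def c0_def .
qed

text \<open>
  The parameters are fixed in the order \<open>s\<close> close to one, then \<open>L\<close> large, and finally \<open>N\<close> tends to infinity.
\<close>

lemma m_p_eventually_less:
  fixes p \<epsilon> :: real
  assumes p: "1 < p" and \<epsilon>: "0 < \<epsilon>"
  shows "\<forall>\<^sub>F N in sequentially. m_p p N < 1 / p + \<epsilon>"
proof -
  obtain K where K: "0 < K" "\<And>t. \<bar>bump' t\<bar> \<le> K" using bump'_bounded by metis
  define T where "T = (1 / p + \<epsilon>) powr p"
  have T: "(1 / p) powr p < T" unfolding T_def using p \<epsilon> by (intro powr_less_mono2) auto
  define C0 where "C0 = 3 / exp (- 6 :: real) powr p"
  have "((\<lambda>s::real. s powr (1 - p) * (1 / p) powr p) \<longlongrightarrow> 1 powr (1 - p) * (1 / p) powr p) (at_left 1)"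
    by (intro tendsto_intros) auto
  then have "\<forall>\<^sub>F s in at_left 1. s powr (1 - p) * (1 / p) powr p < T"
    using T by (intro order_tendstoD) auto
  moreover have "\<forall>\<^sub>F s in at_left (1::real). 0 < s \<and> s < 1"
    unfolding eventually_at_left_field by (intro exI[of _ 0]) auto
  ultimately have "\<forall>\<^sub>F s in at_left 1. s powr (1 - p) * (1 / p) powr p < T \<and> 0 < s \<and> s < 1"
    by (rule eventually_conj)
  then obtain s where s: "s powr (1 - p) * (1 / p) powr p < T" "0 < s" "s < 1"
    using eventually_happens' [OF trivial_limit_at_left_real] by blast
  have "((\<lambda>L::real. s powr (1 - p) * (1 / p) powr p + (1 - s) powr (1 - p) * (K / L) powr p * C0)
      \<longlongrightarrow> s powr (1 - p) * (1 / p) powr p + (1 - s) powr (1 - p) * 0 * C0) at_top"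
  proof (intro tendsto_intros)
    have "((\<lambda>L::real. K powr p * L powr (- p)) \<longlongrightarrow> K powr p * 0) at_top"
      by (intro tendsto_mult tendsto_const tendsto_neg_powr filterlim_ident) (use p in auto)
    moreover have "\<forall>\<^sub>F L in at_top. K powr p * L powr (- p) = (K / L) powr p"
      using eventually_gt_at_top[of "0::real"]
      by eventually_elim (use K in \<open>simp add: powr_divide powr_minus_divide\<close>)
    ultimately show "((\<lambda>L::real. (K / L) powr p) \<longlongrightarrow> 0) at_top"
      by (simp add: tendsto_cong)
  qed
  then have "\<forall>\<^sub>F L in at_top. s powr (1 - p) * (1 / p) powr p + (1 - s) powr (1 - p) * (K / L) powr p * C0 < T"
    using s(1) by (intro order_tendstoD) auto
  then have "\<forall>\<^sub>F L in at_top. s powr (1 - p) * (1 / p) powr p + (1 - s) powr (1 - p) * (K / L) powr p * C0 < T \<and> 0 < L"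
    using eventually_gt_at_top[of "0::real"] by (rule eventually_conj)
  then obtain L where L: "s powr (1 - p) * (1 / p) powr p + (1 - s) powr (1 - p) * (K / L) powr p * C0 < T" "0 < L"
    using eventually_happens'[OF trivial_limit_at_top_linorder] by blast
  define Y where "Y = s powr (1 - p) * (1 / p) powr p + (1 - s) powr (1 - p) * (K / L) powr p * C0"
  have Y0: "0 \<le> Y" by (simp add: Y_def C0_def)
  have "((\<lambda>N. exp (2 * L / real N) powr p * Y) \<longlongrightarrow> exp 0 powr p * Y) sequentially"
    by (intro tendsto_intros tendsto_divide_0[OF tendsto_const] filterlim_at_top_imp_at_infinity filterlim_real_sequentially) auto
  then have "\<forall>\<^sub>F N in sequentially. exp (2 * L / real N) powr p * Y < T"
    using L(1) by (intro order_tendstoD) (auto simp: Y_def)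
  then show ?thesis
    using eventually_ge_at_top[of 1]
  proof eventually_elim
    case (elim N)
    have N: "1 \<le> N" using elim by simp
    define h where "h = cheeger N (uball N)"
    have h: "real N \<le> h"
    proof -
      have "real N / 1 \<le> h"
        unfolding h_def
        by (rule cheeger_constant(2)[OF N]) (use uball_body[of N] in \<open>auto simp: open_convex_bodies_def uball_iff\<close>)
      then show ?thesis by simp
    qed
    have "eigenvalue_p N p (uball N) \<le> (real N * exp (2 * L / real N)) powr p * Y"
      unfolding Y_def C0_def by (rule eigenvalue_ball_le[OF p N L(2) s(2,3) K])
    also have "\<dots> = real N powr p * (exp (2 * L / real N) powr p * Y)"
      by (simp add: powr_mult)
    finally have ev: "eigenvalue_p N p (uball N) \<le> real N powr p * (exp (2 * L / real N) powr p * Y)" .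
    define Z where "Z = exp (2 * L / real N) powr p * Y"
    have Z0: "0 \<le> Z" using Y0 by (simp add: Z_def)
    have "Z powr (1 / p) < T powr (1 / p)"
      using elim Z0 p by (intro powr_less_mono2) (auto simp: Z_def)
    also have "T powr (1 / p) = 1 / p + \<epsilon>"
      using p \<epsilon> by (simp add: T_def powr_powr add_pos_pos)
    finally have Z1: "Z powr (1 / p) < 1 / p + \<epsilon>" .
    have e0: "0 \<le> eigenvalue_p N p (uball N)"
    proof -
      have Es: "openin (euclid N) (uball N)" "uball N \<noteq> {}"
        using uball_body[of N] by (auto simp: open_convex_bodies_def)
      obtain \<phi> where \<phi>: "\<phi> \<in> Cinf_c N (uball N)" "0 < (\<integral>x. \<bar>\<phi> x\<bar> powr p \<partial>lebB N)"
        by (rule exists_test_function[OF N order_less_trans[OF zero_less_one p] Es]) (rule that; assumption)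
      show ?thesis
        unfolding eigenvalue_p_def
        by (rule cINF_greatest[OF eigenvalue_le_Rayleigh(2)[OF \<phi>(1) openin_imp_sets[OF Es(1)] p \<phi>(2)]])
           (auto intro!: integral_nonneg_AE)
    qed
    have "eigenvalue_p N p (uball N) powr (1 / p) \<le> (real N powr p * Z) powr (1 / p)"
      using ev e0 p by (intro powr_mono2) (auto simp: Z_def)
    also have "\<dots> = real N * Z powr (1 / p)"
      using p by (simp add: powr_mult powr_powr)
    finally have "F_p N p (uball N) \<le> real N * Z powr (1 / p) / h"
      unfolding F_p_def h_def[symmetric] using h by (intro divide_right_mono) auto
    also have "\<dots> \<le> Z powr (1 / p)"
    proof -
      have "real N * Z powr (1 / p) \<le> h * Z powr (1 / p)" using h by (intro mult_right_mono) auto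
      then show ?thesis using h N by (simp add: pos_divide_le_eq mult.commute)
    qed
    finally show ?case using m_p_le_ball[of p N] Z1 by linarith
  qed
qed

theorem corollary3p5:
  fixes p :: real
  assumes "1 < p"
  shows "(\<forall>N::nat. 1 \<le> N \<longrightarrow> 1 / p < m_p p N) \<and> (m_p p \<longlonglongrightarrow> 1 / p)"
proof (intro conjI allI impI)
  show "1 / p < m_p p N" if "1 \<le> N" for N by (rule m_p_gt[OF that assms])
  show "m_p p \<longlonglongrightarrow> 1 / p"
  proof (rule order_tendstoI)
    fix a assume "a < 1 / p"
    have "\<forall>\<^sub>F N in sequentially. 1 \<le> N" by (rule eventually_ge_at_top)
    then show "\<forall>\<^sub>F N in sequentially. a < m_p p N"
      by eventually_elim (use m_p_gt[OF _ assms] \<open>a < 1 / p\<close> in \<open>force intro: less_trans\<close>)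
  next
    fix a assume "1 / p < a"
    then show "\<forall>\<^sub>F N in sequentially. m_p p N < a"
      using m_p_eventually_less[OF assms, of "a - 1 / p"] by simp
  qed
qed

end
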